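(* Let $\Lambda$ be a stationary point process in $\mathbb C$ having a finite second moment, and let $\zeta_\Lambda$ be the random meromorphic function \[ \zeta_\Lambda(z)=\sum_{\lambda\in\Lambda,\,|\lambda|<1}\frac1{z-\lambda}+\sum_{\lambda\in\Lambda,\,|\lambda|\ge 1}\Big(\frac1{z-\lambda}+\frac1\lambda+\frac{z}{\lambda^2}\Big)-\Psi_2(\infty)\,z, \] where $\Psi_2(\infty)$ is the $L^2(\Omega,\mathbb P)$-limit as $R\to\infty$ of $\Psi_2(R)=\sum_{\lambda\in\Lambda,\,1\le|\lambda|\le R}\lambda^{-2}$. Then $\zeta_\Lambda$ has stationary increments: for every $a\in\mathbb C$, the distribution of the random meromorphic function $z\mapsto\zeta_\Lambda(z+a)-\zeta_\Lambda(z)$ is translation invariant.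
   Context: A point process $\Lambda$ in $\mathbb C$ is stationary if its distribution is invariant under translations; it has finite second moment if $\mathbb E[n_\Lambda(B)^2]<\infty$ for every bounded Borel $B$, where $n_\Lambda=\sum_{\lambda\in\Lambda}\delta_\lambda$. Under these hypotheses $\sum_{|\lambda|\ge1}|\lambda|^{-3}<\infty$ almost surely and $\Psi_2(R)$ converges in $L^2(\Omega,\mathbb P)$ as $R\to\infty$, so $\zeta_\Lambda$ is well defined; it is meromorphic with simple poles of residue $1$ exactly at the points of $\Lambda$. A random function is stationary if its finite-dimensional distributions are invariant under all translations $z\mapsto z+w$. *)

theory Defs
  imports "HOL-Probability.Probability"
begin

text \<open>A (simple) point process in the complex plane is modelled as a map
  \<open>\<Lambda> :: 'w \<Rightarrow> complex set\<close> on a probability space; the counting variable of a set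
  \<open>B\<close> is \<open>n_\<Lambda>(B) = card (\<Lambda> \<omega> \<inter> B)\<close>.\<close>

definition locally_finite_set :: "complex set \<Rightarrow> bool" where
  "locally_finite_set S \<longleftrightarrow> (\<forall>B. bounded B \<longrightarrow> finite (S \<inter> B))"

definition point_process :: "'w measure \<Rightarrow> ('w \<Rightarrow> complex set) \<Rightarrow> bool" where
  "point_process M \<Lambda> \<longleftrightarrow>
     (\<forall>\<omega>\<in>space M. locally_finite_set (\<Lambda> \<omega>)) \<and>
     (\<forall>B. B \<in> sets borel \<and> bounded B \<longrightarrow>
        (\<lambda>\<omega>. card (\<Lambda> \<omega> \<inter> B)) \<in> measurable M (count_space UNIV))"

definition stationary_point_process :: "'w measure \<Rightarrow> ('w \<Rightarrow> complex set) \<Rightarrow> bool" where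
  "stationary_point_process M \<Lambda> \<longleftrightarrow>
     (\<forall>w Bs. (\<forall>B\<in>set Bs. B \<in> sets borel \<and> bounded B) \<longrightarrow>
        distr M (count_space UNIV) (\<lambda>\<omega>. map (\<lambda>B. card (\<Lambda> \<omega> \<inter> ((\<lambda>z. z + w) ` B))) Bs)
      = distr M (count_space UNIV) (\<lambda>\<omega>. map (\<lambda>B. card (\<Lambda> \<omega> \<inter> B)) Bs))"

definition finite_second_moment :: "'w measure \<Rightarrow> ('w \<Rightarrow> complex set) \<Rightarrow> bool" where
  "finite_second_moment M \<Lambda> \<longleftrightarrow>
     (\<forall>B. B \<in> sets borel \<and> bounded B \<longrightarrow>
        integrable M (\<lambda>\<omega>. (real (card (\<Lambda> \<omega> \<inter> B)))\<^sup>2))"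

definition Psi2 :: "('w \<Rightarrow> complex set) \<Rightarrow> real \<Rightarrow> 'w \<Rightarrow> complex" where
  "Psi2 \<Lambda> R \<omega> = (\<Sum>l\<in>\<Lambda> \<omega> \<inter> {l. 1 \<le> cmod l \<and> cmod l \<le> R}. 1 / l\<^sup>2)"

text \<open>\<open>\<Psi>_2(\<infinity>)\<close>: an \<open>L\<^sup>2(\<Omega>,P)\<close>-limit of \<open>\<Psi>_2(R)\<close> as \<open>R \<rightarrow> \<infinity>\<close>
  (unique up to a null set).\<close>

definition Psi2_inf :: "'w measure \<Rightarrow> ('w \<Rightarrow> complex set) \<Rightarrow> 'w \<Rightarrow> complex" where
  "Psi2_inf M \<Lambda> = (SOME X. X \<in> borel_measurable M \<and>
      integrable M (\<lambda>\<omega>. (cmod (X \<omega>))\<^sup>2) \<and>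
      ((\<lambda>R. LINT \<omega>|M. (cmod (Psi2 \<Lambda> R \<omega> - X \<omega>))\<^sup>2) \<longlongrightarrow> 0) at_top)"

definition zeta_pp :: "'w measure \<Rightarrow> ('w \<Rightarrow> complex set) \<Rightarrow> complex \<Rightarrow> 'w \<Rightarrow> complex" where
  "zeta_pp M \<Lambda> z \<omega> =
     (\<Sum>l\<in>\<Lambda> \<omega> \<inter> ball 0 1. 1 / (z - l))
   + (\<Sum>\<^sub>\<infinity>l\<in>\<Lambda> \<omega> - ball 0 1. 1 / (z - l) + 1 / l + z / l\<^sup>2)
   - Psi2_inf M \<Lambda> \<omega> * z"

definition stationary_random_fun :: "'w measure \<Rightarrow> (complex \<Rightarrow> 'w \<Rightarrow> complex) \<Rightarrow> bool" where
  "stationary_random_fun M F \<longleftrightarrow>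
     (\<forall>w (n::nat) (zs::nat \<Rightarrow> complex).
        distr M (PiM {..<n} (\<lambda>_. borel)) (\<lambda>\<omega>. restrict (\<lambda>i. F (zs i + w) \<omega>) {..<n})
      = distr M (PiM {..<n} (\<lambda>_. borel)) (\<lambda>\<omega>. restrict (\<lambda>i. F (zs i) \<omega>) {..<n}))"

end

theory Submission
  imports Defs "HOL-Real_Asymp.Real_Asymp"
begin

text \<open>The increment \<open>\<zeta>(z + a) - \<zeta>(z)\<close> is a limit of the sums of \<open>1/(z + a - l) - 1/(z - l)\<close> over
  \<open>\<bar>l\<bar> \<le> R\<close>, because the polynomial corrections add up to \<open>a (\<Psi>\<^sub>2(R) - \<Psi>\<^sub>2(\<infinity>))\<close>. Translating the
  process only moves the disc of summation, and the boundary annulus contributes \<open>O(R) \<cdot> O(R\<^sup>-\<^sup>2)\<close> in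
  mean; so the finite-dimensional laws before and after translation have the same limit.

  The substance is that \<open>\<Psi>\<^sub>2(R)\<close> converges in \<open>L\<^sup>2\<close>. Outside the disc of radius \<open>R\<close>, \<open>1/z\<^sup>2\<close> is
  minus the Beurling transform of \<open>R\<^sup>-\<^sup>2 1(\<bar>z\<bar> \<le> R)\<close>, and a convolution operator which is isometric on
  \<open>L\<^sup>2\<close> of the plane preserves the second moments of linear statistics of a stationary process. Hence
  \<open>\<Psi>\<^sub>2(R') - \<Psi>\<^sub>2(R)\<close> has up to \<open>O(1/R)\<close> the same \<open>L\<^sup>2\<close> norm as the difference of the normalised
  point counts in the discs of radius \<open>R\<close> and \<open>R'\<close>, which tends to zero by the mean ergodic theorem.
  The isometry is used in a discrete form: for unit central differences \<open>D\<^sub>x\<close> and \<open>D\<^sub>y\<close> the cross terms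
  of \<open>D\<^sub>x g \<mp> i D\<^sub>y g\<close> cancel by stationarity, so no regularity of \<open>g\<close> is needed.\<close>

section \<open>Square integrable functions and limits of distributions\<close>

text \<open>A direct bound for \<open>Psi2\<close> fails. For a general stationary process the
  available size estimate for the count in the unit annulus at radius n is a norm of order n, and n
  * n^-2 sums to a logarithm. With n^-3 the sum converges, so errors spread over the plane are
  arranged to decay like the cube, while the main term is treated by an identity instead of an
  estimate. Neither ergodicity nor decay of correlations is assumed, so the normalised counts may
  have a random limit; only their Cauchy property is asked for. The Beurling transform is never
  applied as an operator: a common potential \<open>g\<close> is chosen, the difference of the
  Cauchy transforms of two normalised discs. Both discs have the same mass, so \<open>g\<close>
  vanishes outside the larger one, and its discrete derivatives are the two sides of the isometry.
  As L2 convergence gives almost sure convergence only along suitable radii, laws are compared along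
  one such sequence.\<close>

lemma Cauchy_Schwarz_L2:
  fixes f g :: "'a \<Rightarrow> complex"
  assumes [measurable]: "f \<in> borel_measurable M" "g \<in> borel_measurable M"
    and f: "integrable M (\<lambda>x. (cmod (f x))\<^sup>2)" and g: "integrable M (\<lambda>x. (cmod (g x))\<^sup>2)"
  shows "integrable M (\<lambda>x. cmod (f x) * cmod (g x))"
    and "(LINT x|M. cmod (f x) * cmod (g x)) \<le>
      sqrt (LINT x|M. (cmod (f x))\<^sup>2) * sqrt (LINT x|M. (cmod (g x))\<^sup>2)"
proof -
  have le: "cmod (f x) * cmod (g x) \<le> (cmod (f x))\<^sup>2 + (cmod (g x))\<^sup>2" for x
    using sum_squares_bound[of "cmod (f x)" "cmod (g x)"] mult_nonneg_nonneg[OF norm_ge_zero norm_ge_zero, of "f x" "g x"]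
    by linarith
  show int: "integrable M (\<lambda>x. cmod (f x) * cmod (g x))"
    by (rule Bochner_Integration.integrable_bound[OF Bochner_Integration.integrable_add[OF f g]])
       (use le in \<open>auto simp: abs_mult\<close>)
  define A B C where "A = (LINT x|M. (cmod (f x))\<^sup>2)" and "B = (LINT x|M. (cmod (g x))\<^sup>2)"
    and "C = (LINT x|M. cmod (f x) * cmod (g x))"
  have nn: "A \<ge> 0" "B \<ge> 0" "C \<ge> 0" unfolding A_def B_def C_def by (auto intro!: integral_nonneg_AE)
  have "ennreal (C\<^sup>2) \<le> ennreal (A * B)"
    using Cauchy_Schwarz_nn_integral[of "\<lambda>x. cmod (f x)" M "\<lambda>x. cmod (g x)"]
    using nn_integral_eq_integral[OF int] nn_integral_eq_integral[OF f] nn_integral_eq_integral[OF g] nn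
    by (simp add: A_def B_def C_def ennreal_mult ennreal_power)
  then have "C\<^sup>2 \<le> A * B" using nn by (simp add: ennreal_le_iff)
  then show "C \<le> sqrt A * sqrt B"
    by (metis real_le_rsqrt real_sqrt_mult)
qed

lemma Minkowski_L2:
  fixes f g :: "'a \<Rightarrow> complex"
  assumes [measurable]: "f \<in> borel_measurable M" "g \<in> borel_measurable M"
    and f: "integrable M (\<lambda>x. (cmod (f x))\<^sup>2)" and g: "integrable M (\<lambda>x. (cmod (g x))\<^sup>2)"
  shows "integrable M (\<lambda>x. (cmod (f x + g x))\<^sup>2)"
    and "sqrt (LINT x|M. (cmod (f x + g x))\<^sup>2) \<le>
      sqrt (LINT x|M. (cmod (f x))\<^sup>2) + sqrt (LINT x|M. (cmod (g x))\<^sup>2)"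
proof -
  note fg = Cauchy_Schwarz_L2[OF assms]
  define h where "h x = (cmod (f x))\<^sup>2 + (cmod (g x))\<^sup>2 + 2 * (cmod (f x) * cmod (g x))" for x
  have le: "(cmod (f x + g x))\<^sup>2 \<le> h x" for x
    using power_mono[OF norm_triangle_ineq[of "f x" "g x"], of 2]
    by (simp add: h_def power2_eq_square algebra_simps)
  have h: "integrable M h" unfolding h_def using f g fg by auto
  show int: "integrable M (\<lambda>x. (cmod (f x + g x))\<^sup>2)"
    by (rule Bochner_Integration.integrable_bound[OF h])
       (use le in \<open>auto intro: order_trans[OF _ abs_ge_self]\<close>)
  define A B where "A = (LINT x|M. (cmod (f x))\<^sup>2)" and "B = (LINT x|M. (cmod (g x))\<^sup>2)"
  have nn: "A \<ge> 0" "B \<ge> 0" unfolding A_def B_def by (auto intro!: integral_nonneg_AE)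
  have "(LINT x|M. (cmod (f x + g x))\<^sup>2) \<le> (LINT x|M. h x)"
    by (intro integral_mono int h le)
  also have "\<dots> = A + B + 2 * (LINT x|M. cmod (f x) * cmod (g x))"
    using f g fg by (simp add: h_def A_def B_def)
  also have "\<dots> \<le> A + B + 2 * (sqrt A * sqrt B)" using fg(2) by (simp add: A_def B_def)
  also have "\<dots> = (sqrt A + sqrt B)\<^sup>2" using nn by (simp add: power2_sum)
  finally show "sqrt (LINT x|M. (cmod (f x + g x))\<^sup>2) \<le> sqrt A + sqrt B"
    using nn by (simp add: real_le_lsqrt)
qed

lemma (in prob_space) L1_le_L2:
  fixes f :: "'a \<Rightarrow> complex"
  assumes [measurable]: "f \<in> borel_measurable M" and f: "integrable M (\<lambda>x. (cmod (f x))\<^sup>2)"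
  shows "integrable M f" and "(LINT x|M. cmod (f x)) \<le> sqrt (LINT x|M. (cmod (f x))\<^sup>2)"
proof -
  have "integrable M (\<lambda>x. cmod (f x))" "(LINT x|M. cmod (f x)) \<le> sqrt (LINT x|M. (cmod (f x))\<^sup>2)"
    using Cauchy_Schwarz_L2[of f M "\<lambda>_. 1"] f by (auto simp: prob_space)
  then show "integrable M f" "(LINT x|M. cmod (f x)) \<le> sqrt (LINT x|M. (cmod (f x))\<^sup>2)"
    by (auto simp: integrable_norm_iff)
qed

section \<open>Equality of laws transferred through almost sure limits\<close>

text \<open>Continuous functions decreasing to the indicator of a closed set serve as test functions
  for laws. As \<open>infdist x {}\<close> is 0, an empty \<open>C\<close> would give the limit 1;
  that case is therefore excluded here and treated apart later.\<close>

lemma closed_indicator_limit: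
  fixes C :: "'a::metric_space set"
  assumes "closed C" "C \<noteq> {}"
  shows "(\<lambda>m. max 0 (1 - real m * infdist x C)) \<longlonglongrightarrow> indicator C x"
proof (cases "x \<in> C")
  case True
  then show ?thesis by simp
next
  case False
  then have pos: "infdist x C > 0"
    using assms by (simp add: infdist_pos_not_in_closed)
  obtain m0 :: nat where m0: "real m0 * infdist x C > 1"
    using pos reals_Archimedean3 by blast
  have "max 0 (1 - real m * infdist x C) = 0" if "m \<ge> m0" for m
  proof -
    have "real m0 * infdist x C \<le> real m * infdist x C"
      using that pos by (intro mult_right_mono) auto
    then show ?thesis using m0 by simp
  qed
  then have "eventually (\<lambda>m. max 0 (1 - real m * infdist x C) = 0) sequentially"
    by (auto simp: eventually_sequentially)
  then show ?thesis using False by (simp add: tendsto_eventually)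
qed

text \<open>Closed boxes form an intersection-stable generator of the product sigma-algebra and
  include the whole space. Closed sides are chosen because their indicators are limits of continuous
  functions.\<close>

lemma measure_eqI_PiM_closed:
  fixes P Q :: "(nat \<Rightarrow> 'b::metric_space) measure"
  assumes P: "sets P = sets (PiM {..<n} (\<lambda>_. borel))" and Q: "sets Q = sets (PiM {..<n} (\<lambda>_. borel))"
    and "prob_space P"
    and eq: "\<And>C. (\<And>i. i < n \<Longrightarrow> closed (C i)) \<Longrightarrow> emeasure P (Pi\<^sub>E {..<n} C) = emeasure Q (Pi\<^sub>E {..<n} C)"
  shows "P = Q"
proof -
  interpret P: prob_space P by fact
  define \<E> where "\<E> = {Pi\<^sub>E {..<n} F | F. \<forall>i\<in>{..<n}. F i \<in> Collect (closed :: 'b set \<Rightarrow> bool)}"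
  have gen: "sets (PiM {..<n} (\<lambda>_. borel :: 'b measure)) = sigma_sets (space (PiM {..<n} (\<lambda>_. borel))) \<E>"
  proof -
    \<comment> \<open>\<open>sets_PiM_sigma\<close> generates by cylinders over a cover of the index
      set; covering it by the single set \<open>{..<n}\<close> makes every cylinder a full
      box.\<close>
    have "sets (PiM {..<n} (\<lambda>_. sigma UNIV (Collect (closed :: 'b set \<Rightarrow> bool)))) =
      sets (sigma (Pi\<^sub>E {..<n} (\<lambda>_. UNIV))
        {{f\<in>Pi\<^sub>E {..<n} (\<lambda>_. UNIV). \<forall>i\<in>j. f i \<in> A i} | A j.
          j \<in> {{..<n}} \<and> A \<in> Pi j (\<lambda>_. Collect closed)})"
      by (rule sets_PiM_sigma) (auto intro!: exI[of _ "{UNIV}"])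
    also have "{{f\<in>Pi\<^sub>E {..<n} (\<lambda>_. UNIV). \<forall>i\<in>j. f i \<in> A i} | A j.
          j \<in> {{..<n}} \<and> A \<in> Pi j (\<lambda>_. Collect closed)} = \<E>" (is "?L = _")
    proof (intro set_eqI iffI)
      have *: "{f\<in>Pi\<^sub>E {..<n} (\<lambda>_. UNIV). \<forall>i\<in>{..<n}. f i \<in> A i} = Pi\<^sub>E {..<n} A" for A :: "nat \<Rightarrow> 'b set"
        unfolding PiE_def Pi_def by blast
      show "X \<in> \<E>" if "X \<in> ?L" for X
      proof -
        from that obtain A where "X = {f\<in>Pi\<^sub>E {..<n} (\<lambda>_. UNIV). \<forall>i\<in>{..<n}. f i \<in> A i}"
          and A: "A \<in> Pi {..<n} (\<lambda>_. Collect closed)" by blast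
        then have "X = Pi\<^sub>E {..<n} A" unfolding * by -
        with A show ?thesis unfolding \<E>_def by blast
      qed
      show "X \<in> ?L" if "X \<in> \<E>" for X
      proof -
        from that obtain A where "X = Pi\<^sub>E {..<n} A"
          and A: "A \<in> Pi {..<n} (\<lambda>_. Collect closed)" unfolding \<E>_def by blast
        then have "X = {f\<in>Pi\<^sub>E {..<n} (\<lambda>_. UNIV). \<forall>i\<in>{..<n}. f i \<in> A i}" unfolding * by -
        with A show ?thesis by blast
      qed
    qed
    also have "sets (sigma (Pi\<^sub>E {..<n} (\<lambda>_. UNIV)) \<E>) = sigma_sets (Pi\<^sub>E {..<n} (\<lambda>_. UNIV)) \<E>"
      by (rule sets_measure_of) (auto simp: \<E>_def PiE_iff)
    finally show ?thesis by (simp add: borel_eq_closed space_PiM)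
  qed
  have sp: "space (PiM {..<n} (\<lambda>_. borel :: 'b measure)) = Pi\<^sub>E {..<n} (\<lambda>_. UNIV)"
    by (simp add: space_PiM)
  show ?thesis
  proof (rule measure_eqI_generator_eq[where E = \<E> and \<Omega> = "Pi\<^sub>E {..<n} (\<lambda>_. UNIV)" and A = "\<lambda>_. Pi\<^sub>E {..<n} (\<lambda>_. UNIV)"])
    show "Int_stable \<E>"
    proof (rule Int_stableI)
      fix a b assume "a \<in> \<E>" "b \<in> \<E>"
      then obtain F G where a: "a = Pi\<^sub>E {..<n} F" "\<forall>i<n. closed (F i)"
        and b: "b = Pi\<^sub>E {..<n} G" "\<forall>i<n. closed (G i)"
        by (auto simp: \<E>_def)
      have "a \<inter> b = Pi\<^sub>E {..<n} (\<lambda>i. F i \<inter> G i)" by (simp add: a b PiE_Int)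
      then show "a \<inter> b \<in> \<E>" using a b unfolding \<E>_def
        by (auto intro!: exI[of _ "\<lambda>i. F i \<inter> G i"])
    qed
    show "\<E> \<subseteq> Pow (Pi\<^sub>E {..<n} (\<lambda>_. UNIV))" by (auto simp: \<E>_def PiE_iff)
    show "\<And>X. X \<in> \<E> \<Longrightarrow> emeasure P X = emeasure Q X" using eq by (auto simp: \<E>_def)
    show "sets P = sigma_sets (Pi\<^sub>E {..<n} (\<lambda>_. UNIV)) \<E>" "sets Q = sigma_sets (Pi\<^sub>E {..<n} (\<lambda>_. UNIV)) \<E>"
      using P Q gen sp by auto
    show "range (\<lambda>_. Pi\<^sub>E {..<n} (\<lambda>_. UNIV)) \<subseteq> \<E>" unfolding \<E>_def by (auto intro!: exI[of _ "\<lambda>_. UNIV"])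
  qed auto
qed

text \<open>Almost sure convergence gives convergence of expectations of bounded continuous
  functions, so equality of laws survives the limit. \<open>Xs k\<close> and \<open>Ys k\<close>
  have to agree only in law, hence the two limits may be quite different variables.\<close>

lemma distr_eq_limit:
  fixes X Y :: "'a \<Rightarrow> nat \<Rightarrow> 'b::metric_space" and Xs Ys :: "nat \<Rightarrow> 'a \<Rightarrow> nat \<Rightarrow> 'b" and n :: nat
  defines "P \<equiv> PiM {..<n} (\<lambda>_. borel :: 'b measure)"
  assumes M: "prob_space M"
    and X: "X \<in> measurable M P" and Y: "Y \<in> measurable M P"
    and Xs: "\<And>k. Xs k \<in> measurable M P" and Ys: "\<And>k. Ys k \<in> measurable M P"
    and eq: "\<And>k. distr M P (Xs k) = distr M P (Ys k)"
    and limX: "\<And>i. i < n \<Longrightarrow> AE \<omega> in M. (\<lambda>k. Xs k \<omega> i) \<longlonglongrightarrow> X \<omega> i"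
    and limY: "\<And>i. i < n \<Longrightarrow> AE \<omega> in M. (\<lambda>k. Ys k \<omega> i) \<longlonglongrightarrow> Y \<omega> i"
  shows "distr M P X = distr M P Y"
proof -
  interpret prob_space M by fact
  have component: "(\<lambda>\<omega>. Z \<omega> i) \<in> borel_measurable M" if "Z \<in> measurable M P" "i < n" for Z i
    using measurable_compose[OF that(1)[unfolded P_def] measurable_component_singleton[of i]] that(2) by simp
  have main: "emeasure (distr M P X) (Pi\<^sub>E {..<n} C) = emeasure (distr M P Y) (Pi\<^sub>E {..<n} C)"
    if C: "\<And>i. i < n \<Longrightarrow> closed (C i)" for C
  proof (cases "\<exists>i<n. C i = {}")
    case True
    then have "Pi\<^sub>E {..<n} C = {}" by (auto simp: PiE_eq_empty_iff)
    then show ?thesis by simp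
  next
    case False
    \<comment> \<open>A continuous approximation to the indicator of the box. The limit in
      \<open>k\<close> is taken first, at fixed \<open>m\<close>, because it relies on continuity;
      letting \<open>m\<close> grow afterwards recovers the box.\<close>
    define h where "h m x = (\<Prod>i<n. max 0 (1 - real m * infdist (x i) (C i)))" for m and x :: "nat \<Rightarrow> 'b"
    have h01: "0 \<le> h m x" "h m x \<le> 1" for m x
      unfolding h_def by (auto intro!: prod_nonneg prod_le_1 simp: infdist_nonneg)
    have h_meas: "h m \<in> borel_measurable P" for m
    proof -
      have "(\<lambda>x. infdist (x i) (C i)) \<in> borel_measurable P" if "i < n" for i
        using that unfolding P_def
        by (intro borel_measurable_continuous_on[where f="\<lambda>x. infdist x (C i)"]
            continuous_intros measurable_component_singleton) auto
      then show ?thesis unfolding h_def by (intro borel_measurable_prod borel_measurable_max) auto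
    qed
    have h_lim: "(\<lambda>k. h m (Zs k)) \<longlonglongrightarrow> h m z" if "\<And>i. i < n \<Longrightarrow> (\<lambda>k. Zs k i) \<longlonglongrightarrow> z i" for m Zs z
      unfolding h_def using that by (intro tendsto_prod tendsto_intros) auto
    have step: "(\<lambda>k. LINT \<omega>|M. h m (Zs k \<omega>)) \<longlonglongrightarrow> (LINT \<omega>|M. h m (Z \<omega>))"
      if Z: "Z \<in> measurable M P" and Zs: "\<And>k. Zs k \<in> measurable M P"
        and lim: "\<And>i. i < n \<Longrightarrow> AE \<omega> in M. (\<lambda>k. Zs k \<omega> i) \<longlonglongrightarrow> Z \<omega> i" for m Z Zs
    proof (rule integral_dominated_convergence[where w="\<lambda>_. 1"])
      have "AE \<omega> in M. \<forall>i\<in>{..<n}. (\<lambda>k. Zs k \<omega> i) \<longlonglongrightarrow> Z \<omega> i"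
        using lim by (intro AE_finite_allI) auto
      then show "AE x in M. (\<lambda>k. h m (Zs k x)) \<longlonglongrightarrow> h m (Z x)"
        by eventually_elim (rule h_lim, auto)
      show "(\<lambda>x. h m (Z x)) \<in> borel_measurable M" "\<And>k. (\<lambda>x. h m (Zs k x)) \<in> borel_measurable M"
        using measurable_compose[OF Z h_meas] measurable_compose[OF Zs h_meas] by auto
    qed (use h01 in \<open>auto intro!: integrable_const\<close>)
    have "(LINT \<omega>|M. h m (Xs k \<omega>)) = (LINT \<omega>|M. h m (Ys k \<omega>))" for m k
      using eq[of k] integral_distr[OF Xs h_meas, of k m] integral_distr[OF Ys h_meas, of k m] by simp
    then have hXY: "(LINT \<omega>|M. h m (X \<omega>)) = (LINT \<omega>|M. h m (Y \<omega>))" for m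
      using step[OF X Xs limX, of m] step[OF Y Ys limY, of m] LIMSEQ_unique by auto
    have hind: "(\<lambda>m. h m x) \<longlonglongrightarrow> indicator {x. \<forall>i<n. x i \<in> C i} x" for x
    proof -
      have "(\<lambda>m. h m x) \<longlonglongrightarrow> (\<Prod>i<n. indicator (C i) (x i))"
        unfolding h_def using False C by (intro tendsto_prod closed_indicator_limit) auto
      also have "(\<Prod>i<n. indicator (C i) (x i)) = (indicator {x. \<forall>i<n. x i \<in> C i} x :: real)"
        by (auto simp: indicator_def prod_zero_iff)
      finally show ?thesis .
    qed
    have box: "emeasure (distr M P Z) (Pi\<^sub>E {..<n} C) = ennreal (LINT \<omega>|M. indicator {x. \<forall>i<n. x i \<in> C i} (Z \<omega>))"
      and boxm: "(\<lambda>\<omega>. indicator {x. \<forall>i<n. x i \<in> C i} (Z \<omega>) :: real) \<in> borel_measurable M"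
      if Z: "Z \<in> measurable M P" for Z
    proof -
      have "Pi\<^sub>E {..<n} C \<in> sets P" unfolding P_def using C by (intro sets_PiM_I_finite) auto
      then have "emeasure (distr M P Z) (Pi\<^sub>E {..<n} C) = emeasure M (Z -` Pi\<^sub>E {..<n} C \<inter> space M)"
        using Z by (simp add: emeasure_distr)
      also have *: "Z -` Pi\<^sub>E {..<n} C \<inter> space M = {\<omega> \<in> space M. \<forall>i<n. Z \<omega> i \<in> C i}"
        using measurable_space[OF Z] by (fastforce simp: P_def space_PiM PiE_iff)
      finally have e: "emeasure (distr M P Z) (Pi\<^sub>E {..<n} C) = emeasure M {\<omega> \<in> space M. \<forall>i<n. Z \<omega> i \<in> C i}" .
      define S where "S = {\<omega> \<in> space M. \<forall>i<n. Z \<omega> i \<in> C i}"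
      have m: "S \<in> sets M"
        unfolding S_def *[symmetric] by (rule measurable_sets[OF Z \<open>Pi\<^sub>E {..<n} C \<in> sets P\<close>])
      have ind: "indicator {x. \<forall>i<n. x i \<in> C i} (Z \<omega>) = (indicator S \<omega> :: real)"
        if "\<omega> \<in> space M" for \<omega> using that by (auto simp: indicator_def S_def)
      show "(\<lambda>\<omega>. indicator {x. \<forall>i<n. x i \<in> C i} (Z \<omega>) :: real) \<in> borel_measurable M"
        by (rule measurable_cong[THEN iffD2, OF ind borel_measurable_indicator[OF m]])
      have "(LINT \<omega>|M. indicator {x. \<forall>i<n. x i \<in> C i} (Z \<omega>)) = (LINT \<omega>|M. indicator S \<omega> :: real)"
        by (rule Bochner_Integration.integral_cong[OF refl ind])
      then show "emeasure (distr M P Z) (Pi\<^sub>E {..<n} C) = ennreal (LINT \<omega>|M. indicator {x. \<forall>i<n. x i \<in> C i} (Z \<omega>))"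
        using m unfolding e S_def[symmetric] by (simp add: emeasure_eq_measure)
    qed
    have step2: "(\<lambda>m. LINT \<omega>|M. h m (Z \<omega>)) \<longlonglongrightarrow> (LINT \<omega>|M. indicator {x. \<forall>i<n. x i \<in> C i} (Z \<omega>))"
      if Z: "Z \<in> measurable M P" for Z
    proof (rule integral_dominated_convergence[where w="\<lambda>_. 1"])
      show "(\<lambda>\<omega>. indicator {x. \<forall>i<n. x i \<in> C i} (Z \<omega>) :: real) \<in> borel_measurable M"
        by (rule boxm[OF Z])
      show "(\<lambda>\<omega>. h m (Z \<omega>)) \<in> borel_measurable M" for m by (rule measurable_compose[OF Z h_meas])
      show "AE \<omega> in M. (\<lambda>m. h m (Z \<omega>)) \<longlonglongrightarrow> indicator {x. \<forall>i<n. x i \<in> C i} (Z \<omega>)"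
        by (rule AE_I2) (rule hind)
      show "AE \<omega> in M. norm (h m (Z \<omega>)) \<le> 1" for m by (rule AE_I2) (simp add: h01)
    qed simp
    have "(LINT \<omega>|M. indicator {x. \<forall>i<n. x i \<in> C i} (X \<omega>)) = (LINT \<omega>|M. indicator {x. \<forall>i<n. x i \<in> C i} (Y \<omega>) :: real)"
      using step2[OF X] step2[OF Y] hXY LIMSEQ_unique by auto
    then show ?thesis using box[OF X] box[OF Y] by simp
  qed
  show ?thesis
    by (rule measure_eqI_PiM_closed[where n=n])
       (use main prob_space_distr[OF X] in \<open>auto simp: P_def\<close>)
qed

section \<open>Linear statistics and stationarity\<close>

text \<open>Discarding the points where \<open>\<phi>\<close> is 0 leaves a finite index set when
  the support is bounded; a plain sum over an infinite \<open>\<Lambda> \<omega>\<close> would be 0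
  by default.\<close>

definition linstat :: "('w \<Rightarrow> complex set) \<Rightarrow> (complex \<Rightarrow> complex) \<Rightarrow> 'w \<Rightarrow> complex" where
  "linstat \<Lambda> \<phi> \<omega> = (\<Sum>l\<in>{l\<in>\<Lambda> \<omega>. \<phi> l \<noteq> 0}. \<phi> l)"

definition bsupp :: "(complex \<Rightarrow> complex) \<Rightarrow> bool" where
  "bsupp \<phi> \<longleftrightarrow> \<phi> \<in> borel_measurable borel \<and> bounded {x. \<phi> x \<noteq> 0}"

lemma bounded_translate: "bounded {x. P x} \<Longrightarrow> bounded {x::complex. P (x - w)}"
proof -
  assume "bounded {x. P x}"
  moreover have "{x. P (x - w)} = (\<lambda>x. w + x) ` {x. P x}"
  proof (intro set_eqI iffI)
    fix x assume "x \<in> {x. P (x - w)}"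
    then show "x \<in> (\<lambda>x. w + x) ` {x. P x}" by (intro image_eqI[of _ _ "x - w"]) auto
  qed auto
  ultimately show ?thesis using bounded_translation[of "{x. P x}" w] by simp
qed

lemma bsupp_translate:
  assumes "bsupp \<phi>"
  shows "bsupp (\<lambda>z. \<phi> (z - w))"
proof -
  have [measurable]: "\<phi> \<in> borel_measurable borel" using assms by (simp add: bsupp_def)
  show ?thesis using assms bounded_translate[of "\<lambda>x. \<phi> x \<noteq> 0" w] by (simp add: bsupp_def)
qed

locale stationary_pp = prob_space M for M :: "'w measure" +
  fixes \<Lambda> :: "'w \<Rightarrow> complex set"
  assumes pp: "point_process M \<Lambda>"
    and stationary: "stationary_point_process M \<Lambda>"
    and second_moment: "finite_second_moment M \<Lambda>"
begin

abbreviation "N \<equiv> linstat \<Lambda>"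

lemma finite_points: "\<omega> \<in> space M \<Longrightarrow> bounded B \<Longrightarrow> finite (\<Lambda> \<omega> \<inter> B)"
  using pp by (auto simp: point_process_def locally_finite_set_def)

lemma N_eq:
  assumes "\<omega> \<in> space M" "bounded B" "\<And>x. \<phi> x \<noteq> 0 \<Longrightarrow> x \<in> B"
  shows "N \<phi> \<omega> = (\<Sum>l\<in>\<Lambda> \<omega> \<inter> B. \<phi> l)"
  unfolding linstat_def using assms by (intro sum.mono_neutral_left finite_points) auto

text \<open>The hypotheses speak only of counts, so a linear statistic is first written through the
  counts of level sets. The value 0 is left out because its level set is unbounded.\<close>

lemma N_eq_simple:
  assumes \<omega>: "\<omega> \<in> space M" and s: "simple_function borel \<phi>" and b: "bsupp \<phi>"
  shows "N \<phi> \<omega> = (\<Sum>y\<in>range \<phi> - {0}. y * of_nat (card (\<Lambda> \<omega> \<inter> \<phi> -` {y})))"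
proof -
  have fin: "finite {l\<in>\<Lambda> \<omega>. \<phi> l \<noteq> 0}"
    using finite_points[OF \<omega>, of "{x. \<phi> x \<noteq> 0}"] b by (simp add: bsupp_def Int_def)
  have "N \<phi> \<omega> = (\<Sum>y\<in>range \<phi> - {0}. \<Sum>l\<in>{l\<in>{l\<in>\<Lambda> \<omega>. \<phi> l \<noteq> 0}. \<phi> l = y}. \<phi> l)"
    unfolding linstat_def using s fin
    by (intro sum.group[symmetric]) (auto simp: simple_function_def)
  also have "\<dots> = (\<Sum>y\<in>range \<phi> - {0}. y * of_nat (card (\<Lambda> \<omega> \<inter> \<phi> -` {y})))"
  proof (rule sum.cong[OF refl])
    fix y assume y: "y \<in> range \<phi> - {0}"
    then have "{l\<in>{l\<in>\<Lambda> \<omega>. \<phi> l \<noteq> 0}. \<phi> l = y} = \<Lambda> \<omega> \<inter> \<phi> -` {y}" by auto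
    moreover have "(\<Sum>l\<in>\<Lambda> \<omega> \<inter> \<phi> -` {y}. \<phi> l) = (\<Sum>l\<in>\<Lambda> \<omega> \<inter> \<phi> -` {y}. y)"
      by (intro sum.cong) auto
    ultimately show "(\<Sum>l\<in>{l\<in>{l\<in>\<Lambda> \<omega>. \<phi> l \<noteq> 0}. \<phi> l = y}. \<phi> l) = y * of_nat (card (\<Lambda> \<omega> \<inter> \<phi> -` {y}))"
      by (simp add: mult.commute)
  qed
  finally show ?thesis .
qed

text \<open>Lists of naturals form a countable type, so preimages of single lists suffice, and these
  are finite intersections.\<close>

lemma measurable_counts:
  assumes "\<forall>B\<in>set Bs. B \<in> sets borel \<and> bounded B"
  shows "(\<lambda>\<omega>. map (\<lambda>B. card (\<Lambda> \<omega> \<inter> B)) Bs) \<in> measurable M (count_space UNIV)"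
proof -
  have "(\<lambda>\<omega>. map (\<lambda>B. card (\<Lambda> \<omega> \<inter> B)) Bs) -` {xs} \<inter> space M \<in> sets M" for xs
    using assms
  proof (induction Bs arbitrary: xs)
    case Nil
    then show ?case by (cases xs) auto
  next
    case (Cons B Bs)
    show ?case
    proof (cases xs)
      case Nil
      then have "(\<lambda>\<omega>. map (\<lambda>B. card (\<Lambda> \<omega> \<inter> B)) (B # Bs)) -` {xs} \<inter> space M = {}" by auto
      then show ?thesis by (metis sets.empty_sets)
    next
      case (Cons x ys)
      have "(\<lambda>\<omega>. card (\<Lambda> \<omega> \<inter> B)) \<in> measurable M (count_space UNIV)"
        using pp Cons.prems by (simp add: point_process_def)
      then have "(\<lambda>\<omega>. card (\<Lambda> \<omega> \<inter> B)) -` {x} \<inter> space M \<in> sets M"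
        by (rule measurable_sets) simp
      moreover have "(\<lambda>\<omega>. map (\<lambda>B. card (\<Lambda> \<omega> \<inter> B)) Bs) -` {ys} \<inter> space M \<in> sets M"
        using Cons.IH Cons.prems by simp
      moreover have "(\<lambda>\<omega>. map (\<lambda>B. card (\<Lambda> \<omega> \<inter> B)) (B # Bs)) -` {xs} \<inter> space M =
          ((\<lambda>\<omega>. card (\<Lambda> \<omega> \<inter> B)) -` {x} \<inter> space M) \<inter> ((\<lambda>\<omega>. map (\<lambda>B. card (\<Lambda> \<omega> \<inter> B)) Bs) -` {ys} \<inter> space M)"
        using Cons by auto
      ultimately show ?thesis by (metis sets.Int)
    qed
  qed
  then show ?thesis by (subst measurable_count_space_eq2_countable) auto
qed

text \<open>The tuple is one function \<open>G\<close> of the vector of counts of all level sets.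
  Translating the functions translates the level sets and keeps the values, so the same
  \<open>G\<close> applied to the shifted counts gives the shifted tuple.\<close>

lemma law_N_simple:
  fixes \<phi> :: "nat \<Rightarrow> complex \<Rightarrow> complex" and n :: nat
  defines "P \<equiv> PiM {..<n} (\<lambda>_. borel :: complex measure)"
  assumes s: "\<And>i. i < n \<Longrightarrow> simple_function borel (\<phi> i)" and b: "\<And>i. i < n \<Longrightarrow> bsupp (\<phi> i)"
  shows "(\<lambda>\<omega>. restrict (\<lambda>i. N (\<phi> i) \<omega>) {..<n}) \<in> measurable M P"
    and "distr M P (\<lambda>\<omega>. restrict (\<lambda>i. N (\<lambda>z. \<phi> i (z - w)) \<omega>) {..<n}) =
      distr M P (\<lambda>\<omega>. restrict (\<lambda>i. N (\<phi> i) \<omega>) {..<n})"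
proof -
  define \<B> where "\<B> = (\<Union>i<n. (\<lambda>y. \<phi> i -` {y}) ` (range (\<phi> i) - {0}))"
  have "finite \<B>" unfolding \<B>_def using s by (auto simp: simple_function_def)
  then obtain Bs where Bs: "set Bs = \<B>" using finite_list by blast
  have "B \<in> sets borel \<and> bounded B" if "B \<in> \<B>" for B
  proof -
    from that obtain i y where i: "i < n" "y \<noteq> 0" "B = \<phi> i -` {y}" by (auto simp: \<B>_def)
    have "bounded {x. \<phi> i x \<noteq> 0}" "B \<subseteq> {x. \<phi> i x \<noteq> 0}" using b[OF i(1)] i by (auto simp: bsupp_def)
    then have "bounded B" by (rule bounded_subset)
    moreover have "\<phi> i -` {y} \<inter> space borel \<in> sets borel"
      using b[OF i(1)] by (intro measurable_sets[of _ borel borel]) (auto simp: bsupp_def)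
    ultimately show ?thesis using i(3) by simp
  qed
  then have Bsb: "\<forall>B\<in>set Bs. B \<in> sets borel \<and> bounded B" using Bs by blast
  \<comment> \<open>The list of counts is read as a lookup table keyed by level sets, so a set
    shared by several \<open>\<phi> i\<close> causes no conflict.\<close>
  define G where "G c = restrict (\<lambda>i. \<Sum>y\<in>range (\<phi> i) - {0}. y * of_nat (the (map_of (zip Bs c) (\<phi> i -` {y})))) {..<n}"
    for c :: "nat list"
  have G: "G \<in> measurable (count_space UNIV) P"
    by (auto simp: P_def space_PiM G_def)
  have mapof: "the (map_of (zip Bs (map f Bs)) (\<phi> i -` {y})) = f (\<phi> i -` {y})"
    if "i < n" "y \<in> range (\<phi> i) - {0}" for f :: "complex set \<Rightarrow> nat" and i y
  proof -
    have "\<phi> i -` {y} \<in> set Bs" unfolding Bs \<B>_def using that by blast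
    then show ?thesis by (simp add: map_of_zip_map)
  qed
  define c0 where "c0 \<omega> = map (\<lambda>B. card (\<Lambda> \<omega> \<inter> B)) Bs" for \<omega>
  define c1 where "c1 \<omega> = map (\<lambda>B. card (\<Lambda> \<omega> \<inter> ((\<lambda>z. z + w) ` B))) Bs" for \<omega>
  have c0: "c0 \<in> measurable M (count_space UNIV)"
    unfolding c0_def by (rule measurable_counts[OF Bsb])
  have c1: "c1 \<in> measurable M (count_space UNIV)"
  proof -
    have "(\<lambda>z. z + w) ` B \<in> sets borel \<and> bounded ((\<lambda>z. z + w) ` B)" if "B \<in> set Bs" for B
    proof
      have "(\<lambda>z. z + w) ` B = (\<lambda>z. z - w) -` B \<inter> space borel"
        by (auto intro: image_eqI[of _ _ "_ - w"])
      also have "\<dots> \<in> sets borel" using that Bsb by (intro measurable_sets[of _ borel borel]) auto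
      finally show "(\<lambda>z. z + w) ` B \<in> sets borel" .
      show "bounded ((\<lambda>z. z + w) ` B)"
        using that Bsb bounded_translation[of B w] by (simp add: add.commute)
    qed
    then have "(\<lambda>\<omega>. map (\<lambda>B. card (\<Lambda> \<omega> \<inter> B)) (map (\<lambda>B. (\<lambda>z. z + w) ` B) Bs)) \<in> measurable M (count_space UNIV)"
      by (intro measurable_counts) auto
    then show ?thesis by (simp add: c1_def[abs_def] comp_def)
  qed
  have N0: "restrict (\<lambda>i. N (\<phi> i) \<omega>) {..<n} = G (c0 \<omega>)" if "\<omega> \<in> space M" for \<omega>
  proof
    fix i
    show "restrict (\<lambda>i. N (\<phi> i) \<omega>) {..<n} i = G (c0 \<omega>) i"
      unfolding G_def c0_def using N_eq_simple[OF that, of "\<phi> i"] s b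
      by (auto intro!: sum.cong simp: mapof)
  qed
  have N1: "restrict (\<lambda>i. N (\<lambda>z. \<phi> i (z - w)) \<omega>) {..<n} = G (c1 \<omega>)" if "\<omega> \<in> space M" for \<omega>
  proof
    fix i
    have r: "range (\<lambda>z. \<phi> i (z - w)) = range (\<phi> i)"
      by (auto intro: image_eqI[of _ _ "_ + w"])
    have v: "(\<lambda>z. \<phi> i (z - w)) -` {y} = (\<lambda>z. z + w) ` (\<phi> i -` {y})" for y
      by (auto intro: image_eqI[of _ _ "_ - w"])
    have "simple_function borel (\<lambda>z. \<phi> i (z - w))" if "i < n"
    proof -
      have [measurable]: "\<phi> i \<in> borel_measurable borel" using b[OF that] by (simp add: bsupp_def)
      have "(\<lambda>z. \<phi> i (z - w)) -` {y} \<inter> space borel \<in> sets borel" for y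
        by (rule measurable_sets[of _ borel borel]) auto
      then show ?thesis using s[OF that] r by (simp add: simple_function_def)
    qed
    then show "restrict (\<lambda>i. N (\<lambda>z. \<phi> i (z - w)) \<omega>) {..<n} i = G (c1 \<omega>) i"
      unfolding G_def c1_def using N_eq_simple[OF that, of "\<lambda>z. \<phi> i (z - w)"] bsupp_translate[OF b, of i w]
      by (auto intro!: sum.cong simp: mapof r v)
  qed
  have m: "(\<lambda>\<omega>. G (c0 \<omega>)) \<in> measurable M P" "(\<lambda>\<omega>. G (c1 \<omega>)) \<in> measurable M P"
    using measurable_compose[OF c0 G] measurable_compose[OF c1 G] by auto
  show "(\<lambda>\<omega>. restrict (\<lambda>i. N (\<phi> i) \<omega>) {..<n}) \<in> measurable M P"
    by (rule measurable_cong[THEN iffD2, OF N0 m(1)])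
  have eq: "distr M (count_space UNIV) c1 = distr M (count_space UNIV) c0"
    using stationary Bsb unfolding stationary_point_process_def c0_def[abs_def] c1_def[abs_def] by blast
  have "distr M P (\<lambda>\<omega>. restrict (\<lambda>i. N (\<lambda>z. \<phi> i (z - w)) \<omega>) {..<n}) = distr M P (G \<circ> c1)"
    by (intro distr_cong refl) (simp add: N1)
  also have "\<dots> = distr (distr M (count_space UNIV) c1) P G"
    by (rule distr_distr[OF G c1, symmetric])
  also have "\<dots> = distr (distr M (count_space UNIV) c0) P G" by (simp only: eq)
  also have "\<dots> = distr M P (G \<circ> c0)"
    by (rule distr_distr[OF G c0])
  also have "\<dots> = distr M P (\<lambda>\<omega>. restrict (\<lambda>i. N (\<phi> i) \<omega>) {..<n})"
    by (intro distr_cong refl) (simp add: N0)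
  finally show "distr M P (\<lambda>\<omega>. restrict (\<lambda>i. N (\<lambda>z. \<phi> i (z - w)) \<omega>) {..<n}) =
      distr M P (\<lambda>\<omega>. restrict (\<lambda>i. N (\<phi> i) \<omega>) {..<n})" .
qed

lemma simple_approx:
  assumes "bsupp \<phi>"
  obtains F where "\<And>k. simple_function borel (F k)" "\<And>k. bsupp (F k)" "\<And>x. (\<lambda>k. F k x) \<longlonglongrightarrow> \<phi> x"
    "\<And>k x. \<phi> x = 0 \<Longrightarrow> F k x = 0"
proof -
  from assms have "\<phi> \<in> borel_measurable borel" by (simp add: bsupp_def)
  \<comment> \<open>The base point 0 matters: the resulting bound by
    \<open>2 * dist (\<phi> x) 0\<close> forces the approximants to vanish where
    \<open>\<phi>\<close> does, which keeps their supports bounded.\<close>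
  from borel_measurable_implies_sequence_metric[OF this, of 0] obtain F where
    F: "\<And>k. simple_function borel (F k)" "\<And>x. (\<lambda>k. F k x) \<longlonglongrightarrow> \<phi> x"
    and d: "\<And>k x. dist (F k x) 0 \<le> 2 * dist (\<phi> x) 0" by auto
  have z: "F k x = 0" if "\<phi> x = 0" for k x using d[of k x] that by simp
  have "bsupp (F k)" for k
    unfolding bsupp_def
  proof
    show "F k \<in> borel_measurable borel" by (rule borel_measurable_simple_function[OF F(1)])
    have "{x. F k x \<noteq> 0} \<subseteq> {x. \<phi> x \<noteq> 0}" using z by auto
    then show "bounded {x. F k x \<noteq> 0}" using assms bounded_subset by (auto simp: bsupp_def)
  qed
  then show ?thesis using F z that by blast
qed

lemma N_tendsto:
  assumes "\<omega> \<in> space M" "bsupp \<phi>" "\<And>x. (\<lambda>k. F k x) \<longlonglongrightarrow> \<phi> x" "\<And>k x. \<phi> x = 0 \<Longrightarrow> F k x = 0"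
  shows "(\<lambda>k. N (F k) \<omega>) \<longlonglongrightarrow> N \<phi> \<omega>"
proof -
  have b: "bounded {x. \<phi> x \<noteq> 0}" using assms by (simp add: bsupp_def)
  have "N (F k) \<omega> = (\<Sum>l\<in>\<Lambda> \<omega> \<inter> {x. \<phi> x \<noteq> 0}. F k l)" for k
    using assms by (intro N_eq b) auto
  moreover have "N \<phi> \<omega> = (\<Sum>l\<in>\<Lambda> \<omega> \<inter> {x. \<phi> x \<noteq> 0}. \<phi> l)"
    using assms by (intro N_eq b) auto
  ultimately show ?thesis using assms(3) by (auto intro: tendsto_sum)
qed

lemma measurable_N:
  assumes "bsupp \<phi>"
  shows "N \<phi> \<in> borel_measurable M"
proof -
  obtain F where F: "\<And>k. simple_function borel (F k)" "\<And>k. bsupp (F k)" "\<And>x. (\<lambda>k. F k x) \<longlonglongrightarrow> \<phi> x"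
    "\<And>k x. \<phi> x = 0 \<Longrightarrow> F k x = 0" using simple_approx[OF assms] by blast
  have "N (F k) \<in> borel_measurable M" for k
  proof -
    have "(\<lambda>\<omega>. restrict (\<lambda>i. N (F k) \<omega>) {..<Suc 0} 0) \<in> borel_measurable M"
      by (rule measurable_compose[OF law_N_simple(1)[where n = "Suc 0" and \<phi> = "\<lambda>_. F k"] measurable_component_singleton])
        (use F in auto)
    then show ?thesis by simp
  qed
  then show ?thesis
    by (rule borel_measurable_LIMSEQ_metric) (rule N_tendsto[OF _ assms F(3,4)])
qed

lemma measurable_N_tuple:
  assumes "\<And>i. i < n \<Longrightarrow> bsupp (\<phi> i)"
  shows "(\<lambda>\<omega>. restrict (\<lambda>i. N (\<phi> i) \<omega>) {..<n}) \<in> measurable M (PiM {..<n} (\<lambda>_. borel))"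
  using assms by (intro measurable_restrict measurable_N) auto

text \<open>For fixed \<open>\<omega>\<close> the statistic is a finite sum, hence pointwise
  convergence of simple functions is enough. Unbounded functions are covered, as the kernels with
  poles require.\<close>

lemma law_N_translate:
  fixes \<phi> :: "nat \<Rightarrow> complex \<Rightarrow> complex"
  assumes b: "\<And>i. i < n \<Longrightarrow> bsupp (\<phi> i)"
  shows "distr M (PiM {..<n} (\<lambda>_. borel)) (\<lambda>\<omega>. restrict (\<lambda>i. N (\<lambda>z. \<phi> i (z - w)) \<omega>) {..<n}) =
      distr M (PiM {..<n} (\<lambda>_. borel)) (\<lambda>\<omega>. restrict (\<lambda>i. N (\<phi> i) \<omega>) {..<n})"
proof -
  have "\<exists>F. (\<forall>k. simple_function borel (F k)) \<and> (\<forall>k. bsupp (F k)) \<and> (\<forall>x. (\<lambda>k. F k x) \<longlonglongrightarrow> \<phi> i x) \<and>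
    (\<forall>k x. \<phi> i x = 0 \<longrightarrow> F k x = 0)" if "i < n" for i
    using simple_approx[OF b[OF that]] by metis
  then obtain F where F: "\<And>i k. i < n \<Longrightarrow> simple_function borel (F i k)" "\<And>i k. i < n \<Longrightarrow> bsupp (F i k)"
    "\<And>i x. i < n \<Longrightarrow> (\<lambda>k. F i k x) \<longlonglongrightarrow> \<phi> i x" "\<And>i k x. i < n \<Longrightarrow> \<phi> i x = 0 \<Longrightarrow> F i k x = 0"
    by metis
  show ?thesis
  proof (rule distr_eq_limit[where Xs = "\<lambda>k \<omega>. restrict (\<lambda>i. N (\<lambda>z. F i k (z - w)) \<omega>) {..<n}"
        and Ys = "\<lambda>k \<omega>. restrict (\<lambda>i. N (F i k) \<omega>) {..<n}"])
    show "prob_space M" by unfold_locales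
    show "distr M (PiM {..<n} (\<lambda>_. borel)) (\<lambda>\<omega>. restrict (\<lambda>i. N (\<lambda>z. F i k (z - w)) \<omega>) {..<n}) =
      distr M (PiM {..<n} (\<lambda>_. borel)) (\<lambda>\<omega>. restrict (\<lambda>i. N (F i k) \<omega>) {..<n})" for k
      by (rule law_N_simple) (use F in auto)
    show "AE \<omega> in M. (\<lambda>k. restrict (\<lambda>i. N (\<lambda>z. F i k (z - w)) \<omega>) {..<n} i)
      \<longlonglongrightarrow> restrict (\<lambda>i. N (\<lambda>z. \<phi> i (z - w)) \<omega>) {..<n} i" if "i < n" for i
      using that F(3,4)[OF that] by (intro AE_I2) (simp add: N_tendsto bsupp_translate[OF b])
    show "AE \<omega> in M. (\<lambda>k. restrict (\<lambda>i. N (F i k) \<omega>) {..<n} i)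
      \<longlonglongrightarrow> restrict (\<lambda>i. N (\<phi> i) \<omega>) {..<n} i" if "i < n" for i
      using that F(3,4)[OF that] by (intro AE_I2) (simp add: N_tendsto b)
  qed (intro measurable_N_tuple bsupp_translate b F, assumption)+
qed

end

section \<open>The second moment seminorm\<close>

text \<open>\<open>bsupp\<close> suffices for statements about laws; boundedness is added so that
  the statistic is square integrable, by comparison with a count. The increment kernels have poles
  and in general satisfy only \<open>bsupp\<close>.\<close>

definition test_fun :: "(complex \<Rightarrow> complex) \<Rightarrow> bool" where
  "test_fun \<phi> \<longleftrightarrow> bsupp \<phi> \<and> (\<exists>K. \<forall>x. cmod (\<phi> x) \<le> K)"

lemma test_bsupp: "test_fun \<phi> \<Longrightarrow> bsupp \<phi>"
  by (simp add: test_fun_def)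

lemma bsupp_add:
  assumes "bsupp \<phi>" "bsupp \<psi>"
  shows "bsupp (\<lambda>z. \<phi> z + \<psi> z)"
proof -
  have "{x. \<phi> x + \<psi> x \<noteq> 0} \<subseteq> {x. \<phi> x \<noteq> 0} \<union> {x. \<psi> x \<noteq> 0}" by auto
  moreover have "bounded ({x. \<phi> x \<noteq> 0} \<union> {x. \<psi> x \<noteq> 0})" using assms by (simp add: bsupp_def)
  ultimately have "bounded {x. \<phi> x + \<psi> x \<noteq> 0}" by (rule bounded_subset[rotated])
  then show ?thesis using assms by (auto simp: bsupp_def)
qed

lemma bsupp_cmult:
  assumes "bsupp \<phi>"
  shows "bsupp (\<lambda>z. c * \<phi> z)"
proof -
  have "{x. c * \<phi> x \<noteq> 0} \<subseteq> {x. \<phi> x \<noteq> 0}" by auto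
  then have "bounded {x. c * \<phi> x \<noteq> 0}" using assms bounded_subset unfolding bsupp_def by blast
  then show ?thesis using assms by (auto simp: bsupp_def)
qed

lemma bsupp_0: "bsupp (\<lambda>_. 0)"
  by (simp add: bsupp_def)

lemma test_0: "test_fun (\<lambda>_. 0)"
  by (auto simp: test_fun_def bsupp_0)

lemma test_add: "test_fun \<phi> \<Longrightarrow> test_fun \<psi> \<Longrightarrow> test_fun (\<lambda>z. \<phi> z + \<psi> z)"
  unfolding test_fun_def using bsupp_add by (meson norm_add_rule_thm)

lemma test_cmult: "test_fun \<phi> \<Longrightarrow> test_fun (\<lambda>z. c * \<phi> z)"
  unfolding test_fun_def norm_mult using bsupp_cmult by (meson mult_left_mono norm_ge_zero)

lemma test_diff: "test_fun \<phi> \<Longrightarrow> test_fun \<psi> \<Longrightarrow> test_fun (\<lambda>z. \<phi> z - \<psi> z)"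
  using test_add[of \<phi> "\<lambda>z. -1 * \<psi> z"] test_cmult[of \<psi> "-1"] by simp

lemma test_sum:
  assumes "\<And>i. i \<in> I \<Longrightarrow> test_fun (\<phi> i)"
  shows "test_fun (\<lambda>z. \<Sum>i\<in>I. \<phi> i z)"
  using assms by (induction I rule: infinite_finite_induct) (auto intro: test_0 test_add)

lemma test_translate: "test_fun \<phi> \<Longrightarrow> test_fun (\<lambda>z. \<phi> (z - w))"
  using bsupp_translate by (auto simp: test_fun_def)

lemma test_indicator:
  assumes "B \<in> sets borel" "bounded B"
  shows "test_fun (\<lambda>z. of_real (indicator B z))"
proof -
  have "{x. of_real (indicator B x) \<noteq> (0::complex)} = B" by (auto simp: indicator_def)
  then have "bsupp (\<lambda>z. of_real (indicator B z))" using assms by (auto simp: bsupp_def)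
  moreover have "cmod (of_real (indicator B x)) \<le> 1" for x by (simp add: indicator_def)
  ultimately show ?thesis unfolding test_fun_def by blast
qed

lemma testI:
  assumes "\<phi> \<in> borel_measurable borel" "\<And>x. cmod (\<phi> x) \<le> K" "\<And>x. \<phi> x \<noteq> 0 \<Longrightarrow> cmod x \<le> r"
  shows "test_fun \<phi>"
proof -
  have "bounded {x. \<phi> x \<noteq> 0}" using assms(3) by (auto simp: bounded_iff)
  then show ?thesis using assms by (auto simp: test_fun_def bsupp_def)
qed

context stationary_pp
begin

lemma N_add:
  assumes "\<omega> \<in> space M" "bsupp \<phi>" "bsupp \<psi>"
  shows "N (\<lambda>z. \<phi> z + \<psi> z) \<omega> = N \<phi> \<omega> + N \<psi> \<omega>"
proof -
  define B where "B = {x. \<phi> x \<noteq> 0} \<union> {x. \<psi> x \<noteq> 0}"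
  have B: "bounded B" using assms by (simp add: bsupp_def B_def)
  have "N f \<omega> = (\<Sum>l\<in>\<Lambda> \<omega> \<inter> B. f l)" if "\<And>x. f x \<noteq> 0 \<Longrightarrow> \<phi> x \<noteq> 0 \<or> \<psi> x \<noteq> 0" for f
    by (rule N_eq[OF assms(1) B]) (use that B_def in blast)
  from this[of "\<lambda>z. \<phi> z + \<psi> z"] this[of \<phi>] this[of \<psi>] show ?thesis
    by (simp add: sum.distrib) (metis add.right_neutral)
qed

lemma N_cmult: "N (\<lambda>z. c * \<phi> z) \<omega> = c * N \<phi> \<omega>"
  by (cases "c = 0") (auto simp: linstat_def sum_distrib_left)

lemma N_diff:
  assumes "\<omega> \<in> space M" "bsupp \<phi>" "bsupp \<psi>"
  shows "N (\<lambda>z. \<phi> z - \<psi> z) \<omega> = N \<phi> \<omega> - N \<psi> \<omega>"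
  using N_add[OF assms(1,2) bsupp_cmult[OF assms(3), of "-1"]] N_cmult[of "-1" \<psi> \<omega>] by simp

lemma N_0: "N (\<lambda>_. 0) \<omega> = 0"
  by (simp add: linstat_def)

lemma cmod_N_le:
  assumes "\<omega> \<in> space M" "bsupp \<phi>" "bsupp (\<lambda>x. of_real (\<psi> x))" "\<And>x. cmod (\<phi> x) \<le> \<psi> x"
  shows "cmod (N \<phi> \<omega>) \<le> cmod (N (\<lambda>x. of_real (\<psi> x)) \<omega>)"
proof -
  define B where "B = {x. of_real (\<psi> x) \<noteq> (0::complex)}"
  have B: "bounded B" using assms by (simp add: bsupp_def B_def)
  have \<psi>: "\<psi> x \<ge> 0" for x using order_trans[OF norm_ge_zero assms(4)] .
  have "N \<phi> \<omega> = (\<Sum>l\<in>\<Lambda> \<omega> \<inter> B. \<phi> l)"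
    by (rule N_eq[OF assms(1) B]) (use assms(4) in \<open>auto simp: B_def\<close>, metis norm_le_zero_iff)
  then have "cmod (N \<phi> \<omega>) \<le> (\<Sum>l\<in>\<Lambda> \<omega> \<inter> B. \<psi> l)"
    using assms(4) by (simp add: sum_norm_le)
  also have "\<dots> = cmod (N (\<lambda>x. of_real (\<psi> x)) \<omega>)"
    using N_eq[OF assms(1) B, of "\<lambda>x. of_real (\<psi> x)"] \<psi>
    by (simp add: B_def sum_nonneg flip: of_real_sum)
  finally show ?thesis .
qed

lemma integrable_N_sq:
  assumes "test_fun \<phi>"
  shows "integrable M (\<lambda>\<omega>. (cmod (N \<phi> \<omega>))\<^sup>2)"
proof -
  obtain K where K: "\<And>x. cmod (\<phi> x) \<le> K" using assms by (auto simp: test_fun_def)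
  obtain r where r: "\<And>x. \<phi> x \<noteq> 0 \<Longrightarrow> cmod x \<le> r"
    using test_bsupp[OF assms] by (auto simp: bsupp_def bounded_iff)
  have [measurable]: "N \<phi> \<in> borel_measurable M" by (rule measurable_N[OF test_bsupp[OF assms]])
  have le: "cmod (N \<phi> \<omega>) \<le> K * real (card (\<Lambda> \<omega> \<inter> cball 0 r))" if "\<omega> \<in> space M" for \<omega>
  proof -
    have "N \<phi> \<omega> = (\<Sum>l\<in>\<Lambda> \<omega> \<inter> cball 0 r. \<phi> l)"
      by (rule N_eq[OF that]) (use r in auto)
    also have "cmod \<dots> \<le> (\<Sum>l\<in>\<Lambda> \<omega> \<inter> cball 0 r. K)" by (rule sum_norm_le) (rule K)
    finally show ?thesis by (simp add: mult.commute)
  qed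
  have "integrable M (\<lambda>\<omega>. (real (card (\<Lambda> \<omega> \<inter> cball 0 r)))\<^sup>2)"
    using second_moment by (simp add: finite_second_moment_def)
  then have "integrable M (\<lambda>\<omega>. K\<^sup>2 * (real (card (\<Lambda> \<omega> \<inter> cball 0 r)))\<^sup>2)" by simp
  then show ?thesis
  proof (rule Bochner_Integration.integrable_bound)
    show "AE \<omega> in M. norm ((cmod (N \<phi> \<omega>))\<^sup>2) \<le> norm (K\<^sup>2 * (real (card (\<Lambda> \<omega> \<inter> cball 0 r)))\<^sup>2)"
      using power_mono[OF le norm_ge_zero, of _ 2] by (intro AE_I2) (simp add: power_mult_distrib)
  qed measurable
qed

text \<open>On test functions this is a seminorm that is invariant under translations and monotone
  in the modulus. The size estimates for annuli and tails rest on these properties.\<close>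

definition nrm :: "(complex \<Rightarrow> complex) \<Rightarrow> real" where
  "nrm \<phi> = sqrt (LINT \<omega>|M. (cmod (N \<phi> \<omega>))\<^sup>2)"

lemma nrm_nonneg: "nrm \<phi> \<ge> 0"
  by (simp add: nrm_def integral_nonneg_AE)

lemma nrm_sq: "(nrm \<phi>)\<^sup>2 = (LINT \<omega>|M. (cmod (N \<phi> \<omega>))\<^sup>2)"
  by (simp add: nrm_def integral_nonneg_AE)

lemma nrm_0: "nrm (\<lambda>_. 0) = 0"
  by (simp add: nrm_def N_0)

lemma nrm_add:
  assumes "test_fun \<phi>" "test_fun \<psi>"
  shows "nrm (\<lambda>z. \<phi> z + \<psi> z) \<le> nrm \<phi> + nrm \<psi>"
proof -
  have "(LINT \<omega>|M. (cmod (N (\<lambda>z. \<phi> z + \<psi> z) \<omega>))\<^sup>2) = (LINT \<omega>|M. (cmod (N \<phi> \<omega> + N \<psi> \<omega>))\<^sup>2)"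
    using assms by (intro Bochner_Integration.integral_cong refl) (simp add: N_add test_bsupp)
  then show ?thesis unfolding nrm_def
    using Minkowski_L2(2)[OF measurable_N measurable_N integrable_N_sq integrable_N_sq, OF assms[THEN test_bsupp] assms]
    by simp
qed

lemma nrm_cmult: "nrm (\<lambda>z. c * \<phi> z) = cmod c * nrm \<phi>"
  by (simp add: nrm_def N_cmult norm_mult power_mult_distrib real_sqrt_mult)

lemma nrm_diff:
  assumes "test_fun \<phi>" "test_fun \<psi>"
  shows "nrm (\<lambda>z. \<phi> z - \<psi> z) \<le> nrm \<phi> + nrm \<psi>"
  using nrm_add[OF assms(1) test_cmult[OF assms(2), of "-1"]] nrm_cmult[of "-1" \<psi>] by simp

lemma nrm_commute: "nrm (\<lambda>z. \<phi> z - \<psi> z) = nrm (\<lambda>z. \<psi> z - \<phi> z)"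
  using nrm_cmult[of "-1" "\<lambda>z. \<phi> z - \<psi> z"] by simp

lemma nrm_triangle:
  assumes "test_fun \<phi>" "test_fun \<psi>" "test_fun \<eta>"
  shows "nrm (\<lambda>z. \<phi> z - \<eta> z) \<le> nrm (\<lambda>z. \<phi> z - \<psi> z) + nrm (\<lambda>z. \<psi> z - \<eta> z)"
  using nrm_add[OF test_diff[OF assms(1,2)] test_diff[OF assms(2,3)]] by simp

lemma nrm_sum:
  assumes "\<And>i. i \<in> I \<Longrightarrow> test_fun (\<phi> i)"
  shows "nrm (\<lambda>z. \<Sum>i\<in>I. \<phi> i z) \<le> (\<Sum>i\<in>I. nrm (\<phi> i))"
  using assms
proof (induction I rule: infinite_finite_induct)
  case (insert x F)
  then have "nrm (\<lambda>z. \<phi> x z + (\<Sum>i\<in>F. \<phi> i z)) \<le> nrm (\<phi> x) + nrm (\<lambda>z. \<Sum>i\<in>F. \<phi> i z)"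
    by (intro nrm_add test_sum) auto
  with insert show ?case by simp
qed (auto simp: nrm_0)

lemma nrm_mono:
  assumes "test_fun \<phi>" "test_fun (\<lambda>x. of_real (\<psi> x))" "\<And>x. cmod (\<phi> x) \<le> \<psi> x"
  shows "nrm \<phi> \<le> nrm (\<lambda>x. of_real (\<psi> x))"
  unfolding nrm_def
  using assms by (intro real_sqrt_le_mono integral_mono integrable_N_sq power_mono cmod_N_le)
    (auto simp: test_bsupp)

lemma expectation_N_le:
  assumes "test_fun \<phi>"
  shows "integrable M (N \<phi>)" "(LINT \<omega>|M. cmod (N \<phi> \<omega>)) \<le> nrm \<phi>"
  using L1_le_L2[OF measurable_N integrable_N_sq, OF test_bsupp] assms by (auto simp: nrm_def)

text \<open>Stationarity of the joint law of a pair gives invariance of mixed products, which the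
  cancellation between two difference directions requires.\<close>

lemma inner_N_translate:
  assumes "bsupp \<phi>" "bsupp \<psi>"
  shows "(LINT \<omega>|M. N (\<lambda>z. \<phi> (z - w)) \<omega> * cnj (N (\<lambda>z. \<psi> (z - w)) \<omega>)) =
    (LINT \<omega>|M. N \<phi> \<omega> * cnj (N \<psi> \<omega>))"
proof -
  let ?P = "PiM {..<2::nat} (\<lambda>_. borel :: complex measure)"
  define \<eta> where "\<eta> i = (if i = 0 then \<phi> else \<psi>)" for i :: nat
  have \<eta>: "bsupp (\<eta> i)" for i using assms by (simp add: \<eta>_def)
  define H where "H v = v 0 * cnj (v 1)" for v :: "nat \<Rightarrow> complex"
  have [measurable]: "(\<lambda>v. v 0) \<in> borel_measurable ?P" "(\<lambda>v. v 1) \<in> borel_measurable ?P"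
    by (rule measurable_component_singleton; simp)+
  have "(\<lambda>z::complex. cnj z) \<in> borel_measurable borel"
    by (intro borel_measurable_continuous_onI continuous_intros)
  then have H: "H \<in> borel_measurable ?P" unfolding H_def by measurable
  have *: "(LINT v|distr M ?P (\<lambda>\<omega>. restrict (\<lambda>i. N (\<theta> i) \<omega>) {..<2}). H v) =
      (LINT \<omega>|M. N (\<theta> 0) \<omega> * cnj (N (\<theta> 1) \<omega>))" if "\<And>i. bsupp (\<theta> i)" for \<theta>
    using that by (subst integral_distr[OF measurable_N_tuple H]) (auto simp: H_def)
  show ?thesis
    using *[OF \<eta>] *[of "\<lambda>i z. \<eta> i (z - w)"] bsupp_translate[OF \<eta>] law_N_translate[of 2 \<eta> w] \<eta>
    by (simp add: \<eta>_def)
qed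

lemma nrm_translate:
  assumes "bsupp \<phi>"
  shows "nrm (\<lambda>z. \<phi> (z - w)) = nrm \<phi>"
proof -
  have *: "complex_of_real (LINT \<omega>|M. (cmod (N \<theta> \<omega>))\<^sup>2) = (LINT \<omega>|M. N \<theta> \<omega> * cnj (N \<theta> \<omega>))" for \<theta>
    by (subst integral_complex_of_real[symmetric]) (simp only: complex_norm_square)
  have "complex_of_real (LINT \<omega>|M. (cmod (N (\<lambda>z. \<phi> (z - w)) \<omega>))\<^sup>2) = complex_of_real (LINT \<omega>|M. (cmod (N \<phi> \<omega>))\<^sup>2)"
    unfolding * by (rule inner_N_translate[OF assms assms])
  then show ?thesis unfolding nrm_def of_real_eq_iff by simp
qed

lemma parallelogram_nrm:
  assumes "test_fun \<phi>" "test_fun \<psi>"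
  shows "(nrm (\<lambda>z. \<phi> z - \<psi> z))\<^sup>2 = 2 * (nrm \<phi>)\<^sup>2 + 2 * (nrm \<psi>)\<^sup>2 - (nrm (\<lambda>z. \<phi> z + \<psi> z))\<^sup>2"
proof -
  note i = integrable_N_sq[OF assms(1)] integrable_N_sq[OF assms(2)] integrable_N_sq[OF test_add[OF assms]]
  have par: "(cmod (a - b))\<^sup>2 = 2 * (cmod a)\<^sup>2 + 2 * (cmod b)\<^sup>2 - (cmod (a + b))\<^sup>2" for a b
    unfolding cmod_power2 by (simp add: power2_eq_square algebra_simps)
  have "(nrm (\<lambda>z. \<phi> z - \<psi> z))\<^sup>2 = (LINT \<omega>|M. 2 * (cmod (N \<phi> \<omega>))\<^sup>2 + 2 * (cmod (N \<psi> \<omega>))\<^sup>2 - (cmod (N (\<lambda>z. \<phi> z + \<psi> z) \<omega>))\<^sup>2)"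
    unfolding nrm_sq
  proof (rule Bochner_Integration.integral_cong[OF refl])
    fix \<omega> assume "\<omega> \<in> space M"
    then show "(cmod (N (\<lambda>z. \<phi> z - \<psi> z) \<omega>))\<^sup>2 = 2 * (cmod (N \<phi> \<omega>))\<^sup>2 + 2 * (cmod (N \<psi> \<omega>))\<^sup>2 - (cmod (N (\<lambda>z. \<phi> z + \<psi> z) \<omega>))\<^sup>2"
      using assms[THEN test_bsupp] par by (simp add: N_add N_diff)
  qed
  also have "\<dots> = 2 * (nrm \<phi>)\<^sup>2 + 2 * (nrm \<psi>)\<^sup>2 - (nrm (\<lambda>z. \<phi> z + \<psi> z))\<^sup>2"
    unfolding nrm_sq using i by simp
  finally show ?thesis .
qed

text \<open>The discrete form of the fact that the Beurling transform \<open>\<partial> \<circ> (\<partial>-bar)\<^sup>-\<^sup>1\<close> is an isometry.\<close>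

lemma nrm_dbar_eq_nrm_d:
  assumes g: "test_fun g"
  shows "nrm (\<lambda>z. (g (z + 1) - g (z - 1)) - \<i> * (g (z + \<i>) - g (z - \<i>))) =
    nrm (\<lambda>z. (g (z + 1) - g (z - 1)) + \<i> * (g (z + \<i>) - g (z - \<i>)))"
proof -
  define \<tau> where "\<tau> w = (\<lambda>z. g (z - w))" for w
  have \<tau>: "test_fun (\<tau> w)" for w unfolding \<tau>_def by (rule test_translate[OF g])
  define ip where "ip \<phi> \<psi> = (LINT \<omega>|M. N \<phi> \<omega> * cnj (N \<psi> \<omega>))" for \<phi> \<psi>
  have shift: "ip (\<tau> (a + c)) (\<tau> (b + c)) = ip (\<tau> a) (\<tau> b)" for a b c
    using inner_N_translate[OF test_bsupp test_bsupp, OF \<tau> \<tau>, of a c b]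
    by (simp add: ip_def \<tau>_def algebra_simps)
  have int: "integrable M (\<lambda>\<omega>. N \<phi> \<omega> * cnj (N \<psi> \<omega>))" if "test_fun \<phi>" "test_fun \<psi>" for \<phi> \<psi>
  proof -
    have [measurable]: "N \<phi> \<in> borel_measurable M" "N \<psi> \<in> borel_measurable M" "cnj \<in> borel_measurable borel"
      using that by (auto intro: measurable_N test_bsupp borel_measurable_continuous_onI continuous_intros)
    have "integrable M (\<lambda>\<omega>. cmod (N \<phi> \<omega>) * cmod (N \<psi> \<omega>))"
      by (rule Cauchy_Schwarz_L2) (use that integrable_N_sq in auto)
    then show ?thesis by (rule Bochner_Integration.integrable_bound) (auto simp: norm_mult)
  qed
  define A where "A = (\<lambda>z. \<tau> (-1) z - \<tau> 1 z)"
  define B where "B = (\<lambda>z. \<tau> (-\<i>) z - \<tau> \<i> z)"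
  have A: "test_fun A" and B: "test_fun B" unfolding A_def B_def by (intro test_diff \<tau>)+
  have NA: "N A \<omega> = N (\<tau> (-1)) \<omega> - N (\<tau> 1) \<omega>" and NB: "N B \<omega> = N (\<tau> (-\<i>)) \<omega> - N (\<tau> \<i>) \<omega>"
    if "\<omega> \<in> space M" for \<omega>
    unfolding A_def B_def by (intro N_diff that test_bsupp \<tau>)+
  have AB: "ip A B = ip (\<tau> (-1)) (\<tau> (-\<i>)) - ip (\<tau> (-1)) (\<tau> \<i>) - ip (\<tau> 1) (\<tau> (-\<i>)) + ip (\<tau> 1) (\<tau> \<i>)"
  proof -
    have "ip A B = (LINT \<omega>|M. N (\<tau> (-1)) \<omega> * cnj (N (\<tau> (-\<i>)) \<omega>) - N (\<tau> (-1)) \<omega> * cnj (N (\<tau> \<i>) \<omega>)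
       - N (\<tau> 1) \<omega> * cnj (N (\<tau> (-\<i>)) \<omega>) + N (\<tau> 1) \<omega> * cnj (N (\<tau> \<i>) \<omega>))"
      unfolding ip_def by (intro Bochner_Integration.integral_cong refl) (simp add: NA NB algebra_simps)
    then show ?thesis using int[OF \<tau> \<tau>] by (simp add: ip_def)
  qed
  have BA: "ip B A = ip (\<tau> (-\<i>)) (\<tau> (-1)) - ip (\<tau> (-\<i>)) (\<tau> 1) - ip (\<tau> \<i>) (\<tau> (-1)) + ip (\<tau> \<i>) (\<tau> 1)"
  proof -
    have "ip B A = (LINT \<omega>|M. N (\<tau> (-\<i>)) \<omega> * cnj (N (\<tau> (-1)) \<omega>) - N (\<tau> (-\<i>)) \<omega> * cnj (N (\<tau> 1) \<omega>)
       - N (\<tau> \<i>) \<omega> * cnj (N (\<tau> (-1)) \<omega>) + N (\<tau> \<i>) \<omega> * cnj (N (\<tau> 1) \<omega>))"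
      unfolding ip_def by (intro Bochner_Integration.integral_cong refl) (simp add: NA NB algebra_simps)
    then show ?thesis using int[OF \<tau> \<tau>] by (simp add: ip_def)
  qed
  \<comment> \<open>An inner product of two translates depends only on the difference of their
    shifts. In both expansions the differences \<open>1 - \<i>\<close> and \<open>-1 + \<i>\<close>
    carry a plus sign, \<open>1 + \<i>\<close> and \<open>-1 - \<i>\<close> a minus sign.\<close>
  have "ip A B = ip B A"
    using shift[of \<i> "-1-\<i>" 1] shift[of "-\<i>" "-1+\<i>" 1] shift[of \<i> "1-\<i>" "-1"] shift[of "-\<i>" "1+\<i>" "-1"]
    unfolding AB BA by simp
  moreover have "ip B A = cnj (ip A B)"
    unfolding ip_def by (subst Bochner_Integration.integral_cnj[symmetric]) (simp add: mult.commute)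
  ultimately have Im0: "Im (ip A B) = 0" by (metis Reals_cnj_iff complex_is_Real_iff)
  have sq: "(nrm (\<lambda>z. A z + c * B z))\<^sup>2 = (nrm A)\<^sup>2 + (nrm B)\<^sup>2" if "c = \<i> \<or> c = -\<i>" for c
  proof -
    \<comment> \<open>For these two values of \<open>c\<close> the cross term sees only the
      imaginary part of the inner product, which vanishes because \<open>ip A B\<close> is both
      symmetric and Hermitian.\<close>
    have ident: "(cmod (a + c * b))\<^sup>2 = (cmod a)\<^sup>2 + (cmod b)\<^sup>2 + 2 * Im c * Im (a * cnj b)"
      if "c = \<i> \<or> c = -\<i>" for a b
      unfolding cmod_power2 using that by (auto simp: power2_eq_square algebra_simps)
    have "(nrm (\<lambda>z. A z + c * B z))\<^sup>2 =
      (LINT \<omega>|M. (cmod (N A \<omega>))\<^sup>2 + (cmod (N B \<omega>))\<^sup>2 + 2 * Im c * Im (N A \<omega> * cnj (N B \<omega>)))"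
      unfolding nrm_sq
    proof (rule Bochner_Integration.integral_cong[OF refl])
      fix \<omega> assume "\<omega> \<in> space M"
      then have "N (\<lambda>z. A z + c * B z) \<omega> = N A \<omega> + c * N B \<omega>"
        using N_add[of \<omega> A "\<lambda>z. c * B z"] A B by (simp add: N_cmult test_bsupp test_cmult)
      then show "(cmod (N (\<lambda>z. A z + c * B z) \<omega>))\<^sup>2 =
        (cmod (N A \<omega>))\<^sup>2 + (cmod (N B \<omega>))\<^sup>2 + 2 * Im c * Im (N A \<omega> * cnj (N B \<omega>))"
        using that ident[OF that] by simp
    qed
    also have "\<dots> = (nrm A)\<^sup>2 + (nrm B)\<^sup>2 + 2 * Im c * Im (ip A B)"
      using integrable_N_sq[OF A] integrable_N_sq[OF B] integrable_Im[OF int[OF A B]] integral_Im[OF int[OF A B]]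
      by (simp add: nrm_sq ip_def)
    finally show ?thesis using Im0 by simp
  qed
  have "(nrm (\<lambda>z. A z + (-\<i>) * B z))\<^sup>2 = (nrm (\<lambda>z. A z + \<i> * B z))\<^sup>2"
    using sq[of \<i>] sq[of "-\<i>"] by simp
  then have "nrm (\<lambda>z. A z + (-\<i>) * B z) = nrm (\<lambda>z. A z + \<i> * B z)"
    using power2_eq_imp_eq nrm_nonneg by blast
  then show ?thesis by (simp add: A_def B_def \<tau>_def)
qed

end

section \<open>Annuli and tails\<close>

abbreviation ind :: "complex set \<Rightarrow> complex \<Rightarrow> complex" where
  "ind B z \<equiv> complex_of_real (indicator B z)"

definition annulus :: "real \<Rightarrow> real \<Rightarrow> complex set" where
  "annulus R w = {z. \<bar>cmod z - R\<bar> \<le> w}"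

lemma annulus_bounded: "bounded (annulus R w)"
  by (rule boundedI[of _ "R + w"]) (auto simp: annulus_def)

lemma annulus_borel [measurable]: "annulus R w \<in> sets borel"
  unfolding annulus_def by measurable

lemma test_ind_annulus: "test_fun (ind (annulus R w))"
  by (intro test_indicator annulus_borel annulus_bounded)

lemma norm_cis_diff: "cmod (cis a - cis b) \<le> \<bar>a - b\<bar>"
proof -
  have "cis a - cis b = cis b * (cis (a - b) - 1)"
    by (simp add: algebra_simps cis_mult)
  then have "cmod (cis a - cis b) = cmod (exp (\<i> * of_real (a - b)) - 1)"
    by (simp add: norm_mult cis_conv_exp)
  also have "\<dots> = 2 * \<bar>sin ((a - b) / 2)\<bar>" by (rule dist_exp_i_1)
  also have "\<dots> \<le> 2 * \<bar>(a - b) / 2\<bar>" by (intro mult_left_mono abs_sin_x_le_abs_x) auto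
  finally show ?thesis by simp
qed

text \<open>The centres follow each other along the circle at arc length at most 2 pi, and 7 exceeds
  2 pi. Rounding the angle down to the previous centre costs at most one full spacing; the radial
  offset adds \<open>w\<close>.\<close>

lemma annulus_cover:
  assumes R: "R \<ge> 1" and z: "z \<in> annulus R w"
  shows "\<exists>j<nat \<lceil>R\<rceil>. cmod (z - of_real R * cis (2 * pi * real j / real (nat \<lceil>R\<rceil>))) \<le> w + 7"
proof -
  define n where "n = real (nat \<lceil>R\<rceil>)"
  have n: "n \<ge> R" "n > 0" using R unfolding n_def by linarith+
  define \<theta> where "\<theta> = Arg2pi z"
  have \<theta>: "0 \<le> \<theta>" "\<theta> < 2 * pi" using Arg2pi[of z] by (auto simp: \<theta>_def)
  have zeq: "z = of_real (cmod z) * cis \<theta>" unfolding \<theta>_def cis_conv_exp by (rule Arg2pi_eq)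
  define x where "x = \<theta> * n / (2 * pi)"
  define j where "j = nat \<lfloor>x\<rfloor>"
  have x: "0 \<le> x" "x < n" using \<theta> n by (auto simp: x_def field_simps)
  have j: "real j \<le> x" "x < real j + 1" using x(1) unfolding j_def by linarith+
  have "j < nat \<lceil>R\<rceil>" using j(1) x(2) unfolding n_def by linarith
  have "\<theta> - 2 * pi * real j / n = (x - real j) * (2 * pi / n)"
    using n pi_gt_zero by (simp add: x_def field_simps)
  then have "\<bar>\<theta> - 2 * pi * real j / n\<bar> = \<bar>x - real j\<bar> * (2 * pi / n)"
    using n by (simp add: abs_mult)
  also have "\<dots> \<le> 1 * (2 * pi / n)" using j n by (intro mult_right_mono) auto
  finally have d: "\<bar>\<theta> - 2 * pi * real j / n\<bar> \<le> 2 * pi / n" by simp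
  have "z - of_real R * cis (2 * pi * real j / n) =
    of_real (cmod z - R) * cis \<theta> + of_real R * (cis \<theta> - cis (2 * pi * real j / n))"
    by (subst zeq) (simp add: algebra_simps)
  also have "cmod \<dots> \<le> \<bar>cmod z - R\<bar> + R * cmod (cis \<theta> - cis (2 * pi * real j / n))"
    using R by (intro norm_triangle_le) (simp add: norm_mult del: of_real_diff)
  also have "\<dots> \<le> w + R * (2 * pi / n)"
    using z R order_trans[OF norm_cis_diff d] unfolding annulus_def by (intro add_mono mult_left_mono) auto
  also have "R * (2 * pi / n) \<le> 2 * pi" using n R by (simp add: field_simps)
  also have "2 * pi \<le> 7" using pi_less_4 pi_approx by simp
  finally have "cmod (z - of_real R * cis (2 * pi * real j / n)) \<le> w + 7" by simp
  with \<open>j < nat \<lceil>R\<rceil>\<close> show ?thesis unfolding n_def by blast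
qed

lemma sum_inverse_squares_le:
  fixes m :: nat
  assumes "m \<ge> 2"
  shows "(\<Sum>n=m..<m+k. 1 / (real n)\<^sup>2) \<le> 1 / (real m - 1) - 1 / (real m + real k - 1)"
proof (induction k)
  case (Suc k)
  define x where "x = real m + real k"
  have x: "x \<ge> 2" using assms by (simp add: x_def)
  \<comment> \<open>1/x^2 is at most 1/(x (x - 1)), which telescopes.\<close>
  have "1 / x\<^sup>2 \<le> 1 / (x - 1) - 1 / x"
    using x by (simp add: field_simps power2_eq_square)
  with Suc show ?case by (simp add: x_def)
qed simp

lemma test_tail:
  assumes "R > 0"
  shows "test_fun (\<lambda>z. of_real (indicator {z. R < cmod z \<and> cmod z \<le> T} z / cmod z ^ 3))"
proof (rule testI[where K = "1 / R ^ 3" and r = T])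
  show "cmod (complex_of_real (indicator {z. R < cmod z \<and> cmod z \<le> T} x / cmod x ^ 3)) \<le> 1 / R ^ 3" for x
    using assms by (auto simp: indicator_def norm_divide norm_power intro!: divide_left_mono power_mono mult_pos_pos zero_less_power)
  show "cmod x \<le> T" if "complex_of_real (indicator {z. R < cmod z \<and> cmod z \<le> T} x / cmod x ^ 3) \<noteq> 0" for x
    using that by (auto simp: indicator_def split: if_splits)
qed measurable

context stationary_pp
begin

text \<open>About \<open>R\<close> balls of fixed radius cover the annulus, and by stationarity they
  all have the same seminorm. For \<open>w > 0\<close> and positive intensity the order is sharp,
  since the mean count already grows like \<open>R\<close>.\<close>

lemma nrm_annulus: "\<exists>C\<ge>0. \<forall>R\<ge>1. nrm (ind (annulus R w)) \<le> C * R"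
proof -
  define \<kappa> where "\<kappa> = nrm (ind (cball 0 (w + 7)))"
  have \<kappa>: "\<kappa> \<ge> 0" by (simp add: \<kappa>_def nrm_nonneg)
  have t: "test_fun (ind (cball c r))" for c r by (intro test_indicator) auto
  have \<kappa>_eq: "nrm (ind (cball d (w + 7))) = \<kappa>" for d
  proof -
    have "ind (cball d (w + 7)) = (\<lambda>z. ind (cball 0 (w + 7)) (z - d))"
      by (auto simp: fun_eq_iff indicator_def dist_norm norm_minus_commute)
    then show ?thesis unfolding \<kappa>_def using nrm_translate[OF test_bsupp[OF t[of 0 "w + 7"]], of d] by simp
  qed
  have "nrm (ind (annulus R w)) \<le> 2 * \<kappa> * R" if R: "R \<ge> 1" for R
  proof -
    define n where "n = nat \<lceil>R\<rceil>"
    define c where "c j = of_real R * cis (2 * pi * real j / real n)" for j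
    have eq: "complex_of_real (\<Sum>j<n. indicator (cball (c j) (w + 7)) z) = (\<Sum>j<n. ind (cball (c j) (w + 7)) z)" for z
      by simp
    have "nrm (ind (annulus R w)) \<le> nrm (\<lambda>z. of_real (\<Sum>j<n. indicator (cball (c j) (w + 7)) z))"
    proof (rule nrm_mono)
      show "test_fun (\<lambda>z. of_real (\<Sum>j<n. indicator (cball (c j) (w + 7)) z))"
        unfolding eq by (intro test_sum t)
      show "cmod (ind (annulus R w) z) \<le> (\<Sum>j<n. indicator (cball (c j) (w + 7)) z)" for z
      proof (cases "z \<in> annulus R w")
        case True
        then obtain j where "j < n" "z \<in> cball (c j) (w + 7)"
          using annulus_cover[OF R True] by (auto simp: n_def c_def dist_norm norm_minus_commute)
        then have "1 \<le> (\<Sum>j\<in>{j}. indicator (cball (c j) (w + 7)) z :: real)" by simp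
        also have "\<dots> \<le> (\<Sum>j<n. indicator (cball (c j) (w + 7)) z)"
          using \<open>j < n\<close> by (intro sum_mono2) auto
        finally show ?thesis using True by simp
      qed (simp add: sum_nonneg)
    qed (rule test_ind_annulus)
    also have "\<dots> \<le> (\<Sum>j<n. nrm (ind (cball (c j) (w + 7))))" unfolding eq by (rule nrm_sum) (rule t)
    also have "\<dots> = real n * \<kappa>" by (simp add: \<kappa>_eq)
    also have "\<dots> \<le> 2 * R * \<kappa>"
    proof (rule mult_right_mono[OF _ \<kappa>])
      show "real n \<le> 2 * R" using R unfolding n_def by linarith
    qed
    finally show ?thesis by (simp add: algebra_simps)
  qed
  then show ?thesis using \<kappa> by (intro exI[of _ "2 * \<kappa>"]) auto
qed

text \<open>Cutting into annuli about integer radii n gives terms of order n^-3 * n, whose tail sums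
  to order 1/R. The condition \<open>R \<ge> 4\<close> makes \<open>m - 1\<close> at least
  \<open>R / 2\<close>.\<close>

lemma nrm_tail:
  "\<exists>C\<ge>0. \<forall>R\<ge>4. \<forall>T. nrm (\<lambda>z. of_real (indicator {z. R < cmod z \<and> cmod z \<le> T} z / cmod z ^ 3)) \<le> C / R"
proof -
  obtain C where C: "C \<ge> 0" "\<And>R. R \<ge> 1 \<Longrightarrow> nrm (ind (annulus R 1)) \<le> C * R" using nrm_annulus by blast
  have "nrm (\<lambda>z. of_real (indicator {z. R < cmod z \<and> cmod z \<le> T} z / cmod z ^ 3)) \<le> 2 * C / R" if R: "R \<ge> 4" for R T
  proof -
    define m where "m = nat \<lfloor>R\<rfloor>"
    define k where "k = nat \<lceil>T\<rceil> + 1"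
    have m: "real m > R - 1" "m \<ge> 4" "real m \<le> R" using R unfolding m_def by linarith+
    have eq: "complex_of_real (\<Sum>n=m..<m+k. (1 / real n ^ 3) * indicator (annulus (real n) 1) z) =
      (\<Sum>n=m..<m+k. of_real (1 / real n ^ 3) * ind (annulus (real n) 1) z)" for z by simp
    have "nrm (\<lambda>z. of_real (indicator {z. R < cmod z \<and> cmod z \<le> T} z / cmod z ^ 3)) \<le>
      nrm (\<lambda>z. complex_of_real (\<Sum>n=m..<m+k. (1 / real n ^ 3) * indicator (annulus (real n) 1) z))"
    proof (rule nrm_mono)
      show "test_fun (\<lambda>z. of_real (indicator {z. R < cmod z \<and> cmod z \<le> T} z / cmod z ^ 3))"
        using R by (intro test_tail) auto
      show "test_fun (\<lambda>z. complex_of_real (\<Sum>n=m..<m+k. (1 / real n ^ 3) * indicator (annulus (real n) 1) z))"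
        unfolding eq by (intro test_sum test_cmult test_ind_annulus)
      fix z
      show "cmod (complex_of_real (indicator {z. R < cmod z \<and> cmod z \<le> T} z / cmod z ^ 3)) \<le>
        (\<Sum>n=m..<m+k. (1 / real n ^ 3) * indicator (annulus (real n) 1) z)"
      proof (cases "R < cmod z \<and> cmod z \<le> T")
        case True
        \<comment> \<open>Rounding down puts \<open>z\<close> in the annulus of half-width 1 about
          \<open>n\<close> and keeps 1/|z|^3 below 1/n^3.\<close>
        define n where "n = nat \<lfloor>cmod z\<rfloor>"
        have n: "real n \<le> cmod z" "cmod z < real n + 1" using norm_ge_zero[of z] unfolding n_def by linarith+
        have nm: "n \<in> {m..<m+k}" using True n m unfolding k_def m_def by simp linarith
        have "cmod (complex_of_real (indicator {z. R < cmod z \<and> cmod z \<le> T} z / cmod z ^ 3)) = 1 / cmod z ^ 3"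
          using True by (simp add: norm_divide norm_power)
        also have "\<dots> \<le> 1 / real n ^ 3"
          using nm m n by (intro divide_left_mono power_mono mult_pos_pos zero_less_power) auto
        also have "\<dots> = (\<Sum>n\<in>{n}. (1 / real n ^ 3) * indicator (annulus (real n) 1) z)"
          using n by (simp add: annulus_def)
        also have "\<dots> \<le> (\<Sum>n=m..<m+k. (1 / real n ^ 3) * indicator (annulus (real n) 1) z)"
          using nm by (intro sum_mono2) auto
        finally show ?thesis .
      qed (auto intro!: sum_nonneg)
    qed
    also have "\<dots> \<le> (\<Sum>n=m..<m+k. nrm (\<lambda>z. of_real (1 / real n ^ 3) * ind (annulus (real n) 1) z))"
      unfolding eq by (intro nrm_sum test_cmult test_ind_annulus)
    also have "\<dots> \<le> (\<Sum>n=m..<m+k. C * (1 / (real n)\<^sup>2))"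
    proof (rule sum_mono)
      fix n assume "n \<in> {m..<m+k}"
      then have n: "real n \<ge> 1" using m by auto
      have "nrm (\<lambda>z. of_real (1 / real n ^ 3) * ind (annulus (real n) 1) z) = 1 / real n ^ 3 * nrm (ind (annulus (real n) 1))"
        by (subst nrm_cmult) (simp add: norm_divide norm_power)
      also have "\<dots> \<le> 1 / real n ^ 3 * (C * real n)" using C(2)[OF n] by (intro mult_left_mono) auto
      also have "\<dots> = C * (1 / (real n)\<^sup>2)" using n by (simp add: power2_eq_square power3_eq_cube)
      finally show "nrm (\<lambda>z. of_real (1 / real n ^ 3) * ind (annulus (real n) 1) z) \<le> C * (1 / (real n)\<^sup>2)" .
    qed
    also have "\<dots> = C * (\<Sum>n=m..<m+k. 1 / (real n)\<^sup>2)" by (rule sum_distrib_left[symmetric])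
    also have "\<dots> \<le> C * (1 / (real m - 1))"
    proof (rule mult_left_mono[OF _ C(1)])
      have "1 / (real m + real k - 1) \<ge> 0" using m by (intro divide_nonneg_nonneg) auto
      then show "(\<Sum>n=m..<m+k. 1 / (real n)\<^sup>2) \<le> 1 / (real m - 1)"
        using sum_inverse_squares_le[of m k] m by linarith
    qed
    also have "\<dots> \<le> C * (2 / R)"
      using m R C(1) by (intro mult_left_mono) (auto simp: field_simps)
    finally show ?thesis by (simp add: algebra_simps)
  qed
  then show ?thesis using C(1) by (intro exI[of _ "2 * C"]) auto
qed

end

section \<open>The mean ergodic theorem for disc averages\<close>

definition unit_cell :: "complex set" where
  "unit_cell = {z. 0 \<le> Re z \<and> Re z < 1 \<and> 0 \<le> Im z \<and> Im z < 1}"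

definition corner :: "complex \<Rightarrow> complex" where
  "corner z = Complex (of_int \<lfloor>Re z\<rfloor>) (of_int \<lfloor>Im z\<rfloor>)"

definition lattice_disc :: "real \<Rightarrow> complex set" where
  "lattice_disc R = {k. Re k \<in> \<int> \<and> Im k \<in> \<int> \<and> cmod k \<le> R}"

text \<open>A pixelated disc. Unlike the disc itself it is an exact sum of lattice translates of one
  half-open cell, which is what averaging over a group of shifts requires.\<close>

definition cells :: "real \<Rightarrow> complex set" where
  "cells R = {z. cmod (corner z) \<le> R}"

lemma unit_cell_borel [measurable]: "unit_cell \<in> sets borel"
  unfolding unit_cell_def by measurable

lemma unit_cell_bounded: "bounded unit_cell"
proof (rule boundedI)
  fix z assume "z \<in> unit_cell"
  then show "cmod z \<le> 2" using cmod_le[of z] by (auto simp: unit_cell_def)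
qed

lemma finite_lattice_disc: "finite (lattice_disc R)"
proof (rule finite_subset)
  show "lattice_disc R \<subseteq> (\<lambda>(a, b). Complex (of_int a) (of_int b)) ` ({-\<lceil>R\<rceil>..\<lceil>R\<rceil>} \<times> {-\<lceil>R\<rceil>..\<lceil>R\<rceil>})"
  proof
    fix k assume "k \<in> lattice_disc R"
    then obtain a b where ab: "Re k = of_int a" "Im k = of_int b" and k: "cmod k \<le> R"
      by (auto simp: lattice_disc_def elim!: Ints_cases)
    have "\<bar>real_of_int a\<bar> \<le> R" "\<bar>real_of_int b\<bar> \<le> R"
      using abs_Re_le_cmod[of k] abs_Im_le_cmod[of k] ab k by auto
    then have "a \<in> {-\<lceil>R\<rceil>..\<lceil>R\<rceil>}" "b \<in> {-\<lceil>R\<rceil>..\<lceil>R\<rceil>}" by (simp; linarith)+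
    moreover have "k = Complex (of_int a) (of_int b)" using ab by (simp add: complex_eq_iff)
    ultimately show "k \<in> (\<lambda>(a, b). Complex (of_int a) (of_int b)) ` ({-\<lceil>R\<rceil>..\<lceil>R\<rceil>} \<times> {-\<lceil>R\<rceil>..\<lceil>R\<rceil>})"
      by force
  qed
qed auto

lemma zero_in_lattice_disc: "R \<ge> 0 \<Longrightarrow> 0 \<in> lattice_disc R"
  by (simp add: lattice_disc_def)

lemma mem_cell_iff:
  assumes "k \<in> lattice_disc R"
  shows "z - k \<in> unit_cell \<longleftrightarrow> corner z = k"
proof -
  obtain a b where ab: "Re k = of_int a" "Im k = of_int b"
    using assms by (auto simp: lattice_disc_def elim!: Ints_cases)
  have "z - k \<in> unit_cell \<longleftrightarrow> \<lfloor>Re z\<rfloor> = a \<and> \<lfloor>Im z\<rfloor> = b"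
    unfolding unit_cell_def floor_eq_iff using ab by auto
  then show ?thesis using ab by (auto simp: corner_def complex_eq_iff)
qed

lemma corner_close: "cmod (z - corner z) \<le> 2"
proof -
  have "\<bar>Re (z - corner z)\<bar> \<le> 1" "\<bar>Im (z - corner z)\<bar> \<le> 1"
    unfolding corner_def by (simp; linarith)+
  then show ?thesis using cmod_le[of "z - corner z"] by linarith
qed

lemma corner_in_lattice: "corner z \<in> lattice_disc R \<longleftrightarrow> z \<in> cells R"
  by (auto simp: corner_def lattice_disc_def cells_def)

lemma cells_sum: "(\<Sum>k\<in>lattice_disc R. ind unit_cell (z - k)) = ind (cells R) z"
proof -
  have "(\<Sum>k\<in>lattice_disc R. ind unit_cell (z - k)) = (\<Sum>k\<in>lattice_disc R. if corner z = k then 1 else 0)"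
    by (intro sum.cong refl) (simp add: indicator_def mem_cell_iff)
  then show ?thesis using corner_in_lattice[of z R] by (simp add: finite_lattice_disc indicator_def)
qed

lemma cells_eq_Union: "cells R = (\<Union>k\<in>lattice_disc R. (+) k ` unit_cell)"
proof (intro set_eqI iffI)
  fix z assume "z \<in> cells R"
  then have c: "corner z \<in> lattice_disc R" by (simp add: corner_in_lattice)
  then have "z - corner z \<in> unit_cell" using mem_cell_iff by blast
  then have "z \<in> (+) (corner z) ` unit_cell" by (intro image_eqI[of _ _ "z - corner z"]) auto
  then show "z \<in> (\<Union>k\<in>lattice_disc R. (+) k ` unit_cell)" using c by blast
next
  fix z assume "z \<in> (\<Union>k\<in>lattice_disc R. (+) k ` unit_cell)"
  then obtain k q where k: "k \<in> lattice_disc R" "q \<in> unit_cell" "z = k + q" by blast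
  then have "corner z = k" using mem_cell_iff[OF k(1), of z] by simp
  then show "z \<in> cells R" using k(1) corner_in_lattice[of z R] by simp
qed

lemma cells_bounds: "ball 0 (R - 2) \<subseteq> cells R" "cells R \<subseteq> cball 0 (R + 2)"
proof -
  have *: "\<bar>cmod z - cmod (corner z)\<bar> \<le> 2" for z
    using norm_triangle_ineq3[of z "corner z"] corner_close[of z] by linarith
  show "ball 0 (R - 2) \<subseteq> cells R" "cells R \<subseteq> cball 0 (R + 2)"
    unfolding cells_def using * by (auto simp: abs_le_iff; smt (verit))+
qed

lemma cells_borel [measurable]: "cells R \<in> sets borel"
proof -
  have "cells R = (\<Union>k\<in>lattice_disc R. {z. z - k \<in> unit_cell})"
  proof (intro set_eqI iffI)
    fix z assume "z \<in> cells R"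
    then have "corner z \<in> lattice_disc R" by (simp add: corner_in_lattice)
    then show "z \<in> (\<Union>k\<in>lattice_disc R. {z. z - k \<in> unit_cell})" using mem_cell_iff by blast
  next
    fix z assume "z \<in> (\<Union>k\<in>lattice_disc R. {z. z - k \<in> unit_cell})"
    then show "z \<in> cells R" using mem_cell_iff corner_in_lattice by auto
  qed
  moreover have "{z. z - k \<in> unit_cell} \<in> sets borel" for k
  proof -
    have "(\<lambda>z. z - k) -` unit_cell \<inter> space borel \<in> sets borel"
      by (rule measurable_sets[of _ borel borel]) auto
    then show ?thesis by (simp add: vimage_def)
  qed
  ultimately show ?thesis using finite_lattice_disc by (metis sets.finite_UN)
qed

lemma cells_bounded: "bounded (cells R)"
  by (rule bounded_subset[OF bounded_cball cells_bounds(2)])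

definition lattice_count :: "real \<Rightarrow> real" where
  "lattice_count R = real (card (lattice_disc R))"

lemma lattice_count_pos: "R \<ge> 0 \<Longrightarrow> lattice_count R \<ge> 1"
  unfolding lattice_count_def using zero_in_lattice_disc[of R] finite_lattice_disc[of R]
  by (metis One_nat_def Suc_leI card_gt_0_iff empty_iff of_nat_1 of_nat_mono)

text \<open>Gauss's area argument: the union of the cells has area \<open>lattice_count R\<close>
  times that of one cell and lies between the discs of radius \<open>R - 2\<close> and
  \<open>R + 2\<close>, where 2 is a crude bound for the diameter of a cell.\<close>

lemma lattice_count_asymp:
  "\<exists>L>0. \<forall>R\<ge>2. L * (R - 2)\<^sup>2 \<le> lattice_count R \<and> lattice_count R \<le> L * (R + 2)\<^sup>2"
proof -
  \<comment> \<open>The area is left unevaluated: what matters is that it is positive and that the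
    same quotient \<open>V / v\<close> occurs in both bounds.\<close>
  define v where "v = measure lebesgue unit_cell"
  define V where "V = unit_ball_vol (real DIM(complex))"
  have V: "V > 0" by (simp add: V_def)
  have fin: "unit_cell \<in> lmeasurable"
    by (rule bounded_set_imp_lmeasurable) (auto simp: unit_cell_bounded)
  have "ball (Complex (1/2) (1/2)) (1/2) \<subseteq> unit_cell"
  proof
    fix z assume "z \<in> ball (Complex (1/2) (1/2)) (1/2)"
    then have "cmod (z - Complex (1/2) (1/2)) < 1/2" by (simp add: dist_norm norm_minus_commute)
    then have "\<bar>Re z - 1/2\<bar> < 1/2" "\<bar>Im z - 1/2\<bar> < 1/2"
      using abs_Re_le_cmod[of "z - Complex (1/2) (1/2)"] abs_Im_le_cmod[of "z - Complex (1/2) (1/2)"] by auto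
    then show "z \<in> unit_cell" unfolding unit_cell_def abs_less_iff by auto
  qed
  then have "measure lebesgue (ball (Complex (1/2) (1/2)) (1/2)) \<le> v"
    unfolding v_def by (rule measure_mono_fmeasurable) (use fin in auto)
  moreover have "measure lebesgue (ball (Complex (1/2) (1/2)) (1/2)) > 0" by (simp add: measure_completion)
  ultimately have v: "v > 0" by linarith
  have "measure lebesgue (cells R) = (\<Sum>k\<in>lattice_disc R. measure lebesgue ((+) k ` unit_cell))" for R
    unfolding cells_eq_Union
  proof (rule measure_finite_Union[OF finite_lattice_disc])
    show "(\<lambda>k. (+) k ` unit_cell) ` lattice_disc R \<subseteq> sets lebesgue"
      using fin by (auto intro: lebesgue_sets_translation)
    show "disjoint_family_on (\<lambda>k. (+) k ` unit_cell) (lattice_disc R)"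
      unfolding disjoint_family_on_def
    proof (intro ballI impI equals0I)
      fix m n z assume mn: "m \<in> lattice_disc R" "n \<in> lattice_disc R" "m \<noteq> n"
        and "z \<in> (+) m ` unit_cell \<inter> (+) n ` unit_cell"
      then obtain x y where "x \<in> unit_cell" "z = m + x" "y \<in> unit_cell" "z = n + y" by blast
      then have "z - m \<in> unit_cell" "z - n \<in> unit_cell" by (metis add_diff_cancel_left')+
      then show False using mn mem_cell_iff by metis
    qed
    show "emeasure lebesgue ((+) k ` unit_cell) \<noteq> \<infinity>" for k
      using measurable_translation[OF fin, of k] by (auto simp: fmeasurable_def)
  qed
  then have cells: "measure lebesgue (cells R) = v * lattice_count R" for R
    by (simp add: measure_translation v_def lattice_count_def mult.commute)
  have "V / v * (R - 2)\<^sup>2 \<le> lattice_count R \<and> lattice_count R \<le> V / v * (R + 2)\<^sup>2" if R: "R \<ge> 2" for R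
  proof -
    have "measure lebesgue (ball (0::complex) (R - 2)) \<le> measure lebesgue (cells R)"
      by (rule measure_mono_fmeasurable[OF cells_bounds(1)])
         (auto intro: bounded_set_imp_lmeasurable cells_bounded)
    moreover have "measure lebesgue (cells R) \<le> measure lebesgue (cball (0::complex) (R + 2))"
      by (rule measure_mono_fmeasurable[OF cells_bounds(2)]) auto
    ultimately have "V * (R - 2)\<^sup>2 \<le> v * lattice_count R" "v * lattice_count R \<le> V * (R + 2)\<^sup>2"
      using R by (auto simp: cells measure_completion content_ball content_cball V_def)
    then show ?thesis using v by (simp add: field_simps)
  qed
  then show ?thesis using V v by (intro exI[of _ "V / v"]) auto
qed

lemma test_ind_cells: "test_fun (ind (cells R))"
  by (intro test_indicator cells_borel cells_bounded)

text \<open>By \<open>cells_sum\<close> this is \<open>lattice_mean R\<close> applied to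
  \<open>ind unit_cell\<close>, the average of the translates of one cell.\<close>

definition mean_cells :: "real \<Rightarrow> complex \<Rightarrow> complex" where
  "mean_cells R z = of_real (1 / lattice_count R) * ind (cells R) z"

definition lattice_mean :: "real \<Rightarrow> (complex \<Rightarrow> complex) \<Rightarrow> complex \<Rightarrow> complex" where
  "lattice_mean R \<phi> z = of_real (1 / lattice_count R) * (\<Sum>k\<in>lattice_disc R. \<phi> (z - k))"

lemma test_mean_cells: "test_fun (mean_cells R)"
  unfolding mean_cells_def by (intro test_cmult test_ind_cells)

lemma test_lattice_mean: "test_fun \<phi> \<Longrightarrow> test_fun (lattice_mean R \<phi>)"
  unfolding lattice_mean_def by (intro test_cmult test_sum test_translate)

text \<open>Both sides are the same double average of the indicator of one cell over the shifts
  \<open>k + l\<close>.\<close>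

lemma lattice_mean_commute: "lattice_mean R (mean_cells S) = lattice_mean S (mean_cells R)"
proof
  fix z
  have e: "(\<Sum>k\<in>lattice_disc R. ind (cells S) (z - k)) = (\<Sum>k\<in>lattice_disc R. \<Sum>l\<in>lattice_disc S. ind unit_cell (z - k - l))" for R S
    by (simp add: cells_sum)
  have "(\<Sum>k\<in>lattice_disc R. ind (cells S) (z - k)) = (\<Sum>k\<in>lattice_disc S. ind (cells R) (z - k))"
    unfolding e by (subst sum.swap) (simp add: algebra_simps)
  then show "lattice_mean R (mean_cells S) z = lattice_mean S (mean_cells R) z"
    unfolding lattice_mean_def mean_cells_def sum_distrib_left[symmetric] by simp
qed

text \<open>Shifting by \<open>t\<close> changes the modulus by at most \<open>cmod t\<close> and
  passing to the corner by at most 2, so membership can change only near the circle.\<close>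

lemma cells_translate_diff:
  "cmod (ind (cells R) (z - t) - ind (cells R) z) \<le> indicator (annulus R (cmod t + 2)) z"
proof (cases "z \<in> annulus R (cmod t + 2)")
  case True
  then show ?thesis by (simp add: indicator_def)
next
  case False
  have *: "\<bar>cmod z - cmod (corner z)\<bar> \<le> 2" "\<bar>cmod (z - t) - cmod (corner (z - t))\<bar> \<le> 2"
    "\<bar>cmod (z - t) - cmod z\<bar> \<le> cmod t"
    using norm_triangle_ineq3[of z "corner z"] corner_close[of z]
      norm_triangle_ineq3[of "z - t" "corner (z - t)"] corner_close[of "z - t"] norm_triangle_ineq3[of "z - t" z]
    by auto
  then have "z - t \<in> cells R \<longleftrightarrow> z \<in> cells R"
    using False unfolding annulus_def cells_def mem_Collect_eq by linarith
  then show ?thesis by (simp add: indicator_def)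
qed

text \<open>Divided by R^2 rather than by the area, so that away from the circle it equals the d-bar
  derivative of the Cauchy transform \<open>cauchy_disc R\<close>.\<close>

definition disc_mean :: "real \<Rightarrow> complex \<Rightarrow> complex" where
  "disc_mean R z = ind (cball 0 R) z / of_real (R\<^sup>2)"

lemma test_disc_mean: "test_fun (disc_mean R)"
  using test_cmult[OF test_indicator[of "cball 0 R"], of "1 / of_real (R\<^sup>2)"]
  by (simp add: disc_mean_def[abs_def])

section \<open>Cell and disc averages in the second moment seminorm\<close>

context stationary_pp
begin

text \<open>The Folner property in the seminorm: a shift affects only a boundary annulus, of size
  O(R), against a normalisation of order R^2.\<close>

lemma mean_cells_translate:
  "((\<lambda>R. nrm (\<lambda>z. mean_cells R (z - t) - mean_cells R z)) \<longlongrightarrow> 0) at_top"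
proof -
  obtain C where C: "C \<ge> 0" "\<And>R. R \<ge> 1 \<Longrightarrow> nrm (ind (annulus R (cmod t + 2))) \<le> C * R"
    using nrm_annulus by blast
  obtain L where L: "L > 0" "\<And>R. R \<ge> 2 \<Longrightarrow> L * (R - 2)\<^sup>2 \<le> lattice_count R"
    using lattice_count_asymp by blast
  have le: "nrm (\<lambda>z. mean_cells R (z - t) - mean_cells R z) \<le> 4 * C / L * (1 / R)" if R: "R \<ge> 4" for R
  proof -
    have n: "L * (R / 2)\<^sup>2 \<le> lattice_count R"
    proof -
      have "L * (R / 2)\<^sup>2 \<le> L * (R - 2)\<^sup>2" using R L by (intro mult_left_mono power_mono) auto
      then show ?thesis using L(2)[of R] R by linarith
    qed
    have p: "lattice_count R > 0" "L * (R / 2)\<^sup>2 > 0" using lattice_count_pos[of R] R L by auto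
    have "(\<lambda>z. mean_cells R (z - t) - mean_cells R z) =
      (\<lambda>z. of_real (1 / lattice_count R) * (ind (cells R) (z - t) - ind (cells R) z))"
      by (simp add: mean_cells_def algebra_simps)
    then have "nrm (\<lambda>z. mean_cells R (z - t) - mean_cells R z) =
      1 / lattice_count R * nrm (\<lambda>z. ind (cells R) (z - t) - ind (cells R) z)"
      using p by (simp only: nrm_cmult norm_of_real) simp
    also have "\<dots> \<le> 1 / lattice_count R * nrm (ind (annulus R (cmod t + 2)))"
      using p by (intro mult_left_mono nrm_mono cells_translate_diff test_ind_annulus test_diff
          test_translate[OF test_ind_cells] test_ind_cells) auto
    also have "\<dots> \<le> 1 / (L * (R / 2)\<^sup>2) * (C * R)"
      using p n R C(2)[of R] C(1) by (intro mult_mono divide_left_mono nrm_nonneg) auto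
    also have "\<dots> = 4 * C / L * (1 / R)" using R L by (simp add: power2_eq_square field_simps)
    finally show ?thesis .
  qed
  show ?thesis
  proof (rule tendsto_sandwich[OF _ _ tendsto_const])
    show "\<forall>\<^sub>F R in at_top. nrm (\<lambda>z. mean_cells R (z - t) - mean_cells R z) \<le> 4 * C / L * (1 / R)"
      using eventually_ge_at_top[of 4] by eventually_elim (rule le)
    show "((\<lambda>R. 4 * C / L * (1 / R)) \<longlongrightarrow> 0) at_top" by real_asymp
  qed (auto simp: nrm_nonneg)
qed

text \<open>Averaging translates is a contraction, by the triangle inequality and
  stationarity.\<close>

lemma nrm_lattice_mean:
  assumes "test_fun \<phi>" "R \<ge> 0"
  shows "nrm (lattice_mean R \<phi>) \<le> nrm \<phi>"
proof -
  have p: "lattice_count R > 0" using lattice_count_pos[OF assms(2)] by simp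
  have "nrm (lattice_mean R \<phi>) = 1 / lattice_count R * nrm (\<lambda>z. \<Sum>k\<in>lattice_disc R. \<phi> (z - k))"
    unfolding lattice_mean_def nrm_cmult using p by (simp add: norm_divide)
  also have "\<dots> \<le> 1 / lattice_count R * (\<Sum>k\<in>lattice_disc R. nrm (\<lambda>z. \<phi> (z - k)))"
    using p by (intro mult_left_mono nrm_sum test_translate assms) auto
  also have "\<dots> = nrm \<phi>"
    using p by (simp add: nrm_translate test_bsupp assms lattice_count_def)
  finally show ?thesis .
qed

text \<open>After exchanging the two averages the shifts range over the fixed finite set
  \<open>lattice_disc S\<close>, and each such shift leaves \<open>mean_cells R\<close>
  asymptotically unchanged.\<close>

lemma lattice_mean_mean_cells:
  assumes "S \<ge> 0"
  shows "((\<lambda>R. nrm (\<lambda>z. lattice_mean R (mean_cells S) z - mean_cells R z)) \<longlongrightarrow> 0) at_top"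
proof -
  have p: "lattice_count S > 0" using lattice_count_pos[OF assms] by simp
  have le: "nrm (\<lambda>z. lattice_mean R (mean_cells S) z - mean_cells R z) \<le>
    1 / lattice_count S * (\<Sum>k\<in>lattice_disc S. nrm (\<lambda>z. mean_cells R (z - k) - mean_cells R z))" for R
  proof -
    have "(\<lambda>z. lattice_mean R (mean_cells S) z - mean_cells R z) =
      (\<lambda>z. of_real (1 / lattice_count S) * (\<Sum>k\<in>lattice_disc S. mean_cells R (z - k) - mean_cells R z))"
      using p unfolding lattice_mean_commute[of R S]
      by (simp add: lattice_mean_def fun_eq_iff sum_subtractf lattice_count_def algebra_simps)
    then have "nrm (\<lambda>z. lattice_mean R (mean_cells S) z - mean_cells R z) =
      1 / lattice_count S * nrm (\<lambda>z. \<Sum>k\<in>lattice_disc S. mean_cells R (z - k) - mean_cells R z)"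
      using p by (simp only: nrm_cmult norm_of_real) simp
    also have "\<dots> \<le> 1 / lattice_count S * (\<Sum>k\<in>lattice_disc S. nrm (\<lambda>z. mean_cells R (z - k) - mean_cells R z))"
      using p by (intro mult_left_mono nrm_sum test_diff test_translate test_mean_cells) auto
    finally show ?thesis .
  qed
  have "((\<lambda>R. 1 / lattice_count S * (\<Sum>k\<in>lattice_disc S. nrm (\<lambda>z. mean_cells R (z - k) - mean_cells R z)))
      \<longlongrightarrow> 1 / lattice_count S * (\<Sum>k\<in>lattice_disc S. 0)) at_top"
    by (intro tendsto_intros mean_cells_translate)
  then have lim: "((\<lambda>R. 1 / lattice_count S * (\<Sum>k\<in>lattice_disc S. nrm (\<lambda>z. mean_cells R (z - k) - mean_cells R z)))
      \<longlongrightarrow> 0) at_top" by simp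
  show ?thesis
    by (rule tendsto_sandwich[OF _ _ tendsto_const lim]) (use le nrm_nonneg in auto)
qed

text \<open>Averaging \<open>mean_cells S\<close> over a large lattice disc gives nearly
  \<open>mean_cells R\<close> and does not increase the seminorm, so the limit superior is at most
  the value at each \<open>S\<close>. The same averaging applied to a sum of two handles midpoints,
  which need not belong to the family whose infimum is taken.\<close>

lemma nrm_mean_cells_limit:
  defines "\<iota> \<equiv> Inf ((\<lambda>R. nrm (mean_cells R)) ` {0..})"
  shows "((\<lambda>R. nrm (mean_cells R)) \<longlongrightarrow> \<iota>) at_top"
    and "\<And>S S'. S \<ge> 0 \<Longrightarrow> S' \<ge> 0 \<Longrightarrow> 2 * \<iota> \<le> nrm (\<lambda>z. mean_cells S z + mean_cells S' z)"
proof -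
  define e where "e S R = nrm (\<lambda>z. lattice_mean R (mean_cells S) z - mean_cells R z)" for S R
  have e: "((\<lambda>R. e S R) \<longlongrightarrow> 0) at_top" if "S \<ge> 0" for S
    unfolding e_def by (rule lattice_mean_mean_cells[OF that])
  have \<iota>: "\<iota> \<le> nrm (mean_cells R)" if "R \<ge> 0" for R
    unfolding \<iota>_def using that by (intro cInf_lower bdd_belowI[of _ 0]) (auto simp: nrm_nonneg)
  have le: "2 * nrm (mean_cells R) \<le> nrm (\<lambda>z. mean_cells S z + mean_cells S' z) + (e S R + e S' R)"
    if R: "R \<ge> 0" for R S S'
  proof -
    define h where "h = (\<lambda>z. mean_cells S z + mean_cells S' z)"
    have h: "test_fun h" unfolding h_def by (intro test_add test_mean_cells)
    have split: "(\<lambda>z. 2 * mean_cells R z) = (\<lambda>z. lattice_mean R h z -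
      ((lattice_mean R (mean_cells S) z - mean_cells R z) + (lattice_mean R (mean_cells S') z - mean_cells R z)))"
      by (simp add: fun_eq_iff lattice_mean_def h_def sum.distrib algebra_simps)
    have "2 * nrm (mean_cells R) = nrm (\<lambda>z. 2 * mean_cells R z)" by (simp add: nrm_cmult)
    also have "\<dots> \<le> nrm (lattice_mean R h) + nrm (\<lambda>z. (lattice_mean R (mean_cells S) z - mean_cells R z)
      + (lattice_mean R (mean_cells S') z - mean_cells R z))"
      unfolding split by (intro nrm_diff test_lattice_mean h test_add test_diff test_mean_cells)
    also have "nrm (lattice_mean R h) \<le> nrm h" by (rule nrm_lattice_mean[OF h R])
    also have "nrm (\<lambda>z. (lattice_mean R (mean_cells S) z - mean_cells R z)
      + (lattice_mean R (mean_cells S') z - mean_cells R z)) \<le> e S R + e S' R"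
      unfolding e_def by (intro nrm_add test_lattice_mean h test_add test_diff test_mean_cells)
    finally show ?thesis by (simp add: h_def)
  qed
  show "2 * \<iota> \<le> nrm (\<lambda>z. mean_cells S z + mean_cells S' z)" if "S \<ge> 0" "S' \<ge> 0" for S S'
  proof (rule tendsto_lowerbound)
    show "((\<lambda>R. nrm (\<lambda>z. mean_cells S z + mean_cells S' z) + (e S R + e S' R)) \<longlongrightarrow> nrm (\<lambda>z. mean_cells S z + mean_cells S' z)) at_top"
      using tendsto_add[OF tendsto_const tendsto_add[OF e[OF that(1)] e[OF that(2)]],
          of "nrm (\<lambda>z. mean_cells S z + mean_cells S' z)"] by simp
    show "\<forall>\<^sub>F R in at_top. 2 * \<iota> \<le> nrm (\<lambda>z. mean_cells S z + mean_cells S' z) + (e S R + e S' R)"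
      using eventually_ge_at_top[of 0] 
    proof eventually_elim
      case (elim R)
      show ?case using le[OF elim, of S S'] \<iota>[OF elim] by linarith
    qed
  qed simp
  show "((\<lambda>R. nrm (mean_cells R)) \<longlongrightarrow> \<iota>) at_top"
  proof (rule order_tendstoI)
    fix a assume "a < \<iota>"
    then show "\<forall>\<^sub>F R in at_top. a < nrm (mean_cells R)"
      using \<iota> by (intro eventually_mono[OF eventually_ge_at_top[of "0::real"]]) (meson less_le_trans)
  next
    fix a assume "\<iota> < a"
    then obtain S where S: "S \<ge> 0" "nrm (mean_cells S) < a"
      unfolding \<iota>_def by (subst (asm) cInf_less_iff) (auto intro!: bdd_belowI[of _ 0] simp: nrm_nonneg)
    have dbl: "nrm (\<lambda>z. mean_cells S z + mean_cells S z) = 2 * nrm (mean_cells S)"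
      using nrm_cmult[of 2 "mean_cells S"] by simp
    have "\<forall>\<^sub>F R in at_top. e S R < a - nrm (mean_cells S)"
      using S by (intro order_tendstoD(2)[OF e]) auto
    then show "\<forall>\<^sub>F R in at_top. nrm (mean_cells R) < a"
      using eventually_ge_at_top[of 0]
    proof eventually_elim
      case (elim R)
      then show ?case using le[of R S S] dbl by simp
    qed
  qed
qed

text \<open>The averages are asymptotically of minimal norm, so by the parallelogram law they are Cauchy:
  this is von Neumann's proof of the mean ergodic theorem.\<close>

lemma mean_cells_Cauchy:
  assumes "\<epsilon> > 0"
  shows "\<exists>R0\<ge>0. \<forall>R\<ge>R0. \<forall>R'\<ge>R0. nrm (\<lambda>z. mean_cells R z - mean_cells R' z) < \<epsilon>"
proof -
  define \<iota> where "\<iota> = Inf ((\<lambda>R. nrm (mean_cells R)) ` {0..})"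
  have \<iota>: "\<iota> \<ge> 0" unfolding \<iota>_def by (rule cInf_greatest) (auto simp: nrm_nonneg)
  have "((\<lambda>R. (nrm (mean_cells R))\<^sup>2) \<longlongrightarrow> \<iota>\<^sup>2) at_top"
    unfolding \<iota>_def by (intro tendsto_intros nrm_mean_cells_limit)
  then have "\<forall>\<^sub>F R in at_top. (nrm (mean_cells R))\<^sup>2 < \<iota>\<^sup>2 + \<epsilon>\<^sup>2 / 4"
    by (rule order_tendstoD) (use assms in auto)
  then obtain R1 where R1: "\<And>R. R \<ge> R1 \<Longrightarrow> (nrm (mean_cells R))\<^sup>2 < \<iota>\<^sup>2 + \<epsilon>\<^sup>2 / 4"
    by (auto simp: eventually_at_top_linorder)
  have "nrm (\<lambda>z. mean_cells R z - mean_cells R' z) < \<epsilon>" if "R \<ge> max R1 0" "R' \<ge> max R1 0" for R R'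
  proof -
    have "(2 * \<iota>)\<^sup>2 \<le> (nrm (\<lambda>z. mean_cells R z + mean_cells R' z))\<^sup>2"
      using nrm_mean_cells_limit(2)[of R R'] that \<iota> unfolding \<iota>_def[symmetric] by (intro power_mono) auto
    \<comment> \<open>The slack \<epsilon>^2/4 is exactly what the parallelogram law affords: 4
      (\<iota>^2 + \<epsilon>^2/4) - (2 \<iota>)^2 = \<epsilon>^2.\<close>
    then have "(nrm (\<lambda>z. mean_cells R z - mean_cells R' z))\<^sup>2 < \<epsilon>\<^sup>2"
      using parallelogram_nrm[OF test_mean_cells test_mean_cells, of R R'] R1[of R] R1[of R'] that
      by (simp add: power_mult_distrib)
    then show ?thesis using assms by (simp add: power2_less_imp_less)
  qed
  then show ?thesis by (intro exI[of _ "max R1 0"]) auto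
qed

text \<open>With \<open>lattice_count R\<close> about \<open>L\<close> times R^2, the disc average
  differs from \<open>L\<close> times the cell average by a boundary annulus over R^2 and by a
  discrepancy of normalisations; both contribute O(1/R).\<close>

lemma disc_mean_Cauchy:
  assumes "\<epsilon> > 0"
  shows "\<exists>R0\<ge>0. \<forall>R\<ge>R0. \<forall>R'\<ge>R0. nrm (\<lambda>z. disc_mean R z - disc_mean R' z) < \<epsilon>"
proof -
  obtain L where L: "L > 0" "\<And>R. R \<ge> 2 \<Longrightarrow> L * (R - 2)\<^sup>2 \<le> lattice_count R \<and> lattice_count R \<le> L * (R + 2)\<^sup>2"
    using lattice_count_asymp by blast
  obtain C where C: "C \<ge> 0" "\<And>R. R \<ge> 1 \<Longrightarrow> nrm (ind (annulus R 2)) \<le> C * R"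
    using nrm_annulus by blast
  define d where "d R = nrm (\<lambda>z. disc_mean R z - of_real L * mean_cells R z)" for R
  have tm: "test_fun (\<lambda>z. of_real L * mean_cells R z)" for R by (intro test_cmult test_mean_cells)
  have dle: "d R \<le> C / R + 8 * L / R * nrm (mean_cells R)" if R: "R \<ge> 2" for R
  proof -
    have p: "lattice_count R > 0" using lattice_count_pos[of R] R by simp
    have close: "cmod (ind (cball 0 R) z - ind (cells R) z) \<le> indicator (annulus R 2) z" for z
    proof (cases "z \<in> annulus R 2")
      case False
      have "\<bar>cmod z - cmod (corner z)\<bar> \<le> 2"
        using norm_triangle_ineq3[of z "corner z"] corner_close[of z] by linarith
      then have "z \<in> cball 0 R \<longleftrightarrow> z \<in> cells R"
        using False unfolding annulus_def cells_def mem_Collect_eq mem_cball_0 by linarith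
      then show ?thesis by (simp add: indicator_def)
    qed (simp add: indicator_def)
    have eq: "(\<lambda>z. disc_mean R z - of_real L * mean_cells R z) =
      (\<lambda>z. of_real (1 / R\<^sup>2) * (ind (cball 0 R) z - ind (cells R) z) +
        of_real (lattice_count R / R\<^sup>2 - L) * mean_cells R z)"
      using p R by (simp add: fun_eq_iff disc_mean_def mean_cells_def field_simps)
    have "d R \<le> nrm (\<lambda>z. of_real (1 / R\<^sup>2) * (ind (cball 0 R) z - ind (cells R) z)) +
       nrm (\<lambda>z. of_real (lattice_count R / R\<^sup>2 - L) * mean_cells R z)"
      unfolding d_def eq by (intro nrm_add test_cmult test_diff test_mean_cells test_ind_cells test_indicator) auto
    also have "nrm (\<lambda>z. of_real (1 / R\<^sup>2) * (ind (cball 0 R) z - ind (cells R) z)) =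
      1 / R\<^sup>2 * nrm (\<lambda>z. ind (cball 0 R) z - ind (cells R) z)"
      by (subst nrm_cmult) (simp add: norm_divide norm_power)
    also have "\<dots> \<le> 1 / R\<^sup>2 * nrm (ind (annulus R 2))"
      by (intro mult_left_mono nrm_mono close test_diff test_ind_cells test_ind_annulus test_indicator) auto
    also have "\<dots> \<le> 1 / R\<^sup>2 * (C * R)" using C(2)[of R] R by (intro mult_left_mono) auto
    also have "\<dots> = C / R" using R by (simp add: power2_eq_square)
    also have "nrm (\<lambda>z. of_real (lattice_count R / R\<^sup>2 - L) * mean_cells R z) =
      \<bar>lattice_count R / R\<^sup>2 - L\<bar> * nrm (mean_cells R)"
      by (subst nrm_cmult) (simp only: norm_of_real)
    also have "\<dots> \<le> 8 * L / R * nrm (mean_cells R)"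
    proof (rule mult_right_mono[OF _ nrm_nonneg])
      \<comment> \<open>These are the expansions of (R + 2)^2 and (R - 2)^2; the remainder is then
        absorbed into \<open>8 * R\<close>.\<close>
      have a: "lattice_count R - L * R\<^sup>2 \<le> L * (4 * R + 4)" "L * R\<^sup>2 - lattice_count R \<le> L * (4 * R - 4)"
        using L(2)[OF R] by (auto simp: power2_eq_square algebra_simps)
      have b: "L * (4 * R + 4) \<le> L * (8 * R)" "L * (4 * R - 4) \<le> L * (8 * R)"
        using L(1) R by (auto intro!: mult_left_mono)
      have "\<bar>lattice_count R - L * R\<^sup>2\<bar> \<le> 8 * L * R" using a b by (simp add: abs_le_iff)
      then have "\<bar>lattice_count R - L * R\<^sup>2\<bar> / R\<^sup>2 \<le> 8 * L * R / R\<^sup>2" by (rule divide_right_mono) simp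
      also have "8 * L * R / R\<^sup>2 = 8 * L / R" using R by (simp add: power2_eq_square)
      also have "\<bar>lattice_count R - L * R\<^sup>2\<bar> / R\<^sup>2 = \<bar>lattice_count R / R\<^sup>2 - L\<bar>"
      proof -
        have "lattice_count R / R\<^sup>2 - L = (lattice_count R - L * R\<^sup>2) / R\<^sup>2" using R by (simp add: field_simps)
        then show ?thesis by (simp add: abs_divide)
      qed
      finally show "\<bar>lattice_count R / R\<^sup>2 - L\<bar> \<le> 8 * L / R" .
    qed
    finally show ?thesis by simp
  qed
  \<comment> \<open>\<open>nrm (mean_cells R)\<close> converges, so its product with a factor of
    order 1/R vanishes.\<close>
  have "((\<lambda>R. C / R + 8 * L / R * nrm (mean_cells R)) \<longlongrightarrow> 0 + 0 * Inf ((\<lambda>R. nrm (mean_cells R)) ` {0..})) at_top"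
    by (intro tendsto_add tendsto_mult nrm_mean_cells_limit) real_asymp+
  then have lim: "((\<lambda>R. C / R + 8 * L / R * nrm (mean_cells R)) \<longlongrightarrow> 0) at_top" by simp
  have "\<forall>\<^sub>F R in at_top. C / R + 8 * L / R * nrm (mean_cells R) < \<epsilon> / 3"
    by (rule order_tendstoD(2)[OF lim]) (use assms in simp)
  then obtain R1 where R1: "\<And>R. R \<ge> R1 \<Longrightarrow> C / R + 8 * L / R * nrm (mean_cells R) < \<epsilon> / 3"
    by (auto simp: eventually_at_top_linorder)
  have "\<epsilon> / (3 * L) > 0" using assms L by simp
  from mean_cells_Cauchy[OF this] obtain R2 where
    R2: "\<And>R R'. R \<ge> R2 \<Longrightarrow> R' \<ge> R2 \<Longrightarrow> nrm (\<lambda>z. mean_cells R z - mean_cells R' z) < \<epsilon> / (3 * L)" by blast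
  have "nrm (\<lambda>z. disc_mean R z - disc_mean R' z) < \<epsilon>" if R: "R \<ge> max 2 (max R1 R2)" and R': "R' \<ge> max 2 (max R1 R2)" for R R'
  proof -
    have "nrm (\<lambda>z. disc_mean R z - disc_mean R' z) \<le>
      nrm (\<lambda>z. disc_mean R z - of_real L * mean_cells R z) + nrm (\<lambda>z. of_real L * mean_cells R z - disc_mean R' z)"
      by (rule nrm_triangle[OF test_disc_mean tm test_disc_mean])
    also have "nrm (\<lambda>z. of_real L * mean_cells R z - disc_mean R' z) \<le>
      nrm (\<lambda>z. of_real L * mean_cells R z - of_real L * mean_cells R' z) + nrm (\<lambda>z. of_real L * mean_cells R' z - disc_mean R' z)"
      by (rule nrm_triangle[OF tm tm test_disc_mean])
    also have "nrm (\<lambda>z. of_real L * mean_cells R' z - disc_mean R' z) = d R'"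
      unfolding d_def by (rule nrm_commute)
    also have "nrm (\<lambda>z. of_real L * mean_cells R z - of_real L * mean_cells R' z) = L * nrm (\<lambda>z. mean_cells R z - mean_cells R' z)"
      using nrm_cmult[of "of_real L" "\<lambda>z. mean_cells R z - mean_cells R' z"] L by (simp add: right_diff_distrib)
    also have "L * nrm (\<lambda>z. mean_cells R z - mean_cells R' z) < \<epsilon> / 3"
      using R2[of R R'] R R' L by (simp add: field_simps)
    also have "nrm (\<lambda>z. disc_mean R z - of_real L * mean_cells R z) = d R" by (simp add: d_def)
    finally have "nrm (\<lambda>z. disc_mean R z - disc_mean R' z) < d R + (\<epsilon> / 3 + d R')" by simp
    moreover have "d R < \<epsilon> / 3" by (rule le_less_trans[OF dle R1]) (use R in auto)
    moreover have "d R' < \<epsilon> / 3" by (rule le_less_trans[OF dle R1]) (use R' in auto)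
    ultimately show ?thesis by linarith
  qed
  then show ?thesis by (intro exI[of _ "max 2 (max R1 R2)"]) auto
qed

end

section \<open>The discrete Beurling transform\<close>

text \<open>The Cauchy transform of the normalised disc: \<open>\<partial>-bar\<close> of it is \<open>R\<^sup>-\<^sup>2\<close> on the disc,
  and \<open>\<partial>\<close> of it is \<open>-1/z\<^sup>2\<close> off the disc.\<close>

definition cauchy_disc :: "real \<Rightarrow> complex \<Rightarrow> complex" where
  "cauchy_disc R z = (if cmod z \<le> R then cnj z / of_real (R\<^sup>2) else 1 / z)"

text \<open>The two formulas agree on the circle, so a unit step across it still costs only O(R^-2).
  In the mixed case, writing 1/b as \<open>cnj b\<close> over |b|^2 splits off a linear part with
  constant 1 and a radial part with constant 2, whence the 3.\<close>

lemma cauchy_disc_lipschitz: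
  assumes R: "R > 0"
  shows "cmod (cauchy_disc R a - cauchy_disc R b) \<le> 3 * cmod (a - b) / R\<^sup>2"
proof -
  have in_in: "cmod (cauchy_disc R a - cauchy_disc R b) \<le> 3 * cmod (a - b) / R\<^sup>2"
    if "cmod a \<le> R" "cmod b \<le> R" for a b
  proof -
    have "cauchy_disc R a - cauchy_disc R b = cnj (a - b) / of_real (R\<^sup>2)"
      using that by (simp add: cauchy_disc_def diff_divide_distrib)
    then have "cmod (cauchy_disc R a - cauchy_disc R b) = cmod (a - b) / R\<^sup>2"
      by (simp only: norm_divide complex_mod_cnj norm_of_real) simp
    also have "\<dots> \<le> 3 * cmod (a - b) / R\<^sup>2" by (intro divide_right_mono) auto
    finally show ?thesis .
  qed
  have out_out: "cmod (cauchy_disc R a - cauchy_disc R b) \<le> 3 * cmod (a - b) / R\<^sup>2"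
    if a: "cmod a > R" and b: "cmod b > R" for a b
  proof -
    have nz: "a \<noteq> 0" "b \<noteq> 0" using a b R by auto
    have "cauchy_disc R a - cauchy_disc R b = (b - a) / (a * b)"
      using a b nz by (simp add: cauchy_disc_def field_simps)
    then have "cmod (cauchy_disc R a - cauchy_disc R b) = cmod (a - b) / (cmod a * cmod b)"
      by (simp add: norm_divide norm_mult norm_minus_commute)
    also have "\<dots> \<le> cmod (a - b) / R\<^sup>2"
      using a b R unfolding power2_eq_square by (intro divide_left_mono mult_mono mult_pos_pos) auto
    also have "\<dots> \<le> 3 * cmod (a - b) / R\<^sup>2" by (intro divide_right_mono) auto
    finally show ?thesis .
  qed
  have in_out: "cmod (cauchy_disc R a - cauchy_disc R b) \<le> 3 * cmod (a - b) / R\<^sup>2"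
    if a: "cmod a \<le> R" and b: "cmod b > R" for a b
  proof -
    define \<beta> where "\<beta> = cmod b"
    have \<beta>: "\<beta> > R" "\<beta> > 0" using b R by (auto simp: \<beta>_def)
    have "1 / b = cnj b / of_real (\<beta>\<^sup>2)"
      by (metis \<beta>_def complex_div_cnj divide_divide_eq_left mult_1 of_real_power complex_cnj_one)
    then have "cauchy_disc R a - cauchy_disc R b = cnj (a - b) / of_real (R\<^sup>2) + cnj b * of_real (1 / R\<^sup>2 - 1 / \<beta>\<^sup>2)"
      using a b by (simp add: cauchy_disc_def algebra_simps diff_divide_distrib)
    then have "cmod (cauchy_disc R a - cauchy_disc R b) \<le> cmod (cnj (a - b) / of_real (R\<^sup>2)) + cmod (cnj b * of_real (1 / R\<^sup>2 - 1 / \<beta>\<^sup>2))"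
      by (simp only: norm_triangle_ineq)
    also have "cmod (cnj (a - b) / of_real (R\<^sup>2)) = cmod (a - b) / R\<^sup>2"
      by (simp only: norm_divide complex_mod_cnj norm_of_real) simp
    also have "cmod (cnj b * of_real (1 / R\<^sup>2 - 1 / \<beta>\<^sup>2)) = \<beta> * \<bar>1 / R\<^sup>2 - 1 / \<beta>\<^sup>2\<bar>"
      by (simp only: norm_mult complex_mod_cnj norm_of_real \<beta>_def)
    also have "\<beta> * \<bar>1 / R\<^sup>2 - 1 / \<beta>\<^sup>2\<bar> \<le> 2 * cmod (a - b) / R\<^sup>2"
    proof -
      have "1 / \<beta>\<^sup>2 \<le> 1 / R\<^sup>2" using \<beta> R by (intro divide_left_mono power_mono mult_pos_pos zero_less_power) auto
      then have "\<beta> * \<bar>1 / R\<^sup>2 - 1 / \<beta>\<^sup>2\<bar> = \<beta> * (1 / R\<^sup>2 - 1 / \<beta>\<^sup>2)" by simp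
      also have "\<dots> = (\<beta> - R) * ((\<beta> + R) / \<beta>) / R\<^sup>2"
        using \<beta> R by (simp add: field_simps power2_eq_square)
      also have "\<dots> \<le> cmod (a - b) * 2 / R\<^sup>2"
      proof (intro divide_right_mono mult_mono)
        show "\<beta> - R \<le> cmod (a - b)" using norm_triangle_ineq2[of b a] a by (simp add: \<beta>_def norm_minus_commute)
        show "(\<beta> + R) / \<beta> \<le> 2" using \<beta> R by (simp add: field_simps)
      qed (use \<beta> R in auto)
      finally show ?thesis by (simp only: mult.commute)
    qed
    finally show ?thesis by (simp add: add_divide_distrib[symmetric])
  qed
  consider "cmod a \<le> R" "cmod b \<le> R" | "cmod a > R" "cmod b > R" | "cmod a \<le> R" "cmod b > R" | "cmod b \<le> R" "cmod a > R"
    by linarith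
  then show ?thesis
  proof cases
    case 4
    then show ?thesis using in_out[of b a] by (simp add: norm_minus_commute)
  qed (use in_in in_out out_out in auto)
qed

text \<open>The inequality is strict, complementary to the closed disc in \<open>Psi2\<close>, so a
  difference of two tails is exactly the kernel of an increment of \<open>Psi2\<close>.\<close>

definition tail_kernel :: "real \<Rightarrow> complex \<Rightarrow> complex" where
  "tail_kernel R z = (if cmod z > R then 1 / z\<^sup>2 else 0)"

text \<open>Undivided central differences over distance 2: to leading order this is 4 times the
  Wirtinger derivative, and likewise for \<open>discr_dbar\<close>. This is the origin of the
  factors 4 in the comparisons.\<close>

definition discr_d :: "(complex \<Rightarrow> complex) \<Rightarrow> complex \<Rightarrow> complex" where
  "discr_d g z = (g (z + 1) - g (z - 1)) - \<i> * (g (z + \<i>) - g (z - \<i>))"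

definition discr_dbar :: "(complex \<Rightarrow> complex) \<Rightarrow> complex \<Rightarrow> complex" where
  "discr_dbar g z = (g (z + 1) - g (z - 1)) + \<i> * (g (z + \<i>) - g (z - \<i>))"

text \<open>Inside, differences of the linear map \<open>cnj\<close> are exact. Near the circle, two
  differences over distance 2 with Lipschitz constant 3 give 12. Outside, 1/z is holomorphic but its
  discrete d-bar keeps a third order Taylor term, of order |z|^-4, which is small enough for
  \<open>nrm_tail\<close>.\<close>

lemma cauchy_disc_unit_steps:
  assumes R: "R \<ge> 2"
  shows "z \<in> annulus R 1 \<Longrightarrow> cmod (discr_d (cauchy_disc R) z) \<le> 12 / R\<^sup>2 \<and> cmod (discr_dbar (cauchy_disc R) z) \<le> 12 / R\<^sup>2"
    and "cmod z < R - 1 \<Longrightarrow> discr_d (cauchy_disc R) z = 0 \<and> discr_dbar (cauchy_disc R) z = of_real (4 / R\<^sup>2)"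
    and "cmod z > R + 1 \<Longrightarrow> discr_d (cauchy_disc R) z + 4 / z\<^sup>2 = - (4 / (z\<^sup>2 * (z ^ 4 - 1)))
      \<and> discr_dbar (cauchy_disc R) z = - (4 / (z ^ 4 - 1))"
proof -
  show "cmod (discr_d (cauchy_disc R) z) \<le> 12 / R\<^sup>2 \<and> cmod (discr_dbar (cauchy_disc R) z) \<le> 12 / R\<^sup>2"
  proof -
    have 1: "cmod (cauchy_disc R (z + 1) - cauchy_disc R (z - 1)) \<le> 6 / R\<^sup>2"
      using cauchy_disc_lipschitz[of R "z + 1" "z - 1"] R by simp
    have 2: "cmod (\<i> * (cauchy_disc R (z + \<i>) - cauchy_disc R (z - \<i>))) \<le> 6 / R\<^sup>2"
      using cauchy_disc_lipschitz[of R "z + \<i>" "z - \<i>"] R by (simp add: norm_mult flip: mult_2)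
    show ?thesis unfolding discr_d_def discr_dbar_def
      using norm_triangle_mono[OF 1 2] norm_triangle_le_diff[OF add_mono[OF 1 2]] by simp
  qed
next
  have *: "cmod (z + 1) \<le> cmod z + 1" "cmod (z - 1) \<le> cmod z + 1" "cmod (z + \<i>) \<le> cmod z + 1" "cmod (z - \<i>) \<le> cmod z + 1"
    using norm_triangle_ineq[of z 1] norm_triangle_ineq4[of z 1] norm_triangle_ineq[of z \<i>] norm_triangle_ineq4[of z \<i>] by auto
  assume "cmod z < R - 1"
  then show "discr_d (cauchy_disc R) z = 0 \<and> discr_dbar (cauchy_disc R) z = of_real (4 / R\<^sup>2)"
    using * R by (simp add: discr_d_def discr_dbar_def cauchy_disc_def field_simps)
next
  have *: "cmod (z + 1) \<ge> cmod z - 1" "cmod (z - 1) \<ge> cmod z - 1" "cmod (z + \<i>) \<ge> cmod z - 1" "cmod (z - \<i>) \<ge> cmod z - 1"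
    using norm_diff_ineq[of z 1] norm_triangle_ineq2[of z 1] norm_diff_ineq[of z \<i>] norm_triangle_ineq2[of z \<i>] by auto
  assume z: "cmod z > R + 1"
  have out: "cauchy_disc R (z + 1) = 1 / (z + 1)" "cauchy_disc R (z - 1) = 1 / (z - 1)"
    "cauchy_disc R (z + \<i>) = 1 / (z + \<i>)" "cauchy_disc R (z - \<i>) = 1 / (z - \<i>)"
    using * R z by (auto simp: cauchy_disc_def)
  have nz: "z \<noteq> 0" "z + 1 \<noteq> 0" "z - 1 \<noteq> 0" "z + \<i> \<noteq> 0" "z - \<i> \<noteq> 0"
    using * R z by auto
  have p: "z\<^sup>2 - 1 = (z + 1) * (z - 1)" "z\<^sup>2 + 1 = (z + \<i>) * (z - \<i>)" "z ^ 4 - 1 = (z\<^sup>2 - 1) * (z\<^sup>2 + 1)"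
    by (simp_all add: algebra_simps power2_eq_square power4_eq_xxxx)
  have nz2: "z\<^sup>2 - 1 \<noteq> 0" "z\<^sup>2 + 1 \<noteq> 0" unfolding p using nz by auto
  have a: "1 / (z + 1) - 1 / (z - 1) = - (2 / (z\<^sup>2 - 1))" unfolding p using nz by (simp add: field_simps)
  have b: "1 / (z + \<i>) - 1 / (z - \<i>) = - (2 * \<i> / (z\<^sup>2 + 1))" unfolding p using nz by (simp add: field_simps)
  have c: "- (2 / (z\<^sup>2 - 1)) + 2 / (z\<^sup>2 + 1) = - (4 / (z ^ 4 - 1))"
    unfolding p(3) using nz2 by (simp add: divide_simps)
  have d: "- (2 / (z\<^sup>2 - 1)) - 2 / (z\<^sup>2 + 1) + 4 / z\<^sup>2 = - (4 / (z\<^sup>2 * (z ^ 4 - 1)))"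
    unfolding p(3) using nz2 nz by (simp add: divide_simps) (simp add: algebra_simps)
  have "discr_d (cauchy_disc R) z = - (2 / (z\<^sup>2 - 1)) - 2 / (z\<^sup>2 + 1)"
    "discr_dbar (cauchy_disc R) z = - (2 / (z\<^sup>2 - 1)) + 2 / (z\<^sup>2 + 1)"
    unfolding discr_d_def discr_dbar_def out a b by (simp_all add: algebra_simps)
  then show "discr_d (cauchy_disc R) z + 4 / z\<^sup>2 = - (4 / (z\<^sup>2 * (z ^ 4 - 1)))
      \<and> discr_dbar (cauchy_disc R) z = - (4 / (z ^ 4 - 1))"
    using c d by simp
qed

text \<open>In the annulus 16 is 12 for the differences plus 4 for the kernel itself. Outside,
  errors of order |z|^-6 and |z|^-4 are relaxed to the cube that \<open>nrm_tail\<close> handles.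
  The cutoff \<open>T\<close> gives bounded support.\<close>

definition step_error :: "real \<Rightarrow> real \<Rightarrow> complex \<Rightarrow> real" where
  "step_error R T z = 16 / R\<^sup>2 * indicator (annulus R 1) z + 8 * (indicator {z. R < cmod z \<and> cmod z \<le> T} z / cmod z ^ 3)"

lemma step_error_nonneg: "step_error R T z \<ge> 0"
  by (simp add: step_error_def)

lemma cauchy_disc_step_error:
  assumes R: "R \<ge> 2" and T: "cmod z \<le> T"
  shows "cmod (discr_d (cauchy_disc R) z + 4 * tail_kernel R z) \<le> step_error R T z"
    and "cmod (discr_dbar (cauchy_disc R) z - 4 * disc_mean R z) \<le> step_error R T z"
proof -
  consider "z \<in> annulus R 1" | "cmod z < R - 1" | "cmod z > R + 1"
    unfolding annulus_def mem_Collect_eq by linarith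
  then have "cmod (discr_d (cauchy_disc R) z + 4 * tail_kernel R z) \<le> step_error R T z \<and>
    cmod (discr_dbar (cauchy_disc R) z - 4 * disc_mean R z) \<le> step_error R T z"
  proof cases
    case 1
    have t: "cmod (4 * tail_kernel R z) \<le> 4 / R\<^sup>2"
    proof (cases "cmod z > R")
      case True
      then have "1 / (cmod z)\<^sup>2 \<le> 1 / R\<^sup>2"
        using R by (intro divide_left_mono power_mono mult_pos_pos zero_less_power) auto
      then show ?thesis using True by (simp add: tail_kernel_def norm_divide norm_power)
    qed (simp add: tail_kernel_def)
    have m: "cmod (4 * disc_mean R z) \<le> 4 / R\<^sup>2"
      by (simp add: disc_mean_def norm_divide norm_power norm_mult indicator_def)
    have "16 / R\<^sup>2 \<le> step_error R T z" using 1 by (simp add: step_error_def)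
    then show ?thesis
      using norm_triangle_mono[OF conjunct1[OF cauchy_disc_unit_steps(1)[OF R 1]] t]
        norm_triangle_le_diff[OF add_mono[OF conjunct2[OF cauchy_disc_unit_steps(1)[OF R 1]] m]] by simp
  next
    case 2
    then show ?thesis using cauchy_disc_unit_steps(2)[OF R 2] R step_error_nonneg[of R T z]
      by (simp add: tail_kernel_def disc_mean_def)
  next
    case 3
    define r where "r = cmod z"
    have r: "r \<ge> 3" using 3 R by (simp add: r_def)
    have "r ^ 4 \<ge> 3 * r ^ 3" using r mult_right_mono[of 3 r "r ^ 3"] by (simp add: power4_eq_xxxx power3_eq_cube)
    moreover have "r ^ 3 \<ge> 3 ^ 3" using r by (intro power_mono) auto
    ultimately have r4: "r ^ 4 - 1 \<ge> r ^ 3" "r ^ 4 - 1 \<ge> r" "r ^ 3 > 0"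
    proof -
      have "r ^ 3 \<ge> r" using r power_increasing[of 1 3 r] by simp
      then show "r ^ 4 - 1 \<ge> r ^ 3" "r ^ 4 - 1 \<ge> r" "r ^ 3 > 0"
        using \<open>r ^ 4 \<ge> 3 * r ^ 3\<close> \<open>r ^ 3 \<ge> 3 ^ 3\<close> r by auto
    qed
    have n4: "cmod (z ^ 4 - 1) \<ge> r ^ 4 - 1" using norm_triangle_ineq2[of "z ^ 4" 1] by (simp add: norm_power r_def)
    have se: "8 / r ^ 3 \<le> step_error R T z" using 3 R T by (simp add: step_error_def r_def)
    have "cmod (- (4 / (z\<^sup>2 * (z ^ 4 - 1)))) = 4 / (r\<^sup>2 * cmod (z ^ 4 - 1))"
      by (simp add: norm_divide norm_mult norm_power r_def)
    also have "\<dots> \<le> 4 / (r\<^sup>2 * r)"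
      using r4 n4 r by (intro divide_left_mono mult_left_mono mult_pos_pos) auto
    also have "\<dots> = 4 / r ^ 3" by (simp add: power2_eq_square power3_eq_cube)
    also have "\<dots> \<le> 8 / r ^ 3" using r by (intro divide_right_mono) auto
    finally have A: "cmod (- (4 / (z\<^sup>2 * (z ^ 4 - 1)))) \<le> 8 / r ^ 3" .
    have "cmod (- (4 / (z ^ 4 - 1))) = 4 / cmod (z ^ 4 - 1)" by (simp add: norm_divide)
    also have "\<dots> \<le> 4 / r ^ 3"
      using r4 n4 r by (intro divide_left_mono mult_pos_pos) auto
    also have "\<dots> \<le> 8 / r ^ 3" using r by (intro divide_right_mono) auto
    finally have B: "cmod (- (4 / (z ^ 4 - 1))) \<le> 8 / r ^ 3" .
    have "tail_kernel R z = 1 / z\<^sup>2" "disc_mean R z = 0" using 3 R by (auto simp: tail_kernel_def disc_mean_def)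
    then show ?thesis using cauchy_disc_unit_steps(3)[OF R 3] A B se by simp
  qed
  then show "cmod (discr_d (cauchy_disc R) z + 4 * tail_kernel R z) \<le> step_error R T z"
    "cmod (discr_dbar (cauchy_disc R) z - 4 * disc_mean R z) \<le> step_error R T z" by auto
qed

lemma borel_measurable_cauchy_disc [measurable]: "cauchy_disc R \<in> borel_measurable borel"
proof -
  have [measurable]: "cnj \<in> borel_measurable borel"
    by (intro borel_measurable_continuous_onI continuous_intros)
  show ?thesis unfolding cauchy_disc_def[abs_def] by measurable
qed

lemma cmod_cauchy_disc_le:
  assumes "R > 0"
  shows "cmod (cauchy_disc R z) \<le> 1 / R"
proof (cases "cmod z \<le> R")
  case True
  then have "cmod (cauchy_disc R z) = cmod z / R\<^sup>2" by (simp add: cauchy_disc_def norm_divide norm_power)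
  also have "\<dots> \<le> R / R\<^sup>2" using True by (intro divide_right_mono) auto
  also have "\<dots> = 1 / R" by (simp add: power2_eq_square)
  finally show ?thesis .
next
  case False
  then show ?thesis using assms by (auto simp: cauchy_disc_def norm_divide intro!: divide_left_mono mult_pos_pos)
qed

text \<open>A single \<open>cauchy_disc\<close> has unbounded support. All the normalised discs have
  the same mass, however, so their transforms coincide with 1/z far out and cancel.\<close>

lemma test_cauchy_disc_diff:
  assumes "0 < R" "R \<le> R'"
  shows "test_fun (\<lambda>z. cauchy_disc R z - cauchy_disc R' z)"
proof (rule testI[where K = "1 / R + 1 / R'" and r = R'])
  show "cmod (cauchy_disc R x - cauchy_disc R' x) \<le> 1 / R + 1 / R'" for x
    using cmod_cauchy_disc_le[of R x] cmod_cauchy_disc_le[of R' x] assms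
    by (intro norm_triangle_le_diff) auto
  show "cmod x \<le> R'" if "cauchy_disc R x - cauchy_disc R' x \<noteq> 0" for x
    using that assms by (auto simp: cauchy_disc_def split: if_splits)
qed measurable

lemma test_tail_kernel_diff:
  assumes "0 < R" "R \<le> R'"
  shows "test_fun (\<lambda>z. tail_kernel R z - tail_kernel R' z)"
proof (rule testI[where K = "1 / R\<^sup>2" and r = R'])
  show "cmod (tail_kernel R x - tail_kernel R' x) \<le> 1 / R\<^sup>2" for x
    using assms by (auto simp: tail_kernel_def norm_divide norm_power intro!: divide_left_mono power_mono mult_pos_pos zero_less_power)
  show "cmod x \<le> R'" if "tail_kernel R x - tail_kernel R' x \<noteq> 0" for x
    using that assms by (auto simp: tail_kernel_def split: if_splits)
qed (unfold tail_kernel_def, measurable)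

lemma test_discr:
  assumes "test_fun g"
  shows "test_fun (discr_d g)" "test_fun (discr_dbar g)"
proof -
  have *: "test_fun (\<lambda>z. g (z + w))" for w using test_translate[OF assms, of "-w"] by simp
  show "test_fun (discr_d g)" "test_fun (discr_dbar g)"
    unfolding discr_d_def[abs_def] discr_dbar_def[abs_def]
    by (intro test_add test_diff test_cmult test_translate[OF assms] *)+
qed

lemma test_step_error:
  assumes "R > 0"
  shows "test_fun (\<lambda>z. of_real (step_error R T z))"
proof -
  have "(\<lambda>z. complex_of_real (step_error R T z)) = (\<lambda>z. of_real (16 / R\<^sup>2) * ind (annulus R 1) z +
    8 * of_real (indicator {z. R < cmod z \<and> cmod z \<le> T} z / cmod z ^ 3))"
    by (simp add: step_error_def fun_eq_iff)
  then show ?thesis using assms by (simp only: test_add test_cmult test_ind_annulus test_tail)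
qed

section \<open>From the tail kernel to disc averages\<close>

context stationary_pp
begin

lemma nrm_step_error: "\<exists>C\<ge>0. \<forall>R\<ge>4. \<forall>T. nrm (\<lambda>z. of_real (step_error R T z)) \<le> C / R"
proof -
  obtain C1 where C1: "C1 \<ge> 0" "\<And>R. R \<ge> 1 \<Longrightarrow> nrm (ind (annulus R 1)) \<le> C1 * R" using nrm_annulus by blast
  obtain C2 where C2: "C2 \<ge> 0" "\<And>R T. R \<ge> 4 \<Longrightarrow>
    nrm (\<lambda>z. of_real (indicator {z. R < cmod z \<and> cmod z \<le> T} z / cmod z ^ 3)) \<le> C2 / R" using nrm_tail by blast
  have "nrm (\<lambda>z. of_real (step_error R T z)) \<le> (16 * C1 + 8 * C2) / R" if R: "R \<ge> 4" for R T
  proof -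
    have eq: "(\<lambda>z. complex_of_real (step_error R T z)) = (\<lambda>z. of_real (16 / R\<^sup>2) * ind (annulus R 1) z +
      8 * of_real (indicator {z. R < cmod z \<and> cmod z \<le> T} z / cmod z ^ 3))"
      by (simp add: step_error_def fun_eq_iff)
    have "nrm (\<lambda>z. of_real (step_error R T z)) \<le> nrm (\<lambda>z. of_real (16 / R\<^sup>2) * ind (annulus R 1) z) +
      nrm (\<lambda>z. 8 * of_real (indicator {z. R < cmod z \<and> cmod z \<le> T} z / cmod z ^ 3))"
      unfolding eq using R by (intro nrm_add test_cmult test_ind_annulus test_tail) auto
    also have "\<dots> = 16 / R\<^sup>2 * nrm (ind (annulus R 1)) +
      8 * nrm (\<lambda>z. of_real (indicator {z. R < cmod z \<and> cmod z \<le> T} z / cmod z ^ 3))"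
      unfolding nrm_cmult norm_of_real by (simp add: norm_numeral)
    also have "\<dots> \<le> 16 / R\<^sup>2 * (C1 * R) + 8 * (C2 / R)"
      using C1(2)[of R] C2(2)[OF R, of T] R by (intro add_mono mult_left_mono) auto
    also have "\<dots> = (16 * C1 + 8 * C2) / R" using R by (simp add: field_simps power2_eq_square)
    finally show ?thesis .
  qed
  then show ?thesis using C1 C2 by (intro exI[of _ "16 * C1 + 8 * C2"]) auto
qed

text \<open>For the potential \<open>g\<close>, up to \<open>step_error\<close>,
  \<open>discr_d g\<close> is -4 times the kernel difference and \<open>discr_dbar g\<close> is 4
  times the difference of disc means. Their seminorms agree by \<open>nrm_dbar_eq_nrm_d\<close>, so
  the kernel of borderline decay is traded for averages known to be Cauchy.\<close>

lemma nrm_tail_kernel_le_disc_mean: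
  "\<exists>C\<ge>0. \<forall>R\<ge>4. \<forall>R'\<ge>R. nrm (\<lambda>z. tail_kernel R z - tail_kernel R' z) \<le>
    nrm (\<lambda>z. disc_mean R z - disc_mean R' z) + C / R"
proof -
  obtain C where C: "C \<ge> 0" "\<And>R T. R \<ge> 4 \<Longrightarrow> nrm (\<lambda>z. of_real (step_error R T z)) \<le> C / R"
    using nrm_step_error by blast
  have "nrm (\<lambda>z. tail_kernel R z - tail_kernel R' z) \<le> nrm (\<lambda>z. disc_mean R z - disc_mean R' z) + C / R"
    if R: "R \<ge> 4" "R' \<ge> R" for R R'
  proof -
    define g where "g = (\<lambda>z. cauchy_disc R z - cauchy_disc R' z)"
    \<comment> \<open>\<open>g\<close> vanishes beyond \<open>R'\<close>, and its differences reach
      one unit further.\<close>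
    define T where "T = R' + 1"
    define E where "E = (\<lambda>z. step_error R T z + step_error R' T z)"
    define k where "k = (\<lambda>z. tail_kernel R z - tail_kernel R' z)"
    define m where "m = (\<lambda>z. disc_mean R z - disc_mean R' z)"
    have g: "test_fun g" unfolding g_def using R by (intro test_cauchy_disc_diff) auto
    have k: "test_fun k" unfolding k_def using R by (intro test_tail_kernel_diff) auto
    have m: "test_fun m" unfolding m_def by (intro test_diff test_disc_mean)
    have Eeq: "(\<lambda>z. complex_of_real (E z)) = (\<lambda>z. of_real (step_error R T z) + of_real (step_error R' T z))"
      by (simp add: E_def)
    have E: "test_fun (\<lambda>z. of_real (E z))" unfolding Eeq using R by (intro test_add test_step_error) auto
    have "nrm (\<lambda>z. of_real (E z)) \<le> C / R + C / R'"
      unfolding Eeq using R by (intro order_trans[OF nrm_add] test_step_error add_mono C(2)) auto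
    also have "C / R' \<le> C / R" using C(1) R by (intro divide_left_mono) auto
    finally have nE: "nrm (\<lambda>z. of_real (E z)) \<le> 2 * C / R" by simp
    have far: "discr_d g z = 0 \<and> discr_dbar g z = 0 \<and> k z = 0 \<and> m z = 0" if z: "cmod z > T" for z
    proof -
      have "cmod (z + 1) \<ge> cmod z - 1" "cmod (z - 1) \<ge> cmod z - 1" "cmod (z + \<i>) \<ge> cmod z - 1" "cmod (z - \<i>) \<ge> cmod z - 1"
        using norm_diff_ineq[of z 1] norm_triangle_ineq2[of z 1] norm_diff_ineq[of z \<i>] norm_triangle_ineq2[of z \<i>] by auto
      moreover have "g w = 0" if "cmod w > R'" for w using that R by (simp add: g_def cauchy_disc_def)
      ultimately have "g (z + 1) = 0" "g (z - 1) = 0" "g (z + \<i>) = 0" "g (z - \<i>) = 0" using z by (auto simp: T_def)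
      then show ?thesis using z R
        by (simp add: discr_d_def discr_dbar_def k_def m_def tail_kernel_def disc_mean_def T_def)
    qed
    have lin: "discr_d g z = discr_d (cauchy_disc R) z - discr_d (cauchy_disc R') z"
      "discr_dbar g z = discr_dbar (cauchy_disc R) z - discr_dbar (cauchy_disc R') z" for z
      by (simp_all add: discr_d_def discr_dbar_def g_def algebra_simps)
    have d: "cmod (discr_d g z + 4 * k z) \<le> E z" and db: "cmod (discr_dbar g z - 4 * m z) \<le> E z" for z
    proof -
      have "cmod (discr_d g z + 4 * k z) \<le> E z \<and> cmod (discr_dbar g z - 4 * m z) \<le> E z"
      proof (cases "cmod z \<le> T")
        case True
        have 1: "discr_d g z + 4 * k z = (discr_d (cauchy_disc R) z + 4 * tail_kernel R z) - (discr_d (cauchy_disc R') z + 4 * tail_kernel R' z)"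
          and 2: "discr_dbar g z - 4 * m z = (discr_dbar (cauchy_disc R) z - 4 * disc_mean R z) - (discr_dbar (cauchy_disc R') z - 4 * disc_mean R' z)"
          by (simp_all add: lin k_def m_def algebra_simps)
        have R2: "R \<ge> 2" "R' \<ge> 2" using R by auto
        show ?thesis unfolding 1 2 E_def
          using norm_triangle_le_diff[OF add_mono[OF cauchy_disc_step_error(1)[OF R2(1) True] cauchy_disc_step_error(1)[OF R2(2) True]]]
            norm_triangle_le_diff[OF add_mono[OF cauchy_disc_step_error(2)[OF R2(1) True] cauchy_disc_step_error(2)[OF R2(2) True]]]
          by blast
      next
        case False
        then show ?thesis using far[of z] step_error_nonneg[of R T z] step_error_nonneg[of R' T z] by (simp add: E_def)
      qed
      then show "cmod (discr_d g z + 4 * k z) \<le> E z" "cmod (discr_dbar g z - 4 * m z) \<le> E z" by auto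
    qed
    have k4: "test_fun (\<lambda>z. 4 * k z)" and m4: "test_fun (\<lambda>z. 4 * m z)" by (intro test_cmult k m)+
    have "4 * nrm k = nrm (\<lambda>z. 4 * k z)" by (simp add: nrm_cmult)
    also have "\<dots> = nrm (\<lambda>z. (discr_d g z + 4 * k z) - discr_d g z)" by simp
    also have "\<dots> \<le> nrm (\<lambda>z. discr_d g z + 4 * k z) + nrm (discr_d g)"
      by (rule nrm_diff[OF test_add[OF test_discr(1)[OF g] k4] test_discr(1)[OF g]])
    also have "nrm (\<lambda>z. discr_d g z + 4 * k z) \<le> nrm (\<lambda>z. of_real (E z))"
      by (rule nrm_mono[OF test_add[OF test_discr(1)[OF g] k4] E d])
    also have "nrm (discr_d g) = nrm (discr_dbar g)"
      unfolding discr_d_def[abs_def] discr_dbar_def[abs_def] by (rule nrm_dbar_eq_nrm_d[OF g])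
    also have "nrm (discr_dbar g) = nrm (\<lambda>z. (discr_dbar g z - 4 * m z) + 4 * m z)" by simp
    also have "\<dots> \<le> nrm (\<lambda>z. discr_dbar g z - 4 * m z) + nrm (\<lambda>z. 4 * m z)"
      by (rule nrm_add[OF test_diff[OF test_discr(2)[OF g] m4] m4])
    also have "nrm (\<lambda>z. discr_dbar g z - 4 * m z) \<le> nrm (\<lambda>z. of_real (E z))"
      by (rule nrm_mono[OF test_diff[OF test_discr(2)[OF g] m4] E db])
    also have "nrm (\<lambda>z. 4 * m z) = 4 * nrm m" by (simp add: nrm_cmult)
    \<comment> \<open>The error enters twice, each time at most \<open>2 * C / R\<close>; division
      by 4 leaves \<open>C / R\<close>.\<close>
    finally have "4 * nrm k \<le> 4 * nrm m + 2 * nrm (\<lambda>z. of_real (E z))" by simp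
    then show ?thesis using nE unfolding k_def[symmetric] m_def[symmetric] by simp
  qed
  then show ?thesis using C(1) by (intro exI[of _ C]) auto
qed

lemma tail_kernel_Cauchy:
  assumes "\<epsilon> > 0"
  shows "\<exists>R0\<ge>1. \<forall>R\<ge>R0. \<forall>R'\<ge>R. nrm (\<lambda>z. tail_kernel R z - tail_kernel R' z) < \<epsilon>"
proof -
  obtain C where C: "C \<ge> 0" "\<And>R R'. R \<ge> 4 \<Longrightarrow> R' \<ge> R \<Longrightarrow> nrm (\<lambda>z. tail_kernel R z - tail_kernel R' z) \<le>
    nrm (\<lambda>z. disc_mean R z - disc_mean R' z) + C / R" using nrm_tail_kernel_le_disc_mean by blast
  obtain R1 where R1: "\<And>R R'. R \<ge> R1 \<Longrightarrow> R' \<ge> R1 \<Longrightarrow> nrm (\<lambda>z. disc_mean R z - disc_mean R' z) < \<epsilon> / 2"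
    using disc_mean_Cauchy[of "\<epsilon> / 2"] assms by auto
  define R0 where "R0 = max (max 4 R1) (2 * C / \<epsilon>)"
  have "nrm (\<lambda>z. tail_kernel R z - tail_kernel R' z) < \<epsilon>" if R: "R \<ge> R0" "R' \<ge> R" for R R'
  proof -
    have R': "R \<ge> 4" "R \<ge> R1" "R \<ge> 2 * C / \<epsilon>" using R by (auto simp: R0_def)
    have "C / R \<le> \<epsilon> / 2" using R' assms by (simp add: field_simps)
    moreover have "nrm (\<lambda>z. disc_mean R z - disc_mean R' z) < \<epsilon> / 2" using R1[of R R'] R' R by simp
    ultimately show ?thesis using C(2)[OF R'(1) R(2)] by linarith
  qed
  moreover have "R0 \<ge> 1" by (simp add: R0_def)
  ultimately show ?thesis by blast
qed

end

section \<open>Convergence of \<open>Psi2\<close> and of the zeta series\<close>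

text \<open>Riesz-Fischer: on a probability space an L2 Cauchy sequence is L1 Cauchy, which supplies
  an almost surely convergent subsequence, and Fatou's lemma controls the L2 distance to its
  limit.\<close>

lemma (in prob_space) L2_complete:
  fixes f :: "nat \<Rightarrow> 'a \<Rightarrow> complex"
  assumes meas [measurable]: "\<And>n. f n \<in> borel_measurable M"
    and int: "\<And>n. integrable M (\<lambda>x. (cmod (f n x))\<^sup>2)"
    and Cauchy: "\<And>\<epsilon>. \<epsilon> > 0 \<Longrightarrow> \<exists>n0. \<forall>m\<ge>n0. \<forall>n\<ge>n0. sqrt (LINT x|M. (cmod (f m x - f n x))\<^sup>2) < \<epsilon>"
  obtains X where "X \<in> borel_measurable M" "integrable M (\<lambda>x. (cmod (X x))\<^sup>2)"
    "(\<lambda>n. sqrt (LINT x|M. (cmod (f n x - X x))\<^sup>2)) \<longlonglongrightarrow> 0"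
proof -
  have intd: "integrable M (\<lambda>x. (cmod (f m x - f n x))\<^sup>2)" for m n
    using Minkowski_L2(1)[of "f m" M "\<lambda>x. - f n x"] int by simp
  have "\<exists>N. \<forall>i\<ge>N. \<forall>j\<ge>N. (LINT x|M. norm (f i x - f j x)) < e" if "e > 0" for e
  proof -
    have "(LINT x|M. cmod (f i x - f j x)) \<le> sqrt (LINT x|M. (cmod (f i x - f j x))\<^sup>2)" for i j
      by (rule L1_le_L2) (use intd in auto)
    then show ?thesis using Cauchy[OF that] by (meson le_less_trans)
  qed
  then obtain r where r: "strict_mono r" "AE x in M. Cauchy (\<lambda>i. f (r i) x)"
    using cauchy_L1_AE_cauchy_subseq[of M f] L1_le_L2(1)[OF meas int] by blast
  define X where "X x = lim (\<lambda>i. f (r i) x)" for x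
  have X [measurable]: "X \<in> borel_measurable M" unfolding X_def by (rule borel_measurable_lim_metric) simp
  have lim: "AE x in M. (\<lambda>i. f (r i) x) \<longlonglongrightarrow> X x"
    using r(2) by eventually_elim (simp add: X_def Cauchy_convergent_iff convergent_LIMSEQ_iff)
  have fatou: "integrable M (\<lambda>x. (cmod (f n x - X x))\<^sup>2) \<and> sqrt (LINT x|M. (cmod (f n x - X x))\<^sup>2) \<le> \<epsilon>"
    if \<epsilon>: "\<epsilon> > 0" and n: "n \<ge> n0" and n0: "\<And>m n. m \<ge> n0 \<Longrightarrow> n \<ge> n0 \<Longrightarrow> sqrt (LINT x|M. (cmod (f m x - f n x))\<^sup>2) < \<epsilon>"
    for \<epsilon> n n0
  proof -
    have "(\<integral>\<^sup>+x. ennreal ((cmod (f n x - X x))\<^sup>2) \<partial>M) = (\<integral>\<^sup>+x. liminf (\<lambda>i. ennreal ((cmod (f n x - f (r i) x))\<^sup>2)) \<partial>M)"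
    proof (rule nn_integral_cong_AE)
      show "AE x in M. ennreal ((cmod (f n x - X x))\<^sup>2) = liminf (\<lambda>i. ennreal ((cmod (f n x - f (r i) x))\<^sup>2))"
        using lim
      proof eventually_elim
        case (elim x)
        then have "(\<lambda>i. ennreal ((cmod (f n x - f (r i) x))\<^sup>2)) \<longlonglongrightarrow> ennreal ((cmod (f n x - X x))\<^sup>2)"
          by (intro tendsto_ennrealI tendsto_intros)
        then show ?case using lim_imp_Liminf[OF sequentially_bot] by metis
      qed
    qed
    also have "\<dots> \<le> liminf (\<lambda>i. \<integral>\<^sup>+x. ennreal ((cmod (f n x - f (r i) x))\<^sup>2) \<partial>M)"
      by (rule nn_integral_liminf) measurable
    also have "\<dots> \<le> limsup (\<lambda>i. \<integral>\<^sup>+x. ennreal ((cmod (f n x - f (r i) x))\<^sup>2) \<partial>M)"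
      by (rule Liminf_le_Limsup) simp
    also have "\<dots> \<le> ennreal (\<epsilon>\<^sup>2)"
    proof (rule Limsup_bounded)
      have "eventually (\<lambda>i. r i \<ge> n0) sequentially"
        using r(1) by (meson eventually_sequentiallyI order_trans seq_suble)
      then show "\<forall>\<^sub>F i in sequentially. (\<integral>\<^sup>+x. ennreal ((cmod (f n x - f (r i) x))\<^sup>2) \<partial>M) \<le> ennreal (\<epsilon>\<^sup>2)"
      proof eventually_elim
        case (elim i)
        have "(LINT x|M. (cmod (f n x - f (r i) x))\<^sup>2) \<le> \<epsilon>\<^sup>2"
          using n0[OF n elim] \<epsilon> by (metis less_eq_real_def real_sqrt_le_iff real_sqrt_abs abs_of_pos)
        then show ?case
          using nn_integral_eq_integral[OF intd, of n "r i"] by (simp add: ennreal_leI)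
      qed
    qed
    finally have fin: "(\<integral>\<^sup>+x. ennreal ((cmod (f n x - X x))\<^sup>2) \<partial>M) \<le> ennreal (\<epsilon>\<^sup>2)" .
    have i: "integrable M (\<lambda>x. (cmod (f n x - X x))\<^sup>2)"
    proof (rule integrableI_bounded)
      show "(\<integral>\<^sup>+x. ennreal (norm ((cmod (f n x - X x))\<^sup>2)) \<partial>M) < \<infinity>"
        using le_less_trans[OF fin ennreal_less_top] by simp
    qed measurable
    have "(LINT x|M. (cmod (f n x - X x))\<^sup>2) \<le> \<epsilon>\<^sup>2"
      using fin nn_integral_eq_integral[OF i] by (simp add: ennreal_le_iff)
    then show ?thesis using i \<epsilon> by (simp add: real_le_lsqrt)
  qed
  have conv: "(\<lambda>n. sqrt (LINT x|M. (cmod (f n x - X x))\<^sup>2)) \<longlonglongrightarrow> 0"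
  proof (rule LIMSEQ_I)
    fix \<epsilon> :: real assume "\<epsilon> > 0"
    then have h: "\<epsilon> / 2 > 0" by simp
    obtain n0 where n0: "\<And>m n. m \<ge> n0 \<Longrightarrow> n \<ge> n0 \<Longrightarrow> sqrt (LINT x|M. (cmod (f m x - f n x))\<^sup>2) < \<epsilon> / 2"
      using Cauchy[OF h] by blast
    have "norm (sqrt (LINT x|M. (cmod (f n x - X x))\<^sup>2) - 0) < \<epsilon>" if "n \<ge> n0" for n
      using fatou[OF h that n0] \<open>\<epsilon> > 0\<close> by (auto simp: integral_nonneg_AE)
    then show "\<exists>n0. \<forall>n\<ge>n0. norm (sqrt (LINT x|M. (cmod (f n x - X x))\<^sup>2) - 0) < \<epsilon>" by blast
  qed
  obtain n0 where n0: "\<And>m n. m \<ge> n0 \<Longrightarrow> n \<ge> n0 \<Longrightarrow> sqrt (LINT x|M. (cmod (f m x - f n x))\<^sup>2) < 1"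
    using Cauchy[of 1] by auto
  have "integrable M (\<lambda>x. (cmod (f n0 x - X x))\<^sup>2)" using fatou[of 1 n0 n0] n0 by auto
  \<comment> \<open>\<open>X\<close> is recovered from \<open>f n0\<close> by subtracting a square
    integrable difference.\<close>
  then have "integrable M (\<lambda>x. (cmod (f n0 x + - (f n0 x - X x)))\<^sup>2)"
    using int[of n0] by (intro Minkowski_L2(1)) (auto simp: norm_minus_commute)
  then have "integrable M (\<lambda>x. (cmod (X x))\<^sup>2)" by simp
  then show ?thesis using that X conv by blast
qed

section \<open>Truncated sums and the L2 limit of \<open>Psi2\<close>\<close>

definition trunc :: "(complex \<Rightarrow> complex) \<Rightarrow> real \<Rightarrow> complex \<Rightarrow> complex" where
  "trunc f R l = (if 1 \<le> cmod l \<and> cmod l \<le> R then f l else 0)"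

lemma bsupp_trunc:
  assumes [measurable]: "f \<in> borel_measurable borel"
  shows "bsupp (trunc f R)"
proof -
  have "bounded {x. trunc f R x \<noteq> 0}" by (rule boundedI[of _ R]) (auto simp: trunc_def split: if_splits)
  moreover have "trunc f R \<in> borel_measurable borel" unfolding trunc_def[abs_def] by measurable
  ultimately show ?thesis by (simp add: bsupp_def)
qed

lemma test_trunc:
  assumes "f \<in> borel_measurable borel" "\<And>l. 1 \<le> cmod l \<Longrightarrow> cmod (f l) \<le> 1"
  shows "test_fun (trunc f R)"
  unfolding test_fun_def using assms bsupp_trunc by (auto simp: trunc_def intro!: exI[of _ 1])

context stationary_pp
begin

lemma N_trunc:
  assumes "\<omega> \<in> space M"
  shows "N (trunc f R) \<omega> = (\<Sum>l\<in>(\<Lambda> \<omega> - ball 0 1) \<inter> cball 0 R. f l)"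
proof -
  have "N (trunc f R) \<omega> = (\<Sum>l\<in>\<Lambda> \<omega> \<inter> {l. 1 \<le> cmod l \<and> cmod l \<le> R}. trunc f R l)"
    by (rule N_eq[OF assms]) (auto simp: trunc_def split: if_splits intro: boundedI[of _ R])
  also have "\<dots> = (\<Sum>l\<in>\<Lambda> \<omega> \<inter> {l. 1 \<le> cmod l \<and> cmod l \<le> R}. f l)"
    by (intro sum.cong) (auto simp: trunc_def)
  also have "\<Lambda> \<omega> \<inter> {l. 1 \<le> cmod l \<and> cmod l \<le> R} = (\<Lambda> \<omega> - ball 0 1) \<inter> cball 0 R" by auto
  finally show ?thesis .
qed

lemma Psi2_eq: "\<omega> \<in> space M \<Longrightarrow> Psi2 \<Lambda> R \<omega> = N (trunc (\<lambda>l. 1 / l\<^sup>2) R) \<omega>"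
  unfolding N_trunc Psi2_def by (intro sum.cong) auto

lemma test_psi: "test_fun (trunc (\<lambda>l. 1 / l\<^sup>2) R)"
proof (rule test_trunc)
  show "cmod (1 / l\<^sup>2) \<le> 1" if "1 \<le> cmod l" for l
    using that by (simp add: norm_divide norm_power divide_le_eq_1 one_le_power)
qed measurable

lemma borel_measurable_Psi2: "Psi2 \<Lambda> R \<in> borel_measurable M"
  by (rule measurable_cong[THEN iffD2, OF Psi2_eq measurable_N[OF test_bsupp[OF test_psi]]])

lemma integrable_Psi2_sq: "integrable M (\<lambda>\<omega>. (cmod (Psi2 \<Lambda> R \<omega>))\<^sup>2)"
  using integrable_N_sq[OF test_psi, of R] by (subst Bochner_Integration.integrable_cong[OF refl]) (simp_all add: Psi2_eq)

text \<open>For radii at least 1 the tail kernels do not meet the inner cutoff in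
  \<open>Psi2\<close>. The sign reversed in passing from discs to tails is absorbed by
  \<open>nrm_commute\<close>.\<close>

lemma Psi2_diff_L2:
  assumes "1 \<le> R" "1 \<le> R'"
  shows "sqrt (LINT \<omega>|M. (cmod (Psi2 \<Lambda> R \<omega> - Psi2 \<Lambda> R' \<omega>))\<^sup>2) = nrm (\<lambda>z. tail_kernel R z - tail_kernel R' z)"
proof -
  have "(\<lambda>z. tail_kernel R' z - tail_kernel R z) = (\<lambda>l. trunc (\<lambda>l. 1 / l\<^sup>2) R l - trunc (\<lambda>l. 1 / l\<^sup>2) R' l)"
    using assms by (auto simp: fun_eq_iff trunc_def tail_kernel_def)
  then have "nrm (\<lambda>z. tail_kernel R z - tail_kernel R' z) = nrm (\<lambda>l. trunc (\<lambda>l. 1 / l\<^sup>2) R l - trunc (\<lambda>l. 1 / l\<^sup>2) R' l)"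
    by (subst nrm_commute) simp
  also have "\<dots> = sqrt (LINT \<omega>|M. (cmod (Psi2 \<Lambda> R \<omega> - Psi2 \<Lambda> R' \<omega>))\<^sup>2)"
    unfolding nrm_def
    by (intro arg_cong[where f=sqrt] Bochner_Integration.integral_cong refl)
       (simp add: Psi2_eq N_diff test_bsupp[OF test_psi])
  finally show ?thesis by simp
qed

text \<open>The choice operator in \<open>Psi2_inf\<close> yields a genuine limit only once one
  exists. The limit is determined just up to a null set, so later arguments rely on these three
  properties.\<close>

lemma Psi2_inf_props:
  "Psi2_inf M \<Lambda> \<in> borel_measurable M"
  "integrable M (\<lambda>\<omega>. (cmod (Psi2_inf M \<Lambda> \<omega>))\<^sup>2)"
  "((\<lambda>R. LINT \<omega>|M. (cmod (Psi2 \<Lambda> R \<omega> - Psi2_inf M \<Lambda> \<omega>))\<^sup>2) \<longlongrightarrow> 0) at_top"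
proof -
  have Cauchy: "\<exists>R0\<ge>1. \<forall>R\<ge>R0. \<forall>R'\<ge>R0. sqrt (LINT \<omega>|M. (cmod (Psi2 \<Lambda> R \<omega> - Psi2 \<Lambda> R' \<omega>))\<^sup>2) < \<epsilon>"
    if \<epsilon>: "\<epsilon> > 0" for \<epsilon>
  proof -
    obtain R0 where R0: "R0 \<ge> 1" "\<And>R R'. R \<ge> R0 \<Longrightarrow> R' \<ge> R \<Longrightarrow> nrm (\<lambda>z. tail_kernel R z - tail_kernel R' z) < \<epsilon>"
      using tail_kernel_Cauchy[OF \<epsilon>] by blast
    have "nrm (\<lambda>z. tail_kernel R z - tail_kernel R' z) < \<epsilon>" if "R \<ge> R0" "R' \<ge> R0" for R R'
      using R0(2)[of R R'] R0(2)[of R' R] that nrm_commute[of "tail_kernel R" "tail_kernel R'"] by linarith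
    then show ?thesis using R0(1) Psi2_diff_L2 by (intro exI[of _ R0]) auto
  qed
  \<comment> \<open>Completeness concerns sequences, so integer radii come first; the Cauchy
    property over real radii then extends the limit to all \<open>R\<close>.\<close>
  have "\<exists>n0. \<forall>m\<ge>n0. \<forall>n\<ge>n0. sqrt (LINT \<omega>|M. (cmod (Psi2 \<Lambda> (real m) \<omega> - Psi2 \<Lambda> (real n) \<omega>))\<^sup>2) < \<epsilon>"
    if \<epsilon>: "\<epsilon> > 0" for \<epsilon>
  proof -
    obtain R0 where R0: "\<And>R R'. R \<ge> R0 \<Longrightarrow> R' \<ge> R0 \<Longrightarrow> sqrt (LINT \<omega>|M. (cmod (Psi2 \<Lambda> R \<omega> - Psi2 \<Lambda> R' \<omega>))\<^sup>2) < \<epsilon>"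
      using Cauchy[OF \<epsilon>] by blast
    have "real m \<ge> R0" if "m \<ge> nat \<lceil>R0\<rceil>" for m using that by linarith
    then show ?thesis using R0 by (intro exI[of _ "nat \<lceil>R0\<rceil>"]) auto
  qed
  then obtain X where X [measurable]: "X \<in> borel_measurable M" and iX: "integrable M (\<lambda>\<omega>. (cmod (X \<omega>))\<^sup>2)"
    and lim: "(\<lambda>n. sqrt (LINT \<omega>|M. (cmod (Psi2 \<Lambda> (real n) \<omega> - X \<omega>))\<^sup>2)) \<longlonglongrightarrow> 0"
    using L2_complete[of "\<lambda>n. Psi2 \<Lambda> (real n)", OF borel_measurable_Psi2 integrable_Psi2_sq] by blast
  have [measurable]: "Psi2 \<Lambda> R \<in> borel_measurable M" for R by (rule borel_measurable_Psi2)
  have iPX: "integrable M (\<lambda>\<omega>. (cmod (Psi2 \<Lambda> R \<omega> - X \<omega>))\<^sup>2)" for R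
    using Minkowski_L2(1)[of "Psi2 \<Lambda> R" M "\<lambda>\<omega>. - X \<omega>"] integrable_Psi2_sq iX by simp
  have iPP: "integrable M (\<lambda>\<omega>. (cmod (Psi2 \<Lambda> R \<omega> - Psi2 \<Lambda> R' \<omega>))\<^sup>2)" for R R'
    using Minkowski_L2(1)[of "Psi2 \<Lambda> R" M "\<lambda>\<omega>. - Psi2 \<Lambda> R' \<omega>"] integrable_Psi2_sq by simp
  have lim': "((\<lambda>R. sqrt (LINT \<omega>|M. (cmod (Psi2 \<Lambda> R \<omega> - X \<omega>))\<^sup>2)) \<longlongrightarrow> 0) at_top"
  proof (rule tendstoI)
    fix \<epsilon> :: real assume "\<epsilon> > 0"
    then have h: "\<epsilon> / 2 > 0" by simp
    obtain R0 where R0: "\<And>R R'. R \<ge> R0 \<Longrightarrow> R' \<ge> R0 \<Longrightarrow> sqrt (LINT \<omega>|M. (cmod (Psi2 \<Lambda> R \<omega> - Psi2 \<Lambda> R' \<omega>))\<^sup>2) < \<epsilon> / 2"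
      using Cauchy[OF h] by blast
    obtain n0 where n0: "\<And>n. n \<ge> n0 \<Longrightarrow> sqrt (LINT \<omega>|M. (cmod (Psi2 \<Lambda> (real n) \<omega> - X \<omega>))\<^sup>2) < \<epsilon> / 2"
      using order_tendstoD(2)[OF lim h] by (auto simp: eventually_sequentially)
    define n where "n = max n0 (nat \<lceil>R0\<rceil>)"
    have n: "n \<ge> n0" "real n \<ge> R0" unfolding n_def by linarith+
    have "sqrt (LINT \<omega>|M. (cmod (Psi2 \<Lambda> R \<omega> - X \<omega>))\<^sup>2) < \<epsilon>" if "R \<ge> R0" for R
    proof -
      have "sqrt (LINT \<omega>|M. (cmod ((Psi2 \<Lambda> R \<omega> - Psi2 \<Lambda> (real n) \<omega>) + (Psi2 \<Lambda> (real n) \<omega> - X \<omega>)))\<^sup>2) \<le>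
        sqrt (LINT \<omega>|M. (cmod (Psi2 \<Lambda> R \<omega> - Psi2 \<Lambda> (real n) \<omega>))\<^sup>2) + sqrt (LINT \<omega>|M. (cmod (Psi2 \<Lambda> (real n) \<omega> - X \<omega>))\<^sup>2)"
        by (rule Minkowski_L2(2)) (use iPX iPP in auto)
      also have "\<dots> < \<epsilon> / 2 + \<epsilon> / 2" by (intro add_strict_mono R0 n0 n that)
      finally show ?thesis by simp
    qed
    then show "\<forall>\<^sub>F R in at_top. dist (sqrt (LINT \<omega>|M. (cmod (Psi2 \<Lambda> R \<omega> - X \<omega>))\<^sup>2)) 0 < \<epsilon>"
      by (auto simp: eventually_at_top_linorder integral_nonneg_AE)
  qed
  have "((\<lambda>R. (sqrt (LINT \<omega>|M. (cmod (Psi2 \<Lambda> R \<omega> - X \<omega>))\<^sup>2))\<^sup>2) \<longlongrightarrow> 0\<^sup>2) at_top"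
    by (intro tendsto_intros lim')
  then have "((\<lambda>R. LINT \<omega>|M. (cmod (Psi2 \<Lambda> R \<omega> - X \<omega>))\<^sup>2) \<longlongrightarrow> 0) at_top"
    by (simp add: integral_nonneg_AE)
  with X iX have "\<exists>X. X \<in> borel_measurable M \<and> integrable M (\<lambda>\<omega>. (cmod (X \<omega>))\<^sup>2) \<and>
      ((\<lambda>R. LINT \<omega>|M. (cmod (Psi2 \<Lambda> R \<omega> - X \<omega>))\<^sup>2) \<longlongrightarrow> 0) at_top" by blast
  from someI_ex[OF this]
  show "Psi2_inf M \<Lambda> \<in> borel_measurable M"
    "integrable M (\<lambda>\<omega>. (cmod (Psi2_inf M \<Lambda> \<omega>))\<^sup>2)"
    "((\<lambda>R. LINT \<omega>|M. (cmod (Psi2 \<Lambda> R \<omega> - Psi2_inf M \<Lambda> \<omega>))\<^sup>2) \<longlongrightarrow> 0) at_top"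
    unfolding Psi2_inf_def by blast+
qed

section \<open>Summability and measurability of the outer series\<close>

lemma finite_outer_points: "\<omega> \<in> space M \<Longrightarrow> finite ((\<Lambda> \<omega> - ball 0 1) \<inter> cball 0 R)"
  using finite_points[of \<omega> "cball 0 R"] by (rule finite_subset[rotated]) auto

lemma N_trunc_norm:
  assumes "\<omega> \<in> space M"
  shows "N (trunc (\<lambda>l. of_real (cmod (f l))) R) \<omega> = of_real (\<Sum>l\<in>(\<Lambda> \<omega> - ball 0 1) \<inter> cball 0 R. cmod (f l))"
  using N_trunc[OF assms] by simp

text \<open>For complex terms unconditional and absolute summability coincide, and any finite set of
  points lies in a disc of integer radius. Summability thus becomes a condition on countably many
  truncated statistics.\<close>

lemma summable_outer_iff:
  fixes f :: "complex \<Rightarrow> complex"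
  assumes \<omega>: "\<omega> \<in> space M"
  shows "f summable_on (\<Lambda> \<omega> - ball 0 1) \<longleftrightarrow>
    (\<exists>K::nat. \<forall>n::nat. cmod (N (trunc (\<lambda>l. of_real (cmod (f l))) (real n)) \<omega>) \<le> real K)"
proof -
  let ?A = "\<Lambda> \<omega> - ball 0 1"
  have e: "cmod (N (trunc (\<lambda>l. of_real (cmod (f l))) R) \<omega>) = (\<Sum>l\<in>?A \<inter> cball 0 R. cmod (f l))" for R
    unfolding N_trunc_norm[OF \<omega>] by (simp add: sum_nonneg del: of_real_sum)
  have "f summable_on ?A \<longleftrightarrow> bdd_above (sum (\<lambda>x. norm (f x)) ` {F. F \<subseteq> ?A \<and> finite F})"
    unfolding summable_on_iff_abs_summable_on_complex by (rule abs_summable_iff_bdd_above)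
  also have "\<dots> \<longleftrightarrow> (\<exists>K::nat. \<forall>n::nat. (\<Sum>l\<in>?A \<inter> cball 0 (real n). cmod (f l)) \<le> real K)"
  proof
    assume "bdd_above (sum (\<lambda>x. norm (f x)) ` {F. F \<subseteq> ?A \<and> finite F})"
    then obtain B where B: "\<And>F. F \<subseteq> ?A \<Longrightarrow> finite F \<Longrightarrow> (\<Sum>x\<in>F. cmod (f x)) \<le> B"
      by (auto simp: bdd_above_def)
    obtain K :: nat where "B \<le> real K" using real_arch_simple by blast
    then show "\<exists>K::nat. \<forall>n::nat. (\<Sum>l\<in>?A \<inter> cball 0 (real n). cmod (f l)) \<le> real K"
      using B finite_outer_points[OF \<omega>] by (meson Int_lower1 order_trans)
  next
    assume "\<exists>K::nat. \<forall>n::nat. (\<Sum>l\<in>?A \<inter> cball 0 (real n). cmod (f l)) \<le> real K"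
    then obtain K :: nat where K: "\<And>n::nat. (\<Sum>l\<in>?A \<inter> cball 0 (real n). cmod (f l)) \<le> real K" by blast
    have "(\<Sum>x\<in>F. cmod (f x)) \<le> real K" if F: "F \<subseteq> ?A" "finite F" for F
    proof -
      have "bounded F" using F(2) by (rule finite_imp_bounded)
      then obtain r where r: "\<And>x. x \<in> F \<Longrightarrow> cmod x \<le> r" by (auto simp: bounded_iff)
      obtain n :: nat where n: "r \<le> real n" using real_arch_simple by blast
      have "(\<Sum>x\<in>F. cmod (f x)) \<le> (\<Sum>l\<in>?A \<inter> cball 0 (real n). cmod (f l))"
        using F(1) order_trans[OF r n] by (intro sum_mono2 finite_outer_points[OF \<omega>]) auto
      then show ?thesis using K[of n] by linarith
    qed
    then show "bdd_above (sum (\<lambda>x. norm (f x)) ` {F. F \<subseteq> ?A \<and> finite F})"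
      by (intro bdd_aboveI2[of _ _ "real K"]) auto
  qed
  finally show ?thesis unfolding e .
qed

text \<open>The points in growing discs form finite sets that eventually contain any given finite
  set, so they run cofinally through the net defining the unordered sum.\<close>

lemma N_trunc_tendsto_infsum:
  fixes f :: "complex \<Rightarrow> complex"
  assumes \<omega>: "\<omega> \<in> space M" and f: "f summable_on (\<Lambda> \<omega> - ball 0 1)"
    and r: "filterlim r at_top sequentially"
  shows "(\<lambda>n. N (trunc f (r n)) \<omega>) \<longlonglongrightarrow> (\<Sum>\<^sub>\<infinity>l\<in>\<Lambda> \<omega> - ball 0 1. f l)"
proof -
  let ?A = "\<Lambda> \<omega> - ball 0 1"
  have "(sum f \<longlongrightarrow> infsum f ?A) (finite_subsets_at_top ?A)"
    using has_sum_infsum[OF f] by (simp add: has_sum_def)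
  moreover have "filterlim (\<lambda>n. ?A \<inter> cball 0 (r n)) (finite_subsets_at_top ?A) sequentially"
  proof (subst filterlim_finite_subsets_at_top, intro allI impI)
    fix X assume X: "finite X \<and> X \<subseteq> ?A"
    then obtain b where b: "\<And>x. x \<in> X \<Longrightarrow> cmod x \<le> b"
      using finite_imp_bounded[of X] by (auto simp: bounded_iff)
    have "\<forall>\<^sub>F n in sequentially. r n \<ge> b" using r by (simp add: filterlim_at_top)
    then show "\<forall>\<^sub>F n in sequentially. finite (?A \<inter> cball 0 (r n)) \<and> X \<subseteq> ?A \<inter> cball 0 (r n) \<and> ?A \<inter> cball 0 (r n) \<subseteq> ?A"
    proof eventually_elim
      case (elim n)
      show ?case using X order_trans[OF b elim] finite_outer_points[OF \<omega>] by auto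
    qed
  qed
  ultimately have "(\<lambda>n. sum f (?A \<inter> cball 0 (r n))) \<longlonglongrightarrow> infsum f ?A"
    by (rule filterlim_compose)
  then show ?thesis by (simp add: N_trunc[OF \<omega>])
qed

text \<open>\<open>infsum\<close> is 0 where the family is not summable; hence the function is
  defined by cases on a measurable event, with a limit of truncated sums on that event.\<close>

lemma borel_measurable_infsum_outer:
  fixes f :: "complex \<Rightarrow> complex"
  assumes [measurable]: "f \<in> borel_measurable borel"
  shows "(\<lambda>\<omega>. \<Sum>\<^sub>\<infinity>l\<in>\<Lambda> \<omega> - ball 0 1. f l) \<in> borel_measurable M"
proof -
  define a where "a n \<omega> = N (trunc f (real n)) \<omega>" for n \<omega>
  define b where "b n \<omega> = cmod (N (trunc (\<lambda>l. of_real (cmod (f l))) (real n)) \<omega>)" for n \<omega>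
  have [measurable]: "a n \<in> borel_measurable M" for n
    unfolding a_def by (intro measurable_N bsupp_trunc) measurable
  have "N (trunc (\<lambda>l. of_real (cmod (f l))) (real n)) \<in> borel_measurable M" for n
    by (intro measurable_N bsupp_trunc) measurable
  then have [measurable]: "b n \<in> borel_measurable M" for n unfolding b_def by measurable
  have "(\<Sum>\<^sub>\<infinity>l\<in>\<Lambda> \<omega> - ball 0 1. f l) = (if \<exists>K::nat. \<forall>n. b n \<omega> \<le> real K then lim (\<lambda>n. a n \<omega>) else 0)"
    if \<omega>: "\<omega> \<in> space M" for \<omega>
  proof (cases "f summable_on (\<Lambda> \<omega> - ball 0 1)")
    case True
    then have "\<exists>K::nat. \<forall>n. b n \<omega> \<le> real K" unfolding b_def summable_outer_iff[OF \<omega>] by blast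
    moreover have "(\<lambda>n. a n \<omega>) \<longlonglongrightarrow> (\<Sum>\<^sub>\<infinity>l\<in>\<Lambda> \<omega> - ball 0 1. f l)"
      unfolding a_def by (rule N_trunc_tendsto_infsum[OF \<omega> True filterlim_real_sequentially])
    ultimately show ?thesis by (simp add: limI)
  next
    case False
    then have "\<not> (\<exists>K::nat. \<forall>n. b n \<omega> \<le> real K)" unfolding b_def summable_outer_iff[OF \<omega>] .
    then show ?thesis using False by (simp only: infsum_not_exists[OF False] if_False)
  qed
  moreover have "(\<lambda>\<omega>. if \<exists>K::nat. \<forall>n. b n \<omega> \<le> real K then lim (\<lambda>n. a n \<omega>) else 0) \<in> borel_measurable M"
    by measurable
  ultimately show ?thesis by (subst measurable_cong) auto
qed

text \<open>\<open>nrm_tail\<close> bounds the expected partial sums of |l|^-3 uniformly, and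
  monotone convergence makes the full sum finite almost surely.\<close>

lemma AE_summable_inverse_cube: "AE \<omega> in M. (\<lambda>l. 1 / l ^ 3) summable_on (\<Lambda> \<omega> - ball 0 1)"
proof -
  define h where "h l = complex_of_real (cmod (1 / l ^ 3))" for l :: complex
  have hm [measurable]: "h \<in> borel_measurable borel" unfolding h_def by measurable
  have h1: "cmod (h l) \<le> 1" if "1 \<le> cmod l" for l
    using that by (simp add: h_def norm_divide norm_power divide_le_eq_1 one_le_power)
  have t: "test_fun (trunc h R)" for R by (rule test_trunc[OF hm h1])
  define b where "b n \<omega> = cmod (N (trunc h (real n)) \<omega>)" for n \<omega>
  have [measurable]: "b n \<in> borel_measurable M" for n
    unfolding b_def using measurable_N[OF test_bsupp[OF t]] by measurable
  obtain C where C: "C \<ge> 0" "\<And>R T. R \<ge> 4 \<Longrightarrow>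
    nrm (\<lambda>z. of_real (indicator {z. R < cmod z \<and> cmod z \<le> T} z / cmod z ^ 3)) \<le> C / R" using nrm_tail by blast
  \<comment> \<open>The disc of radius 4 is split off because \<open>nrm_tail\<close> applies from
    there on.\<close>
  define K where "K = nrm (trunc h 4) + C / 4"
  have bound: "nrm (trunc h (real n)) \<le> K" if n: "n \<ge> 4" for n
  proof -
    have "trunc h (real n) = (\<lambda>z. trunc h 4 z + of_real (indicator {z. 4 < cmod z \<and> cmod z \<le> real n} z / cmod z ^ 3))"
      using n by (auto simp: fun_eq_iff trunc_def h_def norm_divide norm_power)
    then have "nrm (trunc h (real n)) \<le> nrm (trunc h 4) + nrm (\<lambda>z. of_real (indicator {z. 4 < cmod z \<and> cmod z \<le> real n} z / cmod z ^ 3))"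
      using nrm_add[OF t test_tail[of 4 "real n"], of 4] by simp
    then show ?thesis using C(2)[of 4 "real n"] by (simp add: K_def)
  qed
  have bmono: "b m \<omega> \<le> b n \<omega>" if "\<omega> \<in> space M" "m \<le> n" for m n \<omega>
    unfolding b_def h_def N_trunc_norm[OF that(1)]
    using that(2) by (simp only: norm_of_real, subst (1 2) abs_of_nonneg)
      (auto intro!: sum_nonneg sum_mono2 finite_outer_points[OF that(1)])
  have "(\<integral>\<^sup>+\<omega>. (SUP n. ennreal (b n \<omega>)) \<partial>M) = (SUP n. \<integral>\<^sup>+\<omega>. ennreal (b n \<omega>) \<partial>M)"
    by (rule nn_integral_monotone_convergence_SUP_AE) (auto intro!: AE_I2 ennreal_leI bmono)
  also have "\<dots> \<le> ennreal K"
  proof (rule SUP_least)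
    fix n :: nat
    have "(\<integral>\<^sup>+\<omega>. ennreal (b n \<omega>) \<partial>M) \<le> (\<integral>\<^sup>+\<omega>. ennreal (b (n + 4) \<omega>) \<partial>M)"
      by (intro nn_integral_mono ennreal_leI bmono) auto
    also have "\<dots> = ennreal (LINT \<omega>|M. b (n + 4) \<omega>)"
      unfolding b_def using expectation_N_le(1)[OF t] by (intro nn_integral_eq_integral integrable_norm) auto
    also have "\<dots> \<le> ennreal K"
      using expectation_N_le(2)[OF t, of "real (n + 4)"] bound[of "n + 4"] by (intro ennreal_leI) (simp add: b_def)
    finally show "(\<integral>\<^sup>+\<omega>. ennreal (b n \<omega>) \<partial>M) \<le> ennreal K" .
  qed
  finally have "(\<integral>\<^sup>+\<omega>. (SUP n. ennreal (b n \<omega>)) \<partial>M) \<noteq> \<infinity>"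
    by (metis ennreal_neq_top infinity_ennreal_def neq_top_trans)
  then have "AE \<omega> in M. (SUP n. ennreal (b n \<omega>)) \<noteq> \<infinity>"
    by (intro nn_integral_PInf_AE) auto
  then show ?thesis
    using AE_space
  proof eventually_elim
    case (elim \<omega>)
    then obtain B where B: "(SUP n. ennreal (b n \<omega>)) = ennreal B" "B \<ge> 0"
      by (cases "SUP n. ennreal (b n \<omega>)") auto
    obtain k :: nat where k: "B \<le> real k" using real_arch_simple by blast
    have "b n \<omega> \<le> real k" for n
    proof -
      have "ennreal (b n \<omega>) \<le> ennreal B" unfolding B(1)[symmetric] by (rule SUP_upper) simp
      then show ?thesis using B(2) k by (simp add: ennreal_le_iff)
    qed
    then show ?case unfolding summable_outer_iff[OF elim(2)] b_def h_def by blast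
  qed
qed

end

section \<open>Stationarity of the increments\<close>

definition zeta_term :: "complex \<Rightarrow> complex \<Rightarrow> complex" where
  "zeta_term z l = 1 / (z - l) + 1 / l + z / l\<^sup>2"

lemma borel_measurable_zeta_term [measurable]: "zeta_term z \<in> borel_measurable borel"
  unfolding zeta_term_def[abs_def] by measurable

text \<open>The three terms combine to z^2 / (l^2 (z - l)), and |l| at least 2|z| gives |z - l| at
  least |l|/2. The added 1 keeps \<open>l\<close> away from 0.\<close>

lemma cmod_zeta_term_le:
  assumes "cmod l \<ge> 2 * cmod z + 1"
  shows "cmod (zeta_term z l) \<le> cmod (of_real (2 * (cmod z)\<^sup>2) * (1 / l ^ 3))"
proof -
  have "cmod l > 0" using assms norm_ge_zero[of z] by linarith
  then have l: "cmod l > 0" "l \<noteq> 0" by auto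
  have d: "cmod (z - l) \<ge> cmod l / 2"
    using norm_triangle_ineq2[of l z] assms by (simp add: norm_minus_commute)
  then have zl: "z - l \<noteq> 0" using l by auto
  have "zeta_term z l = z\<^sup>2 / (l\<^sup>2 * (z - l))"
    using l zl unfolding zeta_term_def by (simp add: divide_simps) (simp add: algebra_simps power2_eq_square)
  then have "cmod (zeta_term z l) = (cmod z)\<^sup>2 / ((cmod l)\<^sup>2 * cmod (z - l))"
    by (simp add: norm_divide norm_mult norm_power)
  also have "\<dots> \<le> (cmod z)\<^sup>2 / ((cmod l)\<^sup>2 * (cmod l / 2))"
    using l d by (intro divide_left_mono mult_left_mono mult_pos_pos) auto
  also have "\<dots> = cmod (of_real (2 * (cmod z)\<^sup>2) * (1 / l ^ 3))"
    by (simp add: norm_divide norm_mult norm_power power2_eq_square power3_eq_cube)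
  finally show ?thesis .
qed

text \<open>With \<open>1 / 0 = 0\<close> this kernel is translation equivariant also at the poles, so realisations with
  \<open>z \<in> \<Lambda>\<close> need no separate treatment.\<close>

definition increment_kernel :: "complex \<Rightarrow> complex \<Rightarrow> complex \<Rightarrow> complex" where
  "increment_kernel a z l = 1 / (z + a - l) - 1 / (z - l)"

text \<open>The cutoff is centred at the origin and not at \<open>z\<close>; it is the one part of
  the kernel that does not follow a translation.\<close>

definition disc_kernel :: "complex \<Rightarrow> complex \<Rightarrow> real \<Rightarrow> complex \<Rightarrow> complex" where
  "disc_kernel a z R l = (if cmod l \<le> R then increment_kernel a z l else 0)"

lemma bsupp_disc_kernel: "bsupp (disc_kernel a z R)"
proof -
  have "bounded {x. disc_kernel a z R x \<noteq> 0}"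
    by (rule boundedI[of _ R]) (auto simp: disc_kernel_def split: if_splits)
  moreover have "disc_kernel a z R \<in> borel_measurable borel"
    unfolding disc_kernel_def[abs_def] increment_kernel_def by measurable
  ultimately show ?thesis by (simp add: bsupp_def)
qed

text \<open>By equivariance the kernels differ only where exactly one of \<open>l\<close> and
  \<open>l + w\<close> lies in the disc. In the annulus the increment is -a / ((z + a - l) (z - l)),
  and the lower bound on \<open>R\<close> makes both factors at least R/2 in modulus.\<close>

lemma disc_kernel_translate_diff:
  assumes R: "R \<ge> 2 * (cmod w + cmod z + cmod a) + 1"
  shows "cmod (disc_kernel a (z + w) R (l + w) - disc_kernel a z R l) \<le>
    4 * cmod a / R\<^sup>2 * indicator (annulus R (cmod w)) l"
proof (cases "l \<in> annulus R (cmod w)")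
  case True
  have "cmod w + cmod z + cmod a \<ge> 0" by simp
  then have Rpos: "R > 0" using R by argo
  have l: "cmod l \<ge> R - cmod w" using True unfolding annulus_def mem_Collect_eq by linarith
  have z1: "cmod (z - l) \<ge> R / 2"
    using norm_triangle_ineq2[of l z] l R norm_ge_zero[of a] norm_ge_zero[of w] norm_minus_commute[of z l] by argo
  have z2: "cmod (z + a - l) \<ge> R / 2"
    using norm_triangle_ineq2[of l "z + a"] norm_triangle_ineq[of z a] l R norm_ge_zero[of w]
      norm_minus_commute[of "z + a" l] by argo
  have nz: "z - l \<noteq> 0" "z + a - l \<noteq> 0" using z1 z2 Rpos by auto
  have "increment_kernel a z l = - a / ((z + a - l) * (z - l))"
    using nz by (simp add: increment_kernel_def divide_simps)
  then have "cmod (increment_kernel a z l) = cmod a / (cmod (z + a - l) * cmod (z - l))"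
    by (simp add: norm_divide norm_mult)
  also have "\<dots> \<le> cmod a / ((R / 2) * (R / 2))"
    using z1 z2 Rpos nz by (intro divide_left_mono mult_mono mult_pos_pos) auto
  also have "\<dots> = 4 * cmod a / R\<^sup>2" by (simp add: power2_eq_square)
  finally have i: "cmod (increment_kernel a z l) \<le> 4 * cmod a / R\<^sup>2" .
  have "increment_kernel a (z + w) (l + w) = increment_kernel a z l"
    by (simp add: increment_kernel_def algebra_simps)
  then show ?thesis using i True by (simp add: disc_kernel_def)
next
  case False
  have "increment_kernel a (z + w) (l + w) = increment_kernel a z l"
    by (simp add: increment_kernel_def algebra_simps)
  moreover have "cmod (l + w) \<le> R \<longleftrightarrow> cmod l \<le> R"
    using False norm_triangle_ineq[of l w] norm_diff_ineq[of l w] unfolding annulus_def mem_Collect_eq by linarith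
  ultimately show ?thesis using False by (simp add: disc_kernel_def)
qed

context stationary_pp
begin

lemma zeta_pp_eq:
  assumes "\<omega> \<in> space M"
  shows "zeta_pp M \<Lambda> z \<omega> = N (\<lambda>l. if cmod l < 1 then 1 / (z - l) else 0) \<omega>
    + (\<Sum>\<^sub>\<infinity>l\<in>\<Lambda> \<omega> - ball 0 1. zeta_term z l) - Psi2_inf M \<Lambda> \<omega> * z"
proof -
  have "N (\<lambda>l. if cmod l < 1 then 1 / (z - l) else 0) \<omega> = (\<Sum>l\<in>\<Lambda> \<omega> \<inter> ball 0 1. if cmod l < 1 then 1 / (z - l) else 0)"
    by (rule N_eq[OF assms]) (auto split: if_splits)
  also have "\<dots> = (\<Sum>l\<in>\<Lambda> \<omega> \<inter> ball 0 1. 1 / (z - l))" by (intro sum.cong) auto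
  finally show ?thesis by (simp add: zeta_pp_def zeta_term_def)
qed

lemma borel_measurable_zeta_pp: "zeta_pp M \<Lambda> z \<in> borel_measurable M"
proof -
  have "bsupp (\<lambda>l. if cmod l < 1 then 1 / (z - l) else 0)"
  proof -
    have "bounded {l. (if cmod l < 1 then 1 / (z - l) else 0) \<noteq> 0}"
      by (rule boundedI[of _ 1]) (auto split: if_splits)
    then show ?thesis by (simp add: bsupp_def)
  qed
  then have [measurable]: "N (\<lambda>l. if cmod l < 1 then 1 / (z - l) else 0) \<in> borel_measurable M"
    by (rule measurable_N)
  have [measurable]: "(\<lambda>\<omega>. \<Sum>\<^sub>\<infinity>l\<in>\<Lambda> \<omega> - ball 0 1. zeta_term z l) \<in> borel_measurable M"
    by (rule borel_measurable_infsum_outer) measurable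
  have [measurable]: "Psi2_inf M \<Lambda> \<in> borel_measurable M" by (rule Psi2_inf_props)
  show ?thesis by (subst measurable_cong[OF zeta_pp_eq]) measurable
qed

lemma summable_zeta_term:
  assumes \<omega>: "\<omega> \<in> space M" and s: "(\<lambda>l. 1 / l ^ 3) summable_on (\<Lambda> \<omega> - ball 0 1)"
  shows "zeta_term z summable_on (\<Lambda> \<omega> - ball 0 1)"
proof -
  let ?A = "\<Lambda> \<omega> - ball 0 1" and ?r = "2 * cmod z + 1"
  have "(\<lambda>l. of_real (2 * (cmod z)\<^sup>2) * (1 / l ^ 3)) summable_on (?A - cball 0 ?r)"
    by (intro summable_on_cmult_right summable_on_subset[OF s]) auto
  then have "zeta_term z summable_on (?A - cball 0 ?r)"
    unfolding summable_on_iff_abs_summable_on_complex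
  proof (rule Infinite_Sum.abs_summable_on_comparison_test)
    show "cmod (zeta_term z l) \<le> cmod (of_real (2 * (cmod z)\<^sup>2) * (1 / l ^ 3))" if "l \<in> ?A - cball 0 ?r" for l
      using that by (intro cmod_zeta_term_le) simp
  qed
  moreover have "zeta_term z summable_on (?A \<inter> cball 0 ?r)"
    by (rule summable_on_finite[OF finite_outer_points[OF \<omega>]])
  ultimately have "zeta_term z summable_on ((?A - cball 0 ?r) \<union> (?A \<inter> cball 0 ?r))"
    by (rule summable_on_union)
  then show ?thesis by (simp add: Un_Diff_Int Un_commute)
qed

text \<open>The linear term of the increment cancels, so that the increment is a limit of sums over discs
  of a kernel which is equivariant under translations.\<close>

lemma N_disc_kernel_tendsto:
  assumes \<omega>: "\<omega> \<in> space M" and s: "(\<lambda>l. 1 / l ^ 3) summable_on (\<Lambda> \<omega> - ball 0 1)"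
    and r: "filterlim r at_top sequentially"
    and psi: "(\<lambda>n. Psi2 \<Lambda> (r n) \<omega>) \<longlonglongrightarrow> Psi2_inf M \<Lambda> \<omega>"
  shows "(\<lambda>n. N (disc_kernel a z (r n)) \<omega>) \<longlonglongrightarrow> zeta_pp M \<Lambda> (z + a) \<omega> - zeta_pp M \<Lambda> z \<omega>"
proof -
  let ?A = "\<Lambda> \<omega> - ball 0 1"
  define I where "I z = (\<Sum>l\<in>\<Lambda> \<omega> \<inter> ball 0 1. 1 / (z - l))" for z
  define X where "X = Psi2_inf M \<Lambda> \<omega>"
  have lim: "(\<lambda>n. I (z + a) - I z + N (trunc (zeta_term (z + a)) (r n)) \<omega> - N (trunc (zeta_term z) (r n)) \<omega> - a * Psi2 \<Lambda> (r n) \<omega>)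
    \<longlonglongrightarrow> I (z + a) - I z + (\<Sum>\<^sub>\<infinity>l\<in>?A. zeta_term (z + a) l) - (\<Sum>\<^sub>\<infinity>l\<in>?A. zeta_term z l) - a * X"
    unfolding X_def by (intro tendsto_intros N_trunc_tendsto_infsum summable_zeta_term \<omega> s r psi)
  have "I (z + a) - I z + (\<Sum>\<^sub>\<infinity>l\<in>?A. zeta_term (z + a) l) - (\<Sum>\<^sub>\<infinity>l\<in>?A. zeta_term z l) - a * X =
    zeta_pp M \<Lambda> (z + a) \<omega> - zeta_pp M \<Lambda> z \<omega>"
    by (simp add: zeta_pp_def zeta_term_def I_def X_def algebra_simps)
  note lim = lim[unfolded this]
  have "\<forall>\<^sub>F n in sequentially. r n \<ge> 1" using r by (simp add: filterlim_at_top)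
  then have "\<forall>\<^sub>F n in sequentially. I (z + a) - I z + N (trunc (zeta_term (z + a)) (r n)) \<omega> -
    N (trunc (zeta_term z) (r n)) \<omega> - a * Psi2 \<Lambda> (r n) \<omega> = N (disc_kernel a z (r n)) \<omega>"
  proof eventually_elim
    case (elim n)
    have "N (disc_kernel a z (r n)) \<omega> = (\<Sum>l\<in>\<Lambda> \<omega> \<inter> cball 0 (r n). disc_kernel a z (r n) l)"
      by (rule N_eq[OF \<omega>]) (auto simp: disc_kernel_def split: if_splits)
    also have "\<dots> = (\<Sum>l\<in>\<Lambda> \<omega> \<inter> cball 0 (r n). increment_kernel a z l)"
      by (intro sum.cong) (auto simp: disc_kernel_def)
    also have "\<Lambda> \<omega> \<inter> cball 0 (r n) = (\<Lambda> \<omega> \<inter> ball 0 1) \<union> (?A \<inter> cball 0 (r n))" using elim by auto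
    also have "(\<Sum>l\<in>(\<Lambda> \<omega> \<inter> ball 0 1) \<union> (?A \<inter> cball 0 (r n)). increment_kernel a z l) =
      (\<Sum>l\<in>\<Lambda> \<omega> \<inter> ball 0 1. increment_kernel a z l) + (\<Sum>l\<in>?A \<inter> cball 0 (r n). increment_kernel a z l)"
      by (intro sum.union_disjoint finite_points[OF \<omega>] finite_outer_points[OF \<omega>]) auto
    also have "(\<Sum>l\<in>\<Lambda> \<omega> \<inter> ball 0 1. increment_kernel a z l) = I (z + a) - I z"
      by (simp add: I_def increment_kernel_def sum_subtractf)
    also have "(\<Sum>l\<in>?A \<inter> cball 0 (r n). increment_kernel a z l) =
      (\<Sum>l\<in>?A \<inter> cball 0 (r n). zeta_term (z + a) l - zeta_term z l - a * (1 / l\<^sup>2))"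
      by (intro sum.cong refl) (simp add: increment_kernel_def zeta_term_def add_divide_distrib)
    also have "\<dots> = N (trunc (zeta_term (z + a)) (r n)) \<omega> - N (trunc (zeta_term z) (r n)) \<omega> - a * Psi2 \<Lambda> (r n) \<omega>"
      by (simp add: N_trunc[OF \<omega>] Psi2_eq[OF \<omega>] sum_subtractf sum_distrib_left)
    finally show ?case by simp
  qed
  then show ?thesis using lim by (rule Lim_transform_eventually[rotated])
qed

text \<open>Convergence in mean gives almost sure convergence only along a subsequence. Adding the
  two nonnegative errors first lets one subsequence serve both, and it is chosen without reference
  to any evaluation point, so it suits all of them at once.\<close>

lemma good_radii:
  "\<exists>r::nat \<Rightarrow> nat. strict_mono r \<and>
    (AE \<omega> in M. (\<lambda>k. Psi2 \<Lambda> (real (r k)) \<omega>) \<longlonglongrightarrow> Psi2_inf M \<Lambda> \<omega>) \<and>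
    (AE \<omega> in M. (\<lambda>k. cmod (N (ind (annulus (real (r k)) w)) \<omega>) / (real (r k))\<^sup>2) \<longlonglongrightarrow> 0)"
proof -
  define X where "X = Psi2_inf M \<Lambda>"
  have [measurable]: "Psi2 \<Lambda> R \<in> borel_measurable M" for R by (rule borel_measurable_Psi2)
  have [measurable]: "X \<in> borel_measurable M" unfolding X_def by (rule Psi2_inf_props)
  define d where "d n \<omega> = cmod (Psi2 \<Lambda> (real n) \<omega> - X \<omega>)" for n \<omega>
  define e where "e n \<omega> = cmod (N (ind (annulus (real n) w)) \<omega>) / (real n)\<^sup>2" for n \<omega>
  have sq: "integrable M (\<lambda>\<omega>. (cmod (Psi2 \<Lambda> R \<omega> - X \<omega>))\<^sup>2)" for R
    using Minkowski_L2(1)[of "Psi2 \<Lambda> R" M "\<lambda>\<omega>. - X \<omega>"] integrable_Psi2_sq Psi2_inf_props(2)[folded X_def] by simp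
  have di: "integrable M (d n)" for n
    unfolding d_def by (intro integrable_norm L1_le_L2(1) sq) measurable
  have ei: "integrable M (e n)" for n
    unfolding e_def using expectation_N_le(1)[OF test_ind_annulus] by simp
  have dlim: "(\<lambda>n. LINT \<omega>|M. d n \<omega>) \<longlonglongrightarrow> 0"
  proof (rule tendsto_sandwich[OF _ _ tendsto_const])
    have "((\<lambda>R. sqrt (LINT \<omega>|M. (cmod (Psi2 \<Lambda> R \<omega> - X \<omega>))\<^sup>2)) \<longlongrightarrow> sqrt 0) at_top"
      unfolding X_def by (intro tendsto_intros Psi2_inf_props(3))
    then show "(\<lambda>n. sqrt (LINT \<omega>|M. (cmod (Psi2 \<Lambda> (real n) \<omega> - X \<omega>))\<^sup>2)) \<longlonglongrightarrow> 0"
      using filterlim_compose[OF _ filterlim_real_sequentially] by fastforce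
    show "\<forall>\<^sub>F n in sequentially. (LINT \<omega>|M. d n \<omega>) \<le> sqrt (LINT \<omega>|M. (cmod (Psi2 \<Lambda> (real n) \<omega> - X \<omega>))\<^sup>2)"
      unfolding d_def by (intro always_eventually allI L1_le_L2(2) sq) measurable
  qed (auto simp: d_def)
  obtain C where C: "C \<ge> 0" "\<And>R. R \<ge> 1 \<Longrightarrow> nrm (ind (annulus R w)) \<le> C * R" using nrm_annulus by blast
  have elim: "(\<lambda>n. LINT \<omega>|M. e n \<omega>) \<longlonglongrightarrow> 0"
  proof (rule tendsto_sandwich[OF _ _ tendsto_const])
    show "(\<lambda>n. C / real n) \<longlonglongrightarrow> 0" by real_asymp
    have "(LINT \<omega>|M. e n \<omega>) \<le> C / real n" if "n \<ge> 1" for n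
    proof -
      have "(LINT \<omega>|M. e n \<omega>) = (LINT \<omega>|M. cmod (N (ind (annulus (real n) w)) \<omega>)) / (real n)\<^sup>2"
        by (simp add: e_def)
      also have "\<dots> \<le> (C * real n) / (real n)\<^sup>2"
        using order_trans[OF expectation_N_le(2)[OF test_ind_annulus] C(2)[of "real n"]] that
        by (intro divide_right_mono) auto
      also have "\<dots> = C / real n" using that by (simp add: power2_eq_square)
      finally show ?thesis .
    qed
    then show "\<forall>\<^sub>F n in sequentially. (LINT \<omega>|M. e n \<omega>) \<le> C / real n"
      by (rule eventually_sequentiallyI)
  qed (auto simp: e_def)
  have "(\<lambda>n. LINT \<omega>|M. norm (d n \<omega> + e n \<omega>)) \<longlonglongrightarrow> 0"
  proof -
    have "(LINT \<omega>|M. norm (d n \<omega> + e n \<omega>)) = (LINT \<omega>|M. d n \<omega>) + (LINT \<omega>|M. e n \<omega>)" for n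
    proof -
      have "norm (d n \<omega> + e n \<omega>) = d n \<omega> + e n \<omega>" for \<omega> by (simp add: d_def e_def)
      then show ?thesis using di ei by simp
    qed
    then show ?thesis using tendsto_add[OF dlim elim] by simp
  qed
  then obtain r where r: "strict_mono r" and lim: "AE \<omega> in M. (\<lambda>k. d (r k) \<omega> + e (r k) \<omega>) \<longlonglongrightarrow> 0"
    using tendsto_L1_AE_subseq[of M "\<lambda>n \<omega>. d n \<omega> + e n \<omega>"] di ei by auto
  have "AE \<omega> in M. (\<lambda>k. Psi2 \<Lambda> (real (r k)) \<omega>) \<longlonglongrightarrow> X \<omega>"
    using lim
  proof eventually_elim
    case (elim \<omega>)
    have "(\<lambda>k. d (r k) \<omega>) \<longlonglongrightarrow> 0"
      by (rule tendsto_sandwich[OF _ _ tendsto_const elim]) (auto simp: d_def e_def)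
    then show ?case unfolding d_def by (simp add: LIM_zero_iff tendsto_norm_zero_iff)
  qed
  moreover have "AE \<omega> in M. (\<lambda>k. e (r k) \<omega>) \<longlonglongrightarrow> 0"
    using lim
  proof eventually_elim
    case (elim \<omega>)
    show ?case by (rule tendsto_sandwich[OF _ _ tendsto_const elim]) (auto simp: d_def e_def)
  qed
  ultimately show ?thesis using r unfolding X_def e_def by blast
qed

text \<open>By stationarity, for each \<open>k\<close> the kernels at \<open>zs i + w\<close> and
  their translates by \<open>w\<close> give the same joint law. The first sequence tends to the
  increments at \<open>zs i + w\<close>; the second, asymptotically that of the kernels at
  \<open>zs i\<close>, tends to the increments there.\<close>

lemma zeta_increment_law:
  fixes zs :: "nat \<Rightarrow> complex" and n :: nat
  shows
  "distr M (PiM {..<n} (\<lambda>_. borel)) (\<lambda>\<omega>. restrict (\<lambda>i. zeta_pp M \<Lambda> (zs i + w + a) \<omega> - zeta_pp M \<Lambda> (zs i + w) \<omega>) {..<n})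
    = distr M (PiM {..<n} (\<lambda>_. borel)) (\<lambda>\<omega>. restrict (\<lambda>i. zeta_pp M \<Lambda> (zs i + a) \<omega> - zeta_pp M \<Lambda> (zs i) \<omega>) {..<n})"
proof -
  obtain r :: "nat \<Rightarrow> nat" where r: "strict_mono r"
    and psi: "AE \<omega> in M. (\<lambda>k. Psi2 \<Lambda> (real (r k)) \<omega>) \<longlonglongrightarrow> Psi2_inf M \<Lambda> \<omega>"
    and ann: "AE \<omega> in M. (\<lambda>k. cmod (N (ind (annulus (real (r k)) (cmod w))) \<omega>) / (real (r k))\<^sup>2) \<longlonglongrightarrow> 0"
    using good_radii[of "cmod w"] by blast
  have rtop: "filterlim (\<lambda>k. real (r k)) at_top sequentially"
    by (rule filterlim_compose[OF filterlim_real_sequentially filterlim_subseq[OF r]])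
  define \<phi> where "\<phi> k i = disc_kernel a (zs i + w) (real (r k))" for k i
  have \<phi>: "bsupp (\<phi> k i)" for k i unfolding \<phi>_def by (rule bsupp_disc_kernel)
  have \<phi>t: "bsupp (\<lambda>l. \<phi> k i (l + w))" for k i using bsupp_translate[OF \<phi>, of k i "-w"] by simp
  have conv: "AE \<omega> in M. (\<lambda>k. N (disc_kernel a z (real (r k))) \<omega>) \<longlonglongrightarrow> zeta_pp M \<Lambda> (z + a) \<omega> - zeta_pp M \<Lambda> z \<omega>" for z
    using AE_summable_inverse_cube psi AE_space
    by eventually_elim (rule N_disc_kernel_tendsto[OF _ _ rtop])
  \<comment> \<open>Summing \<open>disc_kernel_translate_diff\<close> over the points leaves a
    multiple of the annulus count over R^2, which tends to 0 along the chosen radii.\<close>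
  have diff: "AE \<omega> in M. (\<lambda>k. N (\<lambda>l. disc_kernel a (z + w) (real (r k)) (l + w)) \<omega> - N (disc_kernel a z (real (r k))) \<omega>) \<longlonglongrightarrow> 0" for z
    using ann AE_space
  proof eventually_elim
    case (elim \<omega>)
    show ?case
    proof (rule Lim_null_comparison)
      show "(\<lambda>k. 4 * cmod a * (cmod (N (ind (annulus (real (r k)) (cmod w))) \<omega>) / (real (r k))\<^sup>2)) \<longlonglongrightarrow> 0"
        using tendsto_mult_right_zero[OF elim(1)] by simp
      have "\<forall>\<^sub>F k in sequentially. real (r k) \<ge> 2 * (cmod w + cmod z + cmod a) + 1"
        using rtop by (simp add: filterlim_at_top)
      then show "\<forall>\<^sub>F k in sequentially. norm (N (\<lambda>l. disc_kernel a (z + w) (real (r k)) (l + w)) \<omega> - N (disc_kernel a z (real (r k))) \<omega>) \<le>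
        4 * cmod a * (cmod (N (ind (annulus (real (r k)) (cmod w))) \<omega>) / (real (r k))\<^sup>2)"
      proof eventually_elim
        case k: (elim k)
        define R where "R = real (r k)"
        have b1: "bsupp (\<lambda>l. disc_kernel a (z + w) R (l + w))"
          using bsupp_translate[OF bsupp_disc_kernel, of a "z + w" R "-w"] by simp
        have b2: "bsupp (\<lambda>l. disc_kernel a (z + w) R (l + w) - disc_kernel a z R l)"
          using bsupp_add[OF b1 bsupp_cmult[OF bsupp_disc_kernel], of "-1" a z R] by simp
        have eq: "(\<lambda>l. complex_of_real (4 * cmod a / R\<^sup>2 * indicator (annulus R (cmod w)) l)) =
          (\<lambda>l. of_real (4 * cmod a / R\<^sup>2) * ind (annulus R (cmod w)) l)" by simp
        have "cmod (N (\<lambda>l. disc_kernel a (z + w) R (l + w)) \<omega> - N (disc_kernel a z R) \<omega>) =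
          cmod (N (\<lambda>l. disc_kernel a (z + w) R (l + w) - disc_kernel a z R l) \<omega>)"
          by (simp add: N_diff[OF elim(2) b1 bsupp_disc_kernel])
        also have "\<dots> \<le> cmod (N (\<lambda>l. of_real (4 * cmod a / R\<^sup>2 * indicator (annulus R (cmod w)) l)) \<omega>)"
        proof (rule cmod_N_le[OF elim(2) b2])
          show "bsupp (\<lambda>l. of_real (4 * cmod a / R\<^sup>2 * indicator (annulus R (cmod w)) l))"
            unfolding eq by (intro bsupp_cmult test_bsupp test_ind_annulus)
          show "cmod (disc_kernel a (z + w) R (x + w) - disc_kernel a z R x) \<le> 4 * cmod a / R\<^sup>2 * indicator (annulus R (cmod w)) x" for x
            using k unfolding R_def by (rule disc_kernel_translate_diff)
        qed
        also have "\<dots> = 4 * cmod a * (cmod (N (ind (annulus R (cmod w))) \<omega>) / R\<^sup>2)"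
          unfolding eq N_cmult norm_mult norm_of_real by simp
        finally show ?case by (simp add: R_def)
      qed
    qed
  qed
  have conv': "AE \<omega> in M. (\<lambda>k. N (\<lambda>l. disc_kernel a (z + w) (real (r k)) (l + w)) \<omega>) \<longlonglongrightarrow> zeta_pp M \<Lambda> (z + a) \<omega> - zeta_pp M \<Lambda> z \<omega>" for z
    using conv[of z] diff[of z]
  proof eventually_elim
    case (elim \<omega>)
    show ?case using tendsto_add[OF elim(2) elim(1)] by simp
  qed
  have meas: "(\<lambda>\<omega>. restrict (\<lambda>i. zeta_pp M \<Lambda> (f i + a) \<omega> - zeta_pp M \<Lambda> (f i) \<omega>) {..<n}) \<in> measurable M (PiM {..<n} (\<lambda>_. borel))" for f
    by (intro measurable_restrict borel_measurable_diff borel_measurable_zeta_pp)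
  show ?thesis
  proof (rule distr_eq_limit[where Xs = "\<lambda>k \<omega>. restrict (\<lambda>i. N (\<phi> k i) \<omega>) {..<n}"
        and Ys = "\<lambda>k \<omega>. restrict (\<lambda>i. N (\<lambda>l. \<phi> k i (l + w)) \<omega>) {..<n}"])
    show "prob_space M" by unfold_locales
    show "(\<lambda>\<omega>. restrict (\<lambda>i. N (\<phi> k i) \<omega>) {..<n}) \<in> measurable M (PiM {..<n} (\<lambda>_. borel))"
      "(\<lambda>\<omega>. restrict (\<lambda>i. N (\<lambda>l. \<phi> k i (l + w)) \<omega>) {..<n}) \<in> measurable M (PiM {..<n} (\<lambda>_. borel))" for k
      by (intro measurable_N_tuple \<phi> \<phi>t)+
    show "distr M (PiM {..<n} (\<lambda>_. borel)) (\<lambda>\<omega>. restrict (\<lambda>i. N (\<phi> k i) \<omega>) {..<n}) =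
      distr M (PiM {..<n} (\<lambda>_. borel)) (\<lambda>\<omega>. restrict (\<lambda>i. N (\<lambda>l. \<phi> k i (l + w)) \<omega>) {..<n})" for k
      using law_N_translate[of n "\<phi> k" "-w"] \<phi> by simp
    show "AE \<omega> in M. (\<lambda>k. restrict (\<lambda>i. N (\<phi> k i) \<omega>) {..<n} i) \<longlonglongrightarrow>
      restrict (\<lambda>i. zeta_pp M \<Lambda> (zs i + w + a) \<omega> - zeta_pp M \<Lambda> (zs i + w) \<omega>) {..<n} i" if "i < n" for i
      using conv[of "zs i + w"] that by (simp add: \<phi>_def)
    show "AE \<omega> in M. (\<lambda>k. restrict (\<lambda>i. N (\<lambda>l. \<phi> k i (l + w)) \<omega>) {..<n} i) \<longlonglongrightarrow>
      restrict (\<lambda>i. zeta_pp M \<Lambda> (zs i + a) \<omega> - zeta_pp M \<Lambda> (zs i) \<omega>) {..<n} i" if "i < n" for i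
      using conv'[of "zs i"] that by (simp add: \<phi>_def)
  qed (rule meas)+
qed

end

theorem theorem1:
  fixes M :: "'w measure" and \<Lambda> :: "'w \<Rightarrow> complex set"
  assumes "prob_space M"
    and "point_process M \<Lambda>"
    and "stationary_point_process M \<Lambda>"
    and "finite_second_moment M \<Lambda>"
  shows "\<forall>a. stationary_random_fun M (\<lambda>z \<omega>. zeta_pp M \<Lambda> (z + a) \<omega> - zeta_pp M \<Lambda> z \<omega>)"
proof -
  interpret stationary_pp M \<Lambda>
    using assms by (intro stationary_pp.intro stationary_pp_axioms.intro)
  show ?thesis
    unfolding stationary_random_fun_def using zeta_increment_law by blast
qed

end
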